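(* Let $m,n\in\mathbb{N}$ with $m\le n$. Let $\mathcal{O}$ be the ring of integers of a number field $K$, and let $\zeta_K$ be the Dedekind zeta function of $K$. Then $$\zeta_{G_{m,n}(\mathcal{O})}(s)=\prod_{i=0}^{m-1}\frac{\zeta_K(s-n-i)}{\zeta_K(s-i)}$$ (as an identity of Dirichlet series), where $\zeta_{G_{m,n}(\mathcal{O})}(s)$ is the twist representation zeta function of $G_{m,n}(\mathcal{O})$.
   Context: $\mathbb{N}$ is the set of positive integers. The group scheme $G_{m,n}$: let $\Lambda_{m,n}$ be the $\mathbb{Z}$-Lie lattice with $\mathbb{Z}$-basis $x_1,\dots,x_{m+n}$, $z_{ij}$ ($1\le i\le m$, $1\le j\le n$) and brackets $[x_i,x_{m+j}]=z_{ij}$, all brackets not following formally from these being zero. $G_{m,n}$ is the unipotent group scheme associated with the class-2 nilpotent Lie lattice $\Lambda_{m,n}$ (group commutators $xyx^{-1}y^{-1}$ are given by Lie brackets). Concretely, for a commutative ring $R$, $G_{m,n}(R)$ is the set $R^m\times R^n\times \mathrm{Mat}_{m\times n}(R)$ with multiplication $(a,b,c)(a',b',c')=(a+a',\,b+b',\,c+c'+a\,(b')^{T})$, where $a,b$ are column vectors. Twist representation zeta function: for a group $G$ and $i\in\mathbb{N}$, $\mathrm{Irr}_i(G)$ is the set of characters of irreducible complex representations of $G$ of dimension $i$. Two characters $\theta_1,\theta_2\in\mathrm{Irr}_i(G)$ are twist equivalent, $\theta_1\sim\theta_2$, if $\theta_1=\chi\theta_2$ for some $\chi\in\mathrm{Irr}_1(G)$.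 Put $\tilde a_i(G)=\#(\mathrm{Irr}_i(G)/\sim)$. If all $\tilde a_i(G)$ are finite (which is the case for torsion-free finitely generated nilpotent groups), define $\zeta_G(s)=\sum_{i\in\mathbb{N}}\tilde a_i(G)\,i^{-s}$. *)

theory Defs
  imports
    "HOL-Computational_Algebra.Polynomial"
    "HOL-Library.FuncSet"
    "HOL-Algebra.QuotRing"
    "Jordan_Normal_Form.VS_Connect"
begin

section \<open>Formal Dirichlet series\<close>

text \<open>
  An element of \<open>fds\<close> stands for the series \<open>\<Sum>k\<ge>1. a k * k powr (-s)\<close> with complex
  coefficients. The coefficient at index 0 has no meaning and is normalised to 0.
\<close>

typedef fds = "{a :: nat \<Rightarrow> complex. a 0 = 0}"
  morphisms fds_nth Abs_fds
  by auto

definition fds :: "(nat \<Rightarrow> complex) \<Rightarrow> fds" where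
  "fds a = Abs_fds (\<lambda>k. if k = 0 then 0 else a k)"

lemma fds_nth_0 [simp]: "fds_nth f 0 = 0"
  using fds_nth[of f] by simp

lemma fds_nth_fds: "fds_nth (fds a) k = (if k = 0 then 0 else a k)"
  unfolding fds_def by (subst Abs_fds_inverse) auto

lemma fds_eqI: "(\<And>k. k > 0 \<Longrightarrow> fds_nth f k = fds_nth g k) \<Longrightarrow> f = g"
  by (metis fds_nth_0 fds_nth_inject ext gr0I)

fun fds_inverse_coeff :: "(nat \<Rightarrow> complex) \<Rightarrow> nat \<Rightarrow> complex" where
  "fds_inverse_coeff a k =
     (if k = 0 then 0 else if k = 1 then inverse (a 1)
      else - inverse (a 1) * (\<Sum>d | d dvd k \<and> d < k. fds_inverse_coeff a d * a (k div d)))"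

declare fds_inverse_coeff.simps [simp del]

instantiation fds :: "{comm_ring_1, inverse}"
begin

definition zero_fds :: fds where "0 = fds (\<lambda>_. 0)"
definition one_fds :: fds where "1 = fds (\<lambda>k. if k = 1 then 1 else 0)"
definition plus_fds :: "fds \<Rightarrow> fds \<Rightarrow> fds" where
  "f + g = fds (\<lambda>k. fds_nth f k + fds_nth g k)"
definition minus_fds :: "fds \<Rightarrow> fds \<Rightarrow> fds" where
  "f - g = fds (\<lambda>k. fds_nth f k - fds_nth g k)"
definition uminus_fds :: "fds \<Rightarrow> fds" where
  "- f = fds (\<lambda>k. - fds_nth f k)"
definition times_fds :: "fds \<Rightarrow> fds \<Rightarrow> fds" where
  "f * g = fds (\<lambda>k. \<Sum>d | d dvd k. fds_nth f d * fds_nth g (k div d))"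

text \<open>
  A formal Dirichlet series is invertible iff its first coefficient is nonzero; the inverse
  of the remaining ones is 0. The series divided by below are zeta functions (and shifts of
  them) whose first coefficient is 1.
\<close>

definition inverse_fds :: "fds \<Rightarrow> fds" where
  "inverse f = fds (fds_inverse_coeff (fds_nth f))"
definition divide_fds :: "fds \<Rightarrow> fds \<Rightarrow> fds" where
  "f div g = f * inverse (g :: fds)"

instance
proof
  fix f g h :: fds
  show "f * g * h = f * (g * h)"
  proof (rule fds_eqI)
    fix k :: nat assume k: "k > 0"
    have "fds_nth (f * g * h) k =
      (\<Sum>d | d dvd k. \<Sum>e | e dvd d. fds_nth f e * fds_nth g (d div e) * fds_nth h (k div d))"
      using k by (auto simp: times_fds_def fds_nth_fds sum_distrib_right intro!: sum.cong)
    also have "\<dots> = (\<Sum>(d, e) \<in> (SIGMA d:{d. d dvd k}. {e. e dvd d}).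
        fds_nth f e * fds_nth g (d div e) * fds_nth h (k div d))"
    proof (rule sum.Sigma)
      show "finite {d. d dvd k}" using k by simp
      show "\<forall>d\<in>{d. d dvd k}. finite {e. e dvd d}"
        using k by (auto intro!: finite_divisors_nat dest: dvd_pos_nat)
    qed
    also have "\<dots> = (\<Sum>(e, d) \<in> (SIGMA e:{e. e dvd k}. {d. d dvd k div e}).
        fds_nth f e * (fds_nth g d * fds_nth h (k div e div d)))"
    proof (rule sum.reindex_bij_witness[of _ "\<lambda>(e, d). (e * d, e)" "\<lambda>(d, e). (e, d div e)"], goal_cases)
      case (1 x)
      thus ?case by auto
    next
      case (2 x)
      thus ?case by (auto intro: dvd_trans div_dvd_div[THEN iffD2])
    next
      case (3 x)
      thus ?case using k by (auto simp: dvd_pos_nat)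
    next
      case (4 x)
      thus ?case using k by (auto simp: dvd_div_iff_mult mult.commute)
    next
      case (5 x)
      thus ?case by (auto simp: div_mult2_eq[symmetric] mult.assoc)
    qed
    also have "\<dots> = (\<Sum>e | e dvd k. \<Sum>d | d dvd k div e.
        fds_nth f e * (fds_nth g d * fds_nth h (k div e div d)))"
    proof (rule sum.Sigma[symmetric])
      show "finite {d. d dvd k}" using k by simp
      show "\<forall>e\<in>{d. d dvd k}. finite {d. d dvd k div e}"
        using k by (auto intro!: finite_divisors_nat dest: dvd_imp_le)
    qed
    also have "\<dots> = fds_nth (f * (g * h)) k"
      using k by (auto simp: times_fds_def fds_nth_fds sum_distrib_left intro!: sum.cong)
    finally show "fds_nth (f * g * h) k = fds_nth (f * (g * h)) k" .
  qed
  show "f * g = g * f"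
  proof (rule fds_eqI)
    fix k :: nat assume k: "k > 0"
    show "fds_nth (f * g) k = fds_nth (g * f) k"
      using k unfolding times_fds_def fds_nth_fds
      by (auto intro!: sum.reindex_bij_witness[of _ "\<lambda>d. k div d" "\<lambda>d. k div d"])
  qed
  show "1 * f = f"
  proof (rule fds_eqI)
    fix k :: nat assume k: "k > 0"
    have "fds_nth (1 * f) k = (\<Sum>d | d dvd k. fds_nth 1 d * fds_nth f (k div d))"
      using k by (simp add: times_fds_def fds_nth_fds)
    also have "\<dots> = (\<Sum>d | d dvd k. if d = 1 then fds_nth f k else 0)"
      by (rule sum.cong) (auto simp: one_fds_def fds_nth_fds)
    finally have "fds_nth (1 * f) k = (\<Sum>d | d dvd k. if d = 1 then fds_nth f k else 0)" .
    thus "fds_nth (1 * f) k = fds_nth f k" using k by simp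
  qed
  show "(f + g) * h = f * h + g * h"
  proof (rule fds_eqI)
    fix k :: nat assume k: "k > 0"
    have "fds_nth ((f + g) * h) k = (\<Sum>d | d dvd k. fds_nth (f + g) d * fds_nth h (k div d))"
      using k by (simp add: times_fds_def fds_nth_fds)
    also have "\<dots> = (\<Sum>d | d dvd k. fds_nth f d * fds_nth h (k div d) + fds_nth g d * fds_nth h (k div d))"
      by (rule sum.cong) (simp_all add: plus_fds_def fds_nth_fds distrib_right)
    also have "\<dots> = fds_nth (f * h + g * h) k"
      using k by (simp add: times_fds_def plus_fds_def fds_nth_fds sum.distrib)
    finally show "fds_nth ((f + g) * h) k = fds_nth (f * h + g * h) k" .
  qed
  show "(0 :: fds) \<noteq> 1"
  proof
    assume "(0 :: fds) = 1"
    hence "fds_nth 0 1 = fds_nth 1 1" by simp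
    thus False by (simp add: zero_fds_def one_fds_def fds_nth_fds)
  qed
qed (auto intro!: fds_eqI simp: plus_fds_def minus_fds_def uminus_fds_def zero_fds_def fds_nth_fds)

end

lemma fds_inverse:
  assumes "fds_nth f 1 \<noteq> 0"
  shows "inverse f * f = 1"
proof (rule fds_eqI)
  fix k :: nat assume k: "k > 0"
  let ?b = "fds_inverse_coeff (fds_nth f)"
  have *: "fds_nth (inverse f * f) k = (\<Sum>d | d dvd k. ?b d * fds_nth f (k div d))"
    using k unfolding times_fds_def inverse_fds_def fds_nth_fds
    by (auto simp: fds_inverse_coeff.simps[of _ 0] intro!: sum.cong)
  show "fds_nth (inverse f * f) k = fds_nth 1 k"
  proof (cases "k = 1")
    case True
    have "?b 1 = inverse (fds_nth f 1)"
      by (subst fds_inverse_coeff.simps) simp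
    thus ?thesis using assms True unfolding * by (simp add: one_fds_def fds_nth_fds)
  next
    case False
    have "{d. d dvd k} = insert k {d. d dvd k \<and> d < k}"
      using k by (auto dest: dvd_imp_le)
    hence "(\<Sum>d | d dvd k. ?b d * fds_nth f (k div d)) =
        ?b k * fds_nth f 1 + (\<Sum>d | d dvd k \<and> d < k. ?b d * fds_nth f (k div d))"
      using k by (simp add: sum.insert)
    also have "\<dots> = 0"
      using assms False k by (subst fds_inverse_coeff.simps) (simp add: field_simps)
    finally show ?thesis using False k unfolding * by (simp add: one_fds_def fds_nth_fds)
  qed
qed

text \<open>The substitution of \<open>s - c\<close> for \<open>s\<close>, since \<open>k powr (-(s - c)) = k ^ c * k powr (-s)\<close>.\<close>

definition fds_shift :: "nat \<Rightarrow> fds \<Rightarrow> fds" where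
  "fds_shift c f = fds (\<lambda>k. of_nat k ^ c * fds_nth f k)"


section \<open>Number fields and the Dedekind zeta function\<close>

definition number_field :: "'k :: field_char_0 itself \<Rightarrow> bool" where
  "number_field _ \<longleftrightarrow>
     (\<exists>B :: 'k set. finite B \<and> (\<forall>x. \<exists>c :: 'k \<Rightarrow> rat. x = (\<Sum>b\<in>B. of_rat (c b) * b)))"

definition ring_of_integers :: "'k :: field_char_0 ring" where
  "ring_of_integers =
     \<lparr>carrier = {x. algebraic_int x}, mult = (*), one = 1, zero = 0, add = (+)\<rparr>"

definition dedekind_zeta :: "'k :: field_char_0 itself \<Rightarrow> fds" where
  "dedekind_zeta _ = fds (\<lambda>k. of_nat (card
     {I. ideal I (ring_of_integers :: 'k ring) \<and> I \<noteq> {0} \<and>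
         card (carrier (ring_of_integers Quot I)) = k}))"


section \<open>The group scheme\<close>

text \<open>
  The points over \<open>R\<close> are triples \<open>(a, b, c)\<close> of a vector of length \<open>m\<close>, a vector of length \<open>n\<close>
  and an \<open>m\<close> by \<open>n\<close> matrix, represented as extensional functions on the (0-based) index sets.
\<close>

definition Gmn :: "nat \<Rightarrow> nat \<Rightarrow> ('r, 'b) ring_scheme \<Rightarrow>
    ((nat \<Rightarrow> 'r) \<times> (nat \<Rightarrow> 'r) \<times> (nat \<times> nat \<Rightarrow> 'r)) monoid" where
  "Gmn m n R =
     \<lparr>carrier = ({..<m} \<rightarrow>\<^sub>E carrier R) \<times> ({..<n} \<rightarrow>\<^sub>E carrier R) \<times>
                ({..<m} \<times> {..<n} \<rightarrow>\<^sub>E carrier R),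
      mult = (\<lambda>(a, b, c) (a', b', c').
        (\<lambda>i\<in>{..<m}. a i \<oplus>\<^bsub>R\<^esub> a' i,
         \<lambda>j\<in>{..<n}. b j \<oplus>\<^bsub>R\<^esub> b' j,
         \<lambda>(i, j)\<in>{..<m} \<times> {..<n}. c (i, j) \<oplus>\<^bsub>R\<^esub> c' (i, j) \<oplus>\<^bsub>R\<^esub> a i \<otimes>\<^bsub>R\<^esub> b' j)),
      one = (\<lambda>i\<in>{..<m}. \<zero>\<^bsub>R\<^esub>, \<lambda>j\<in>{..<n}. \<zero>\<^bsub>R\<^esub>, \<lambda>(i, j)\<in>{..<m} \<times> {..<n}. \<zero>\<^bsub>R\<^esub>)\<rparr>"

lemma (in cring) group_Gmn: "group (Gmn m n R)"
proof (rule groupI)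
  show "\<one>\<^bsub>Gmn m n R\<^esub> \<in> carrier (Gmn m n R)"
    by (auto simp: Gmn_def)
next
  fix x y
  assume xy: "x \<in> carrier (Gmn m n R)" "y \<in> carrier (Gmn m n R)"
  obtain a b c a' b' c' where "x = (a, b, c)" "y = (a', b', c')"
    by (metis prod_cases3)
  with xy show "x \<otimes>\<^bsub>Gmn m n R\<^esub> y \<in> carrier (Gmn m n R)"
    by (auto simp: Gmn_def PiE_iff)
next
  fix x y z
  assume xyz: "x \<in> carrier (Gmn m n R)" "y \<in> carrier (Gmn m n R)" "z \<in> carrier (Gmn m n R)"
  obtain a b c a' b' c' a'' b'' c''
    where eq: "x = (a, b, c)" "y = (a', b', c')" "z = (a'', b'', c'')"
    by (metis prod_cases3)
  have
    "a i \<in> carrier R" "a' i \<in> carrier R" "a'' i \<in> carrier R"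
    "b j \<in> carrier R" "b' j \<in> carrier R" "b'' j \<in> carrier R"
    "c (i, j) \<in> carrier R" "c' (i, j) \<in> carrier R" "c'' (i, j) \<in> carrier R"
    if "i < m" "j < n" for i j
    using xyz that by (auto simp: Gmn_def PiE_iff eq)
  note C = this
  have C1: "a i \<in> carrier R" "a' i \<in> carrier R" "a'' i \<in> carrier R" if "i < m" for i
    using xyz that by (auto simp: Gmn_def PiE_iff eq)
  have C2: "b j \<in> carrier R" "b' j \<in> carrier R" "b'' j \<in> carrier R" if "j < n" for j
    using xyz that by (auto simp: Gmn_def PiE_iff eq)
  have "a i \<oplus> a' i \<oplus> a'' i = a i \<oplus> (a' i \<oplus> a'' i)" if "i < m" for i
    using C1[OF that] by (rule a_assoc)
  moreover have "b j \<oplus> b' j \<oplus> b'' j = b j \<oplus> (b' j \<oplus> b'' j)" if "j < n" for j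
    using C2[OF that] by (rule a_assoc)
  moreover have
    "c (i, j) \<oplus> c' (i, j) \<oplus> a i \<otimes> b' j \<oplus> c'' (i, j) \<oplus> (a i \<oplus> a' i) \<otimes> b'' j =
     c (i, j) \<oplus> (c' (i, j) \<oplus> c'' (i, j) \<oplus> a' i \<otimes> b'' j) \<oplus> a i \<otimes> (b' j \<oplus> b'' j)"
    if "i < m" "j < n" for i j
    using C[OF that] by (simp add: l_distr r_distr a_ac)
  ultimately show "x \<otimes>\<^bsub>Gmn m n R\<^esub> y \<otimes>\<^bsub>Gmn m n R\<^esub> z = x \<otimes>\<^bsub>Gmn m n R\<^esub> (y \<otimes>\<^bsub>Gmn m n R\<^esub> z)"
    by (simp add: Gmn_def eq fun_eq_iff)
next
  fix x assume x: "x \<in> carrier (Gmn m n R)"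
  obtain a b c where eq: "x = (a, b, c)" by (metis prod_cases3)
  have abc: "a \<in> {..<m} \<rightarrow>\<^sub>E carrier R" "b \<in> {..<n} \<rightarrow>\<^sub>E carrier R"
      "c \<in> {..<m} \<times> {..<n} \<rightarrow>\<^sub>E carrier R"
    using x by (auto simp: Gmn_def eq)
  have C: "a i \<in> carrier R" "b j \<in> carrier R" "c (i, j) \<in> carrier R" if "i < m" "j < n" for i j
    using abc that by auto
  have C1: "a i \<in> carrier R" if "i < m" for i using abc that by auto
  have C2: "b j \<in> carrier R" if "j < n" for j using abc that by auto
  have arb: "a i = undefined" if "\<not> i < m" for i
    using abc that by (auto intro: PiE_arb)
  have arb': "b j = undefined" if "\<not> j < n" for j
    using abc that by (auto intro: PiE_arb)
  have arb'': "c (i, j) = undefined" if "\<not> (i < m \<and> j < n)" for i j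
    using PiE_arb[OF abc(3), of "(i, j)"] that by auto
  show "\<one>\<^bsub>Gmn m n R\<^esub> \<otimes>\<^bsub>Gmn m n R\<^esub> x = x"
    using C C1 C2 arb arb' arb'' by (simp add: Gmn_def eq fun_eq_iff)
  let ?y = "(\<lambda>i\<in>{..<m}. \<ominus> a i, \<lambda>j\<in>{..<n}. \<ominus> b j,
             \<lambda>(i, j)\<in>{..<m} \<times> {..<n}. \<ominus> c (i, j) \<oplus> a i \<otimes> b j)"
  have "?y \<in> carrier (Gmn m n R)"
    by (auto simp: Gmn_def C C1 C2)
  moreover have "\<ominus> c (i, j) \<oplus> a i \<otimes> b j \<oplus> c (i, j) \<oplus> (\<ominus> a i) \<otimes> b j = \<zero>"
    if "i < m" "j < n" for i j
  proof -
    have "\<ominus> c (i, j) \<oplus> a i \<otimes> b j \<oplus> c (i, j) = c (i, j) \<oplus> (\<ominus> c (i, j) \<oplus> a i \<otimes> b j)"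
      using C[OF that] by (intro a_comm) auto
    thus ?thesis using C[OF that] by (simp add: r_neg r_neg2 l_minus)
  qed
  hence "?y \<otimes>\<^bsub>Gmn m n R\<^esub> x = \<one>\<^bsub>Gmn m n R\<^esub>"
    by (simp add: Gmn_def eq fun_eq_iff C1 C2 l_neg)
  ultimately show "\<exists>y\<in>carrier (Gmn m n R). y \<otimes>\<^bsub>Gmn m n R\<^esub> x = \<one>\<^bsub>Gmn m n R\<^esub>"
    by blast
qed


section \<open>Twist representation zeta functions\<close>

definition matrix_rep :: "('g, 'b) monoid_scheme \<Rightarrow> nat \<Rightarrow> ('g \<Rightarrow> complex mat) \<Rightarrow> bool" where
  "matrix_rep G d \<rho> \<longleftrightarrow> \<rho> \<in> hom G (units_of (ring_mat TYPE(complex) d ()))"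

definition irreducible_rep :: "('g, 'b) monoid_scheme \<Rightarrow> nat \<Rightarrow> ('g \<Rightarrow> complex mat) \<Rightarrow> bool" where
  "irreducible_rep G d \<rho> \<longleftrightarrow> matrix_rep G d \<rho> \<and> d > 0 \<and>
     (\<forall>W. subspace class_ring W (module_vec TYPE(complex) d) \<and>
          (\<forall>g\<in>carrier G. \<forall>w\<in>W. \<rho> g *\<^sub>v w \<in> W)
        \<longrightarrow> W = {0\<^sub>v d} \<or> W = carrier_vec d)"

definition rep_character :: "('g, 'b) monoid_scheme \<Rightarrow> nat \<Rightarrow> ('g \<Rightarrow> complex mat) \<Rightarrow> 'g \<Rightarrow> complex" where
  "rep_character G d \<rho> = (\<lambda>g\<in>carrier G. \<Sum>i<d. \<rho> g $$ (i, i))"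

definition Irr :: "('g, 'b) monoid_scheme \<Rightarrow> nat \<Rightarrow> ('g \<Rightarrow> complex) set" where
  "Irr G d = {rep_character G d \<rho> | \<rho>. irreducible_rep G d \<rho>}"

definition twist_rel :: "('g, 'b) monoid_scheme \<Rightarrow> nat \<Rightarrow> (('g \<Rightarrow> complex) \<times> ('g \<Rightarrow> complex)) set" where
  "twist_rel G d = {(\<theta>1, \<theta>2). \<theta>1 \<in> Irr G d \<and> \<theta>2 \<in> Irr G d \<and>
     (\<exists>\<chi>\<in>Irr G 1. \<theta>1 = (\<lambda>g\<in>carrier G. \<chi> g * \<theta>2 g))}"

definition twist_zeta :: "('g, 'b) monoid_scheme \<Rightarrow> fds" where
  "twist_zeta G = fds (\<lambda>d. of_nat (card (Irr G d // twist_rel G d)))"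

end

theory Submission
  imports
    Defs
    "HOL-Computational_Algebra.Fundamental_Theorem_Algebra"
    "HOL-Computational_Algebra.Primes"
    "HOL-Library.Function_Algebras"
    "Jordan_Normal_Form.Spectral_Radius"
begin

text \<open>
  Let \<open>R\<close> be the ring of integers. A character \<open>\<psi>\<close> of the centre of the group has a radical, the largest
  submodule \<open>N\<close> of \<open>R^m\<close> with \<open>\<psi> (a b\<^sup>T) = 1\<close> for all \<open>a \<in> N\<close> and \<open>b\<close>. Two irreducible representations
  \<open>\<rho>1\<close>, \<open>\<rho>2\<close> with the same central character differ by a twist, because the commuting operators
  \<open>T \<mapsto> \<rho>1 g * T * (\<rho>2 g)\<inverse>\<close> have a common eigenvector. Taking determinants of commutators shows that
  a central character that occurs has a radical of finite index; in this case there is an explicit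
  irreducible representation on the functions on \<open>R^m / rad \<psi>\<close>. So the twist classes of dimension \<open>d\<close>
  correspond to the characters whose radical has index \<open>d\<close>.

  There are \<open>[R^m : N]^n\<close> characters whose radical contains \<open>N\<close>. Counting the pairs \<open>N \<subseteq> rad \<psi>\<close> by the
  index of \<open>N\<close> in two ways gives \<open>Z(s - n) = \<zeta>(s) Z(s)\<close>, where \<open>\<zeta>\<close> is the twist zeta function and \<open>Z\<close>
  counts the submodules of \<open>R^m\<close>, or equivalently of any submodule of finite index. Projecting to the
  last coordinate shows inductively that \<open>Z\<close> is the product of the \<open>\<zeta>\<^sub>K(s - i)\<close> for \<open>i < m\<close>; this needs of the
  ideals \<open>J\<close> of \<open>R\<close> only that \<open>J / k J\<close> is isomorphic to \<open>R / k R\<close>.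
\<close>

section \<open>Closure properties of algebraic integers\<close>

text \<open>Counting the characters with a prescribed radical would need Moebius inversion over the
  lattice of submodules. Characters whose radical contains a given N are easy: the central matrices
  form a sum of n copies of R^m, one for each column, so these characters are n-tuples of characters
  of R^m / N. The double count then replaces the inversion, provided that the number of submodules
  of each index is the same in every radical. A radical need not be free, since ideals of R need not
  be principal; this is the reason for counting in all submodules of finite index, and for comparing
  J / k J with R / k R.

  The ideal theory rests on two properties of R, collected in the locale \<open>number_ring\<close>:
  its quotients by nonzero elements are finite, and it is completely integrally closed.

  The determinant argument: if g h = z h g and z acts by the scalar c in dimension d, then c^d = 1.
  So the central character takes d-th roots of unity as values, and d R^m lies in the radical. For d
  = 1 the same argument shows that a twist does not change the central character.\<close>

definition int_span :: "'a::comm_ring_1 set \<Rightarrow> 'a set" where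
  "int_span S = {y. \<exists>c. y = (\<Sum>t\<in>S. of_int (c t) * t)}"

lemma int_span_add: "x \<in> int_span S \<Longrightarrow> y \<in> int_span S \<Longrightarrow> x + y \<in> int_span S"
proof -
  assume "x \<in> int_span S" "y \<in> int_span S"
  then obtain c d where "x = (\<Sum>t\<in>S. of_int (c t) * t)" "y = (\<Sum>t\<in>S. of_int (d t) * t)"
    by (auto simp: int_span_def)
  hence "x + y = (\<Sum>t\<in>S. of_int (c t + d t) * t)"
    by (simp add: sum.distrib algebra_simps)
  thus ?thesis unfolding int_span_def mem_Collect_eq by (rule exI[of _ "\<lambda>t. c t + d t"])
qed

lemma int_span_scale: "x \<in> int_span S \<Longrightarrow> of_int k * x \<in> int_span S"
proof -
  assume "x \<in> int_span S"
  then obtain c where "x = (\<Sum>t\<in>S. of_int (c t) * t)"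
    by (auto simp: int_span_def)
  hence "of_int k * x = (\<Sum>t\<in>S. of_int (k * c t) * t)"
    by (simp add: sum_distrib_left algebra_simps)
  thus ?thesis unfolding int_span_def mem_Collect_eq by (rule exI[of _ "\<lambda>t. k * c t"])
qed

lemma int_span_0: "0 \<in> int_span S"
  unfolding int_span_def by (auto intro!: exI[of _ "\<lambda>_. 0"])

lemma int_span_base: "finite S \<Longrightarrow> s \<in> S \<Longrightarrow> s \<in> int_span S"
  unfolding int_span_def
  by (auto intro!: exI[of _ "\<lambda>t. if t = s then 1 else 0"]
      simp: if_distrib[of of_int] if_distrib[of "\<lambda>x. x * _"] cong: if_cong)

lemma int_span_sum: "(\<And>i. i \<in> I \<Longrightarrow> f i \<in> int_span S) \<Longrightarrow> sum f I \<in> int_span S"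
  by (induction I rule: infinite_finite_induct) (auto simp: int_span_0 int_span_add)

lemma int_span_mult_closed:
  assumes "\<And>s. s \<in> S \<Longrightarrow> x * s \<in> int_span S" and "y \<in> int_span S"
  shows "x * y \<in> int_span S"
proof -
  obtain c where "y = (\<Sum>t\<in>S. of_int (c t) * t)"
    using assms by (auto simp: int_span_def)
  hence "x * y = (\<Sum>t\<in>S. of_int (c t) * (x * t))"
    by (simp add: sum_distrib_left algebra_simps)
  thus ?thesis using assms by (auto intro!: int_span_sum int_span_scale)
qed

text \<open>The determinant trick: the elements of \<open>S\<close> form an eigenvector, with
  eigenvalue x, of the integer matrix that expresses multiplication by x in terms of
  \<open>S\<close>. So x is a root of its characteristic polynomial, which is monic with integer
  coefficients. The nonzero \<open>s0\<close> makes the eigenvector nonzero.\<close>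

lemma algebraic_int_if_finite_module:
  fixes x :: "'a :: field_char_0"
  assumes fin: "finite S" and nz: "s0 \<in> S" "s0 \<noteq> 0"
    and cl: "\<And>s. s \<in> S \<Longrightarrow> x * s \<in> int_span S"
  shows "algebraic_int x"
proof -
  define n where "n = card S"
  obtain e where e: "bij_betw e {0..<n} S"
    using ex_bij_betw_nat_finite[OF fin] n_def by blast
  obtain c where c: "\<And>s. s \<in> S \<Longrightarrow> x * s = (\<Sum>t\<in>S. of_int (c s t) * t)"
    using cl unfolding int_span_def by (auto simp: Bex_def) metis
  define M where "M = mat n n (\<lambda>(i, j). c (e i) (e j))"
  define N where "N = map_mat (of_int :: int \<Rightarrow> 'a) M"
  have M: "M \<in> carrier_mat n n" by (simp add: M_def)
  have N: "N \<in> carrier_mat n n" using M by (simp add: N_def)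
  define v where "v = vec n e"
  have eS: "e i \<in> S" if "i < n" for i using e that by (auto simp: bij_betw_def)
  have "N *\<^sub>v v = x \<cdot>\<^sub>v v"
  proof (rule eq_vecI)
    fix i assume "i < dim_vec (x \<cdot>\<^sub>v v)"
    hence i: "i < n" by (simp add: v_def)
    have "(N *\<^sub>v v) $ i = (\<Sum>j\<in>{0..<n}. of_int (c (e i) (e j)) * e j)"
      using i by (simp add: N_def M_def v_def scalar_prod_def)
    also have "\<dots> = (\<Sum>t\<in>S. of_int (c (e i) t) * t)"
      by (rule sum.reindex_bij_betw[OF e])
    also have "\<dots> = x * e i" using c[OF eS[OF i]] by simp
    finally show "(N *\<^sub>v v) $ i = (x \<cdot>\<^sub>v v) $ i" using i by (simp add: v_def)
  qed (use N in \<open>auto simp: v_def\<close>)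
  moreover obtain i where "i < n" "e i = s0" using e nz by (auto simp: bij_betw_def)
  hence "v \<noteq> 0\<^sub>v n" using nz by (metis index_vec index_zero_vec(1) v_def)
  ultimately have "eigenvalue N x"
    using N unfolding eigenvalue_def eigenvector_def
    by (intro exI[of _ v]) (simp add: v_def)
  hence "poly (char_poly N) x = 0" using eigenvalue_root_char_poly[OF N] by simp
  moreover have "char_poly N = map_poly of_int (char_poly M)"
    unfolding N_def using M by (rule of_int_hom.char_poly_hom)
  moreover have "lead_coeff (char_poly M) = 1" using degree_monic_char_poly[OF M] by simp
  ultimately show ?thesis by (auto simp: algebraic_int_altdef_ipoly)
qed

lemma algebraic_int_power_reduction:
  fixes x :: "'a :: field_char_0"
  assumes "algebraic_int x"
  obtains a c where "a > 0" "x ^ a = (\<Sum>k<a. of_int (c k) * x ^ k)"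
proof -
  obtain p where p: "poly (map_poly of_int p) x = 0" "lead_coeff p = 1"
    using assms algebraic_int_altdef_ipoly by blast
  have "degree p > 0"
  proof (rule ccontr)
    assume "\<not> degree p > 0"
    hence "p = 1"
      using p(2) by (metis degree_eq_zeroE gr0I lead_coeff_pCons(2) one_pCons pCons_0_0 coeff_pCons_0)
    thus False using p(1) by simp
  qed
  have "0 = (\<Sum>k\<le>degree p. of_int (coeff p k) * x ^ k)"
    using p(1) by (simp add: poly_altdef degree_map_poly coeff_map_poly)
  also have "{..degree p} = insert (degree p) {..<degree p}" by auto
  finally have "x ^ degree p = - (\<Sum>k<degree p. of_int (coeff p k) * x ^ k)"
    using p(2) by (simp add: add_eq_0_iff)
  also have "\<dots> = (\<Sum>k<degree p. of_int (- coeff p k) * x ^ k)"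
    by (simp add: sum_negf)
  finally show ?thesis using that[of "degree p" "\<lambda>k. - coeff p k"] \<open>degree p > 0\<close> by blast
qed

text \<open>The monomials x^i y^j below the degrees of monic relations for x and y generate a group
  that is preserved by multiplication by x and by y, hence by x + y and x y.\<close>

lemma algebraic_int_add_mult:
  fixes x y :: "'a :: field_char_0"
  assumes "algebraic_int x" "algebraic_int y"
  shows algebraic_int_add: "algebraic_int (x + y)" and algebraic_int_mult: "algebraic_int (x * y)"
proof -
  define S where "S = (\<lambda>(a :: nat) (b :: nat) (x :: 'a) y. (\<lambda>(i, j). x ^ i * y ^ j) ` ({..<a} \<times> {..<b}))"
  have fin: "finite (S a b x y)" for a b x y by (simp add: S_def)
  have base: "x ^ i * y ^ j \<in> int_span (S a b x y)" if "i < a" "j < b" for i j a b x y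
    by (rule int_span_base[OF fin]) (use that in \<open>auto simp: S_def\<close>)
  \<comment> \<open>Only the top power of x leaves the box of exponents, and the monic relation
    rewrites it.\<close>
  have left: "x * s \<in> int_span (S a b x y)"
    if a: "x ^ a = (\<Sum>k<a. of_int (c k) * x ^ k)" and s: "s \<in> S a b x y" for a b c s x y
  proof -
    obtain i j where ij: "s = x ^ i * y ^ j" "i < a" "j < b" using s unfolding S_def by auto
    show ?thesis
    proof (cases "Suc i < a")
      case True
      thus ?thesis using base[OF True ij(3)] ij by (simp add: mult.assoc)
    next
      case False
      hence "Suc i = a" using ij by simp
      hence "x * s = x ^ a * y ^ j" using ij by (auto simp flip: power_Suc mult.assoc)
      also have "\<dots> = (\<Sum>k<a. of_int (c k) * (x ^ k * y ^ j))"
        by (simp add: a sum_distrib_right mult.assoc)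
      also have "\<dots> \<in> int_span (S a b x y)" using base ij by (auto intro!: int_span_sum int_span_scale)
      finally show ?thesis .
    qed
  qed
  obtain a c where a: "a > 0" "x ^ a = (\<Sum>k<a. of_int (c k) * x ^ k)"
    using algebraic_int_power_reduction[OF assms(1)] by blast
  obtain b d where b: "b > 0" "y ^ b = (\<Sum>k<b. of_int (d k) * y ^ k)"
    using algebraic_int_power_reduction[OF assms(2)] by blast
  \<comment> \<open>Exchanging x and y turns closure under the first variable into closure under the
    second.\<close>
  have "S b a y x = S a b x y" by (force simp: S_def mult.commute)
  hence cl: "x * s \<in> int_span (S a b x y)" "y * s \<in> int_span (S a b x y)" if "s \<in> S a b x y" for s
    using left[OF a(2), of s b y] left[OF b(2), of s a x] that by simp_all
  have one: "1 \<in> S a b x y" using a(1) b(1) by (auto simp: S_def intro!: image_eqI[of _ _ "(0, 0)"])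
  show "algebraic_int (x + y)"
    by (rule algebraic_int_if_finite_module[OF fin one])
      (auto simp: distrib_right intro: int_span_add cl)
  show "algebraic_int (x * y)"
    by (rule algebraic_int_if_finite_module[OF fin one])
      (auto simp: mult.assoc intro: int_span_mult_closed cl)
qed

section \<open>Indices of additive subgroups\<close>

definition add_subgroup :: "'a::ab_group_add set \<Rightarrow> bool" where
  "add_subgroup N \<longleftrightarrow> 0 \<in> N \<and> (\<forall>x\<in>N. \<forall>y\<in>N. x - y \<in> N)"

lemma add_subgroupD:
  assumes "add_subgroup N"
  shows "0 \<in> N" "x \<in> N \<Longrightarrow> y \<in> N \<Longrightarrow> x - y \<in> N" "x \<in> N \<Longrightarrow> - x \<in> N"
    "x \<in> N \<Longrightarrow> y \<in> N \<Longrightarrow> x + y \<in> N"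
proof -
  have 2: "x - y \<in> N" if "x \<in> N" "y \<in> N" for x y
    using assms that by (auto simp: add_subgroup_def)
  show 0: "0 \<in> N" using assms by (simp add: add_subgroup_def)
  have 3: "- x \<in> N" if "x \<in> N" for x using 2[OF 0 that] by simp
  show "x \<in> N \<Longrightarrow> y \<in> N \<Longrightarrow> x - y \<in> N" by (rule 2)
  show "x \<in> N \<Longrightarrow> - x \<in> N" by (rule 3)
  show "x \<in> N \<Longrightarrow> y \<in> N \<Longrightarrow> x + y \<in> N" using 2[of x "- y"] 3[of y] by simp
qed

lemma add_subgroup_add_iff: "add_subgroup N \<Longrightarrow> x \<in> N \<Longrightarrow> x + y \<in> N \<longleftrightarrow> y \<in> N"
  using add_subgroupD(2)[of N "x + y" x] add_subgroupD(4)[of N x y] by auto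

lemma add_subgroup_sum:
  "add_subgroup N \<Longrightarrow> (\<And>i. i \<in> I \<Longrightarrow> f i \<in> N) \<Longrightarrow> sum f I \<in> N"
  by (induction I rule: infinite_finite_induct) (auto intro: add_subgroupD)

definition add_coset :: "'a::ab_group_add set \<Rightarrow> 'a \<Rightarrow> 'a set" where
  "add_coset N x = {y. y - x \<in> N}"

definition cosets :: "'a::ab_group_add set \<Rightarrow> 'a set \<Rightarrow> 'a set set" where
  "cosets L N = add_coset N ` L"

text \<open>An infinite index is represented by 0.\<close>

definition idx :: "'a::ab_group_add set \<Rightarrow> 'a set \<Rightarrow> nat" where
  "idx L N = card (cosets L N)"

lemma mem_add_coset: "y \<in> add_coset N x \<longleftrightarrow> y - x \<in> N"
  by (simp add: add_coset_def)

lemma coset_eq_iff: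
  assumes "add_subgroup N"
  shows "add_coset N x = add_coset N x' \<longleftrightarrow> x - x' \<in> N"
proof
  assume "add_coset N x = add_coset N x'"
  moreover have "x \<in> add_coset N x" using assms by (simp add: add_subgroupD add_coset_def)
  ultimately show "x - x' \<in> N" by (simp add: add_coset_def)
next
  assume *: "x - x' \<in> N"
  have "y - x \<in> N \<longleftrightarrow> y - x' \<in> N" for y
    using add_subgroupD(4)[OF assms, of "y - x" "x - x'"] add_subgroupD(2)[OF assms, of "y - x'" "x - x'"] *
    by auto
  thus "add_coset N x = add_coset N x'" by (simp add: add_coset_def)
qed

lemma add_coset_mem: "add_subgroup N \<Longrightarrow> x \<in> add_coset N x"
  by (simp add: add_coset_def add_subgroupD)

lemma idx_pos_iff: "L \<noteq> {} \<Longrightarrow> idx L N > 0 \<longleftrightarrow> finite (cosets L N)"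
  by (auto simp: idx_def card_gt_0_iff cosets_def)

text \<open>\<open>f\<close> need not be additive: it suffices that it matches differences modulo
  the two subgroups, that is, induces a bijection of cosets.\<close>

lemma idx_eqI:
  assumes N: "add_subgroup N" and N': "add_subgroup N'"
    and diff: "\<And>x y. x \<in> L \<Longrightarrow> y \<in> L \<Longrightarrow> f x - f y \<in> N' \<longleftrightarrow> x - y \<in> N"
    and mem: "\<And>x. x \<in> L \<Longrightarrow> f x \<in> L'"
    and sur: "\<And>y. y \<in> L' \<Longrightarrow> \<exists>x\<in>L. y - f x \<in> N'"
  shows "idx L N = idx L' N'"
proof -
  define g where "g C = add_coset N' (f (SOME x. x \<in> L \<and> x \<in> C))" for C
  have gx: "g (add_coset N x) = add_coset N' (f x)" if x: "x \<in> L" for x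
  proof -
    define z where "z = (SOME z. z \<in> L \<and> z \<in> add_coset N x)"
    have "z \<in> L \<and> z \<in> add_coset N x"
      unfolding z_def by (rule someI[of _ x]) (use x N in \<open>simp add: add_coset_mem\<close>)
    hence "f z - f x \<in> N'" using diff x by (auto simp: add_coset_def)
    hence "add_coset N' (f z) = add_coset N' (f x)" by (simp add: coset_eq_iff[OF N'])
    thus ?thesis by (simp add: g_def z_def)
  qed
  have "bij_betw g (cosets L N) (cosets L' N')"
  proof (rule bij_betw_imageI)
    show "inj_on g (cosets L N)"
    proof (rule inj_onI)
      fix A B assume AB: "A \<in> cosets L N" "B \<in> cosets L N" "g A = g B"
      then obtain a b where "A = add_coset N a" "B = add_coset N b" "a \<in> L" "b \<in> L"
        by (auto simp: cosets_def)
      thus "A = B" using AB(3) by (simp add: gx coset_eq_iff[OF N'] coset_eq_iff[OF N] diff)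
    qed
    show "g ` cosets L N = cosets L' N'"
    proof
      show "g ` cosets L N \<subseteq> cosets L' N'" using mem by (auto simp: cosets_def gx)
      show "cosets L' N' \<subseteq> g ` cosets L N"
      proof
        fix C assume "C \<in> cosets L' N'"
        then obtain y where y: "y \<in> L'" "C = add_coset N' y" by (auto simp: cosets_def)
        then obtain x where x: "x \<in> L" "y - f x \<in> N'" using sur by blast
        hence "C = g (add_coset N x)" by (simp add: gx y coset_eq_iff[OF N'])
        thus "C \<in> g ` cosets L N" using x by (auto simp: cosets_def)
      qed
    qed
  qed
  thus ?thesis unfolding idx_def by (rule bij_betw_same_card)
qed

text \<open>The bijection is built without any finiteness assumption. Since \<open>card\<close> of
  an infinite set is 0, the identity also covers infinite indices, and a positive index of N in L
  forces both factors to be positive.\<close>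

lemma idx_mult:
  assumes N: "add_subgroup N" and M: "add_subgroup M" and L: "add_subgroup L"
    and sub: "N \<subseteq> M" "M \<subseteq> L"
  shows "idx L N = idx L M * idx M N"
proof -
  define r where "r D = (SOME x. x \<in> L \<and> x \<in> D)" for D
  have r: "r D \<in> L" "add_coset M (r D) = D" if "D \<in> cosets L M" for D
  proof -
    obtain x where x: "x \<in> L" "D = add_coset M x" using \<open>D \<in> cosets L M\<close> by (auto simp: cosets_def)
    have "r D \<in> L \<and> r D \<in> D"
      unfolding r_def by (rule someI[of _ x]) (use x M in \<open>simp add: add_coset_mem\<close>)
    hence "r D \<in> L" and *: "r D - x \<in> M" using x by (auto simp: mem_add_coset)
    thus "r D \<in> L" "add_coset M (r D) = D"
      using x by (auto simp: coset_eq_iff[OF M])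
  qed
  \<comment> \<open>\<open>add_coset E x\<close> translates an arbitrary set \<open>E\<close> by x,
    so a coset of N in M is moved into the coset \<open>D\<close> by the representative of
    \<open>D\<close>.\<close>
  define g where "g = (\<lambda>(D, E). add_coset E (r D))"
  have gx: "g (D, add_coset N x) = add_coset N (r D + x)" for D x
    by (simp add: g_def add_coset_def algebra_simps)
  have "bij_betw g (cosets L M \<times> cosets M N) (cosets L N)"
  proof (rule bij_betw_imageI)
    show "inj_on g (cosets L M \<times> cosets M N)"
    proof (rule inj_onI)
      fix p p' assume p: "p \<in> cosets L M \<times> cosets M N" "p' \<in> cosets L M \<times> cosets M N" "g p = g p'"
      obtain D E D' E' where DE: "p = (D, E)" "p' = (D', E')" by fastforce
      then obtain e e' where e: "e \<in> M" "E = add_coset N e" "e' \<in> M" "E' = add_coset N e'"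
        using p(1,2) by (auto simp: cosets_def)
      note * = DE[unfolded e]
      have D: "D \<in> cosets L M" "D' \<in> cosets L M" using p(1,2) DE by auto
      have n: "(r D + e) - (r D' + e') \<in> N"
        using p(3) unfolding * gx coset_eq_iff[OF N] .
      hence "(r D + e) - (r D' + e') \<in> M" using sub by blast
      from add_subgroupD(4)[OF M this add_subgroupD(2)[OF M e(3,1)]]
      have "r D - r D' \<in> M" by (simp add: algebra_simps)
      hence DD: "D = D'" using r(2)[OF D(1)] r(2)[OF D(2)] coset_eq_iff[OF M, of "r D" "r D'"] by simp
      hence "e - e' \<in> N" using n by simp
      thus "p = p'" using DD * coset_eq_iff[OF N] by simp
    qed
    show "g ` (cosets L M \<times> cosets M N) = cosets L N"
    proof
      show "g ` (cosets L M \<times> cosets M N) \<subseteq> cosets L N"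
      proof
        fix C assume "C \<in> g ` (cosets L M \<times> cosets M N)"
        then obtain D e where "D \<in> cosets L M" "e \<in> M" "C = g (D, add_coset N e)"
          by (auto simp: cosets_def)
        moreover have "r D + e \<in> L" using add_subgroupD(4)[OF L] r calculation sub by blast
        ultimately show "C \<in> cosets L N" by (auto simp: gx cosets_def)
      qed
      show "cosets L N \<subseteq> g ` (cosets L M \<times> cosets M N)"
      proof
        fix C assume "C \<in> cosets L N"
        then obtain x where x: "x \<in> L" "C = add_coset N x" by (auto simp: cosets_def)
        define D where "D = add_coset M x"
        have D: "D \<in> cosets L M" using x by (auto simp: D_def cosets_def)
        have "x - r D \<in> M" using r(2)[OF D] coset_eq_iff[OF M, of "r D" x]
          add_subgroupD(3)[OF M, of "r D - x"] unfolding D_def[symmetric] by simp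
        moreover have "C = g (D, add_coset N (x - r D))" by (simp only: gx x) simp
        ultimately show "C \<in> g ` (cosets L M \<times> cosets M N)" using D by (auto simp: cosets_def)
      qed
    qed
  qed
  hence "card (cosets L M \<times> cosets M N) = card (cosets L N)" by (rule bij_betw_same_card)
  thus ?thesis by (simp add: idx_def card_cartesian_product)
qed

lemma idx_self: "add_subgroup N \<Longrightarrow> idx N N = 1"
proof -
  assume N: "add_subgroup N"
  have "cosets N N = {N}"
  proof -
    have "add_coset N x = N" if "x \<in> N" for x
      using coset_eq_iff[OF N, of x 0] that by (simp add: add_coset_def)
    thus ?thesis using add_subgroupD(1)[OF N] by (auto simp: cosets_def image_iff)
  qed
  thus ?thesis by (simp add: idx_def)
qed

lemma idx_eq_1_iff:
  assumes N: "add_subgroup N" and L: "add_subgroup L" and sub: "N \<subseteq> L"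
  shows "idx L N = 1 \<longleftrightarrow> N = L"
proof
  assume "idx L N = 1"
  then obtain C where C: "cosets L N = {C}" by (auto simp: idx_def card_1_singleton_iff)
  have "x \<in> N" if "x \<in> L" for x
  proof -
    have "add_coset N x \<in> cosets L N" "add_coset N 0 \<in> cosets L N"
      unfolding cosets_def using that add_subgroupD(1)[OF L] by blast+
    hence "add_coset N x = add_coset N 0" using C by auto
    thus ?thesis using coset_eq_iff[OF N, of x 0] by simp
  qed
  thus "N = L" using sub by blast
qed (use idx_self[OF N] in simp)

text \<open>The group \<open>M\<close> generated by N and the kernel of f in L lies between N and L.
  Modulo \<open>M\<close>, L becomes f(L) / f(N); modulo N, \<open>M\<close> becomes the kernel in L
  modulo the kernel in N.\<close>

lemma idx_hom:
  fixes f :: "'a::ab_group_add \<Rightarrow> 'b::ab_group_add"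
  assumes N: "add_subgroup N" and L: "add_subgroup L" and sub: "N \<subseteq> L"
    and f: "\<And>x y. f (x - y) = f x - f y"
  shows "idx L N = idx (f ` L) (f ` N) * idx {x\<in>L. f x = 0} {x\<in>N. f x = 0}"
proof -
  define K where "K = {x\<in>L. f x = 0}"
  define M where "M = {x\<in>L. f x \<in> f ` N}"
  have f0: "f 0 = 0" using f[of 0 0] by simp
  have K: "add_subgroup K" using L by (auto simp: K_def add_subgroup_def f f0)
  have fN: "add_subgroup (f ` N)"
    using N f0 by (force simp: add_subgroup_def simp flip: f)
  have M: "add_subgroup M"
    using L add_subgroupD[OF fN] by (auto simp: M_def add_subgroup_def f f0)
  have "idx L N = idx L M * idx M N"
    by (rule idx_mult[OF N M L]) (use sub in \<open>auto simp: M_def\<close>)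
  also have "idx L M = idx (f ` L) (f ` N)"
  proof (rule idx_eqI[OF M fN])
    show "\<exists>x\<in>L. y - f x \<in> f ` N" if y: "y \<in> f ` L" for y
    proof -
      from y obtain x where "x \<in> L" "y = f x" by blast
      thus ?thesis using add_subgroupD(1)[OF fN] by (intro bexI[of _ x]) simp_all
    qed
  qed (use add_subgroupD[OF L] in \<open>auto simp: M_def simp flip: f\<close>)
  also have "idx M N = idx K {x\<in>N. f x = 0}"
  proof (rule idx_eqI[symmetric, of _ _ _ "\<lambda>x. x"])
    show "add_subgroup {x\<in>N. f x = 0}" using N f f0 by (auto simp: add_subgroup_def)
    show "\<exists>x\<in>K. y - x \<in> N" if "y \<in> M" for y
    proof -
      obtain z where z: "z \<in> N" "f y = f z" using \<open>y \<in> M\<close> by (auto simp: M_def)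
      have "y - z \<in> K" using z sub \<open>y \<in> M\<close> add_subgroupD[OF L] by (auto simp: K_def M_def f)
      thus ?thesis using z by (intro bexI[of _ "y - z"]) auto
    qed
    show "x \<in> M" if "x \<in> K" for x
      using that add_subgroupD(1)[OF fN] by (auto simp: K_def M_def)
  qed (use N in \<open>auto simp: K_def f\<close>)
  finally show ?thesis by (simp add: K_def)
qed

section \<open>Finiteness of quotients of the ring of integers\<close>

definition algebraic_ints :: "'a :: field set" where
  "algebraic_ints = {x. algebraic_int x}"

lemma algebraic_ints_iff [simp]: "x \<in> algebraic_ints \<longleftrightarrow> algebraic_int x"
  by (simp add: algebraic_ints_def)

text \<open>The bound is the size of a spanning set over the rationals. The definition of a number
  field is unfolded only here.\<close>

lemma rational_relation:
  assumes "number_field TYPE('k :: field_char_0)"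
  obtains D where "\<And>S :: 'k set. finite S \<Longrightarrow> card S > D \<Longrightarrow>
    \<exists>q. (\<Sum>s\<in>S. of_rat (q s) * s) = 0 \<and> (\<exists>s\<in>S. q s \<noteq> 0)"
proof -
  interpret Q: vector_space "\<lambda>q (x :: 'k). of_rat q * x"
    by unfold_locales (auto simp: algebra_simps of_rat_add of_rat_mult)
  obtain B :: "'k set" where B: "finite B" "\<And>x. \<exists>c. x = (\<Sum>b\<in>B. of_rat (c b) * b)"
    using assms unfolding number_field_def by blast
  have span: "Q.span B = UNIV"
  proof -
    have "x \<in> Q.span B" for x
    proof -
      obtain c where "x = (\<Sum>b\<in>B. of_rat (c b) * b)" using B by blast
      thus ?thesis by (auto intro: Q.span_sum Q.span_scale Q.span_base)
    qed
    thus ?thesis by blast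
  qed
  show ?thesis
  proof (rule that[of "card B"])
    fix S :: "'k set" assume S: "finite S" "card S > card B"
    have "Q.dependent S"
      using Q.independent_span_bound[OF B(1), of S] S span by auto
    thus "\<exists>q. (\<Sum>s\<in>S. of_rat (q s) * s) = 0 \<and> (\<exists>s\<in>S. q s \<noteq> 0)"
      using Q.dependent_finite[OF S(1)] by auto
  qed
qed

text \<open>Clear denominators and take a nontrivial integral relation with the least sum of
  absolute values of the coefficients. If p divided all of them, dividing by p would give a smaller
  one.\<close>

lemma integral_relation_mod_prime:
  fixes S :: "'k :: field_char_0 set" and p :: int
  assumes S: "finite S" and p: "\<bar>p\<bar> > 1"
    and q: "(\<Sum>s\<in>S. of_rat (q s) * s) = 0" "s0 \<in> S" "q s0 \<noteq> 0"
  shows "\<exists>c. (\<Sum>s\<in>S. of_int (c s) * s) = 0 \<and> (\<exists>s\<in>S. \<not> p dvd c s)"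
proof -
  define N where "N = (\<Prod>s\<in>S. snd (quotient_of (q s)))"
  have N0: "N \<noteq> 0" unfolding N_def using S
    by (simp add: quotient_of_denom_pos' less_imp_neq[symmetric])
  have "\<exists>k. of_int N * q s = of_int k" if "s \<in> S" for s
  proof -
    define d where "d = snd (quotient_of (q s))"
    have d: "d > 0" by (simp add: d_def quotient_of_denom_pos')
    have "q s = of_int (fst (quotient_of (q s))) / of_int d"
      using quotient_of_div[of "q s"] by (simp add: d_def)
    hence *: "of_int d * q s = of_int (fst (quotient_of (q s)))" using d by (simp add: field_simps)
    have "N = d * (\<Prod>s\<in>S - {s}. snd (quotient_of (q s)))"
      unfolding N_def d_def using S that by (simp add: prod.remove)
    hence "of_int N * q s = of_int (\<Prod>s\<in>S - {s}. snd (quotient_of (q s))) * (of_int d * q s)" by simp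
    also have "\<dots> = of_int ((\<Prod>s\<in>S - {s}. snd (quotient_of (q s))) * fst (quotient_of (q s)))"
      by (simp add: *)
    finally show ?thesis by blast
  qed
  then obtain k where k: "\<And>s. s \<in> S \<Longrightarrow> of_int N * q s = of_int (k s)" by metis
  define rel where "rel c \<longleftrightarrow> (\<Sum>s\<in>S. of_int (c s) * s) = 0 \<and> (\<exists>s\<in>S. c s \<noteq> 0)" for c :: "'k \<Rightarrow> int"
  have "(\<Sum>s\<in>S. of_int (k s) * s) = (\<Sum>s\<in>S. of_int N * (of_rat (q s) * s))"
  proof (rule sum.cong)
    fix s assume "s \<in> S"
    hence "of_rat (of_int N * q s) = (of_rat (of_int (k s)) :: 'k)" using k by simp
    hence "of_int (k s) = of_int N * (of_rat (q s) :: 'k)" by (simp add: of_rat_mult)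
    thus "of_int (k s) * s = of_int N * (of_rat (q s) * s)" by simp
  qed simp
  also have "\<dots> = 0" using q(1) by (simp flip: sum_distrib_left)
  finally have "rel k"
    unfolding rel_def using k[OF q(2)] q N0 by (auto intro!: bexI[of _ s0])
  obtain c where c: "rel c"
    and min: "\<And>c'. rel c' \<Longrightarrow> (\<Sum>s\<in>S. nat \<bar>c s\<bar>) \<le> (\<Sum>s\<in>S. nat \<bar>c' s\<bar>)"
    using exists_least_iff[of "\<lambda>n. \<exists>c. rel c \<and> n = (\<Sum>s\<in>S. nat \<bar>c s\<bar>)"] \<open>rel k\<close>
    by (metis linorder_not_less)
  have "\<exists>s\<in>S. \<not> p dvd c s"
  proof (rule ccontr)
    assume "\<not> ?thesis"
    hence dv: "c s = p * (c s div p)" if "s \<in> S" for s using that by simp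
    have "of_int p * (\<Sum>s\<in>S. of_int (c s div p) * s) = (\<Sum>s\<in>S. of_int (p * (c s div p)) * s)"
      by (simp add: sum_distrib_left mult.assoc)
    also have "\<dots> = (\<Sum>s\<in>S. of_int (c s) * s)" using dv by (intro sum.cong) auto
    also have "\<dots> = 0" using c by (simp add: rel_def)
    finally have "(\<Sum>s\<in>S. of_int (c s div p) * s) = 0" using p by auto
    moreover obtain s1 where s1: "s1 \<in> S" "c s1 \<noteq> 0" using c by (auto simp: rel_def)
    ultimately have "rel (\<lambda>s. c s div p)"
      using dv[OF s1(1)] by (auto simp: rel_def intro!: bexI[of _ s1])
    from min[OF this] have "(\<Sum>s\<in>S. nat \<bar>c s\<bar>) \<le> (\<Sum>s\<in>S. nat \<bar>c s div p\<bar>)" .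
    moreover have ab: "\<bar>c s\<bar> = \<bar>p\<bar> * \<bar>c s div p\<bar>" if "s \<in> S" for s
      using dv[OF that] by (metis abs_mult)
    have le: "nat \<bar>c s div p\<bar> \<le> nat \<bar>c s\<bar>" if "s \<in> S" for s
      unfolding ab[OF that] using p by (intro nat_mono) (simp add: mult_le_cancel_right1)
    have "c s1 div p \<noteq> 0" using dv[OF s1(1)] s1 by auto
    hence "\<bar>c s1 div p\<bar> < \<bar>p\<bar> * \<bar>c s1 div p\<bar>" using p by simp
    hence "nat \<bar>c s1 div p\<bar> < nat \<bar>c s1\<bar>" unfolding ab[OF s1(1)] by linarith
    hence "(\<Sum>s\<in>S. nat \<bar>c s div p\<bar>) < (\<Sum>s\<in>S. nat \<bar>c s\<bar>)"
      using S s1 le by (intro sum_strict_mono_ex1) auto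
    ultimately show False by simp
  qed
  thus ?thesis using c by (auto simp: rel_def)
qed

lemma algebraic_int_diff:
  fixes x y :: "'a :: field_char_0"
  shows "algebraic_int x \<Longrightarrow> algebraic_int y \<Longrightarrow> algebraic_int (x - y)"
  using algebraic_int_add[of x "- y"] by simp

lemma algebraic_int_power: "algebraic_int (x :: 'a :: field_char_0) \<Longrightarrow> algebraic_int (x ^ n)"
  by (induction n) (auto intro: algebraic_int_mult)

lemma algebraic_int_sum:
  "(\<And>i. i \<in> I \<Longrightarrow> algebraic_int (f i :: 'a :: field_char_0)) \<Longrightarrow> algebraic_int (sum f I)"
  by (induction I rule: infinite_finite_induct) (auto intro: algebraic_int_add)

lemma add_subgroup_algebraic_ints: "add_subgroup (algebraic_ints :: 'k :: field_char_0 set)"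
  by (auto simp: add_subgroup_def algebraic_int_diff)

lemma add_subgroup_mult_image:
  fixes N :: "'a :: comm_ring_1 set"
  shows "add_subgroup N \<Longrightarrow> add_subgroup ((*) a ` N)"
  unfolding add_subgroup_def
  by (auto simp flip: right_diff_distrib intro: image_eqI[of _ _ 0])

text \<open>O / p O is a vector space over the field with p elements. Lifts of independent classes
  satisfy no integral relation with a coefficient not divisible by p, so by
  \<open>rational_relation\<close> and \<open>integral_relation_mod_prime\<close> there are at most
  \<open>D\<close> of them. A maximal independent set spans, and its combinations with coefficients
  from 0 to p - 1 meet all cosets.\<close>

lemma finite_algebraic_ints_mod_prime:
  assumes K: "number_field TYPE('k :: field_char_0)" and p: "prime (p :: nat)"
  shows "idx (algebraic_ints :: 'k set) ((*) (of_nat p) ` algebraic_ints) > 0"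
proof -
  let ?O = "(algebraic_ints :: 'k set)" and ?P = "(*) (of_nat p) ` (algebraic_ints :: 'k set)"
  have P: "add_subgroup ?P" by (rule add_subgroup_mult_image[OF add_subgroup_algebraic_ints])
  have P1: "of_int (int p * k) * x \<in> ?P" if "x \<in> ?O" for x k
    using that by (auto intro!: image_eqI[of _ _ "of_int k * x"] algebraic_int_mult simp: mult.assoc)
  obtain D where D: "\<And>S :: 'k set. finite S \<Longrightarrow> card S > D \<Longrightarrow>
    \<exists>q. (\<Sum>s\<in>S. of_rat (q s) * s) = 0 \<and> (\<exists>s\<in>S. q s \<noteq> 0)"
    using rational_relation[OF K] by blast
  \<comment> \<open>Independence of the classes modulo p; the coefficients are kept as integers and
    count as zero when p divides them.\<close>
  define indep where "indep S \<longleftrightarrow> finite S \<and> S \<subseteq> ?O \<and>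
    (\<forall>c. (\<Sum>s\<in>S. of_int (c s) * s) \<in> ?P \<longrightarrow> (\<forall>s\<in>S. int p dvd c s))" for S
  have bound: "card S \<le> D" if "indep S" for S
  proof (rule ccontr)
    assume "\<not> card S \<le> D"
    moreover have "finite S" using that by (simp add: indep_def)
    ultimately obtain q s0 where "(\<Sum>s\<in>S. of_rat (q s) * s) = 0" "s0 \<in> S" "q s0 \<noteq> 0"
      using D[of S] by force
    then obtain c where c: "(\<Sum>s\<in>S. of_int (c s) * s) = 0" "\<exists>s\<in>S. \<not> int p dvd c s"
      using integral_relation_mod_prime[OF \<open>finite S\<close>, of "int p" q s0] prime_gt_1_nat[OF p] by auto
    have "(\<Sum>s\<in>S. of_int (c s) * s) \<in> ?P" unfolding c(1) by (rule add_subgroupD(1)[OF P])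
    thus False using that c(2) unfolding indep_def by blast
  qed
  have "indep {}" by (simp add: indep_def)
  then obtain S where S: "indep S" and max: "\<And>S'. indep S' \<Longrightarrow> card S' \<le> card S"
    using ex_has_greatest_nat[of indep "{}" card "Suc D"] bound by (auto simp: less_Suc_eq_le)
  have fin: "finite S" and SO: "S \<subseteq> ?O" using S by (auto simp: indep_def)
  define R where "R = (\<lambda>d. \<Sum>s\<in>S. of_nat (d s) * s) ` (S \<rightarrow>\<^sub>E {..<p})"
  have "finite R" unfolding R_def by (intro finite_imageI finite_PiE fin) auto
  moreover have "cosets ?O ?P \<subseteq> add_coset ?P ` R"
  proof
    fix C assume "C \<in> cosets ?O ?P"
    then obtain x where x: "x \<in> ?O" "C = add_coset ?P x" by (auto simp: cosets_def)
    have "\<exists>c. x - (\<Sum>s\<in>S. of_int (c s) * s) \<in> ?P"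
    proof (cases "x \<in> S")
      case True
      have "(\<Sum>s\<in>S. of_int (if s = x then 1 else 0) * s) = (\<Sum>s\<in>S. if s = x then x else 0)"
        by (intro sum.cong) auto
      also have "\<dots> = x" using True fin by simp
      finally have "x - (\<Sum>s\<in>S. of_int (if s = x then 1 else 0) * s) = 0" by simp
      thus ?thesis using add_subgroupD(1)[OF P] by (intro exI[of _ "\<lambda>s. if s = x then 1 else 0"]) simp
    next
      case False
      have "\<not> indep (insert x S)" using max[of "insert x S"] False fin by auto
      then obtain c where c: "of_int (c x) * x + (\<Sum>s\<in>S. of_int (c s) * s) \<in> ?P"
          "\<exists>s\<in>insert x S. \<not> int p dvd c s"
        using fin SO x False by (auto simp: indep_def)
      have "\<not> int p dvd c x"
      proof
        assume "int p dvd c x"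
        then obtain k where "c x = int p * k" by blast
        hence "of_int (c x) * x \<in> ?P" using P1 x by auto
        from add_subgroupD(2)[OF P c(1) this]
        have "(\<Sum>s\<in>S. of_int (c s) * s) \<in> ?P" by simp
        hence "\<forall>s\<in>S. int p dvd c s" using S by (auto simp: indep_def)
        thus False using c(2) \<open>int p dvd c x\<close> by blast
      qed
      hence "coprime (c x) (int p)" using p
        by (metis coprime_commute prime_imp_coprime prime_nat_int_transfer)
      \<comment> \<open>Bezout inverts the coefficient of x modulo p and so solves the relation for
        x.\<close>
      then obtain u v where uv: "u * c x + v * int p = 1" using bezout_int by (metis coprime_iff_gcd_eq_1)
      define y where "y = of_int (c x) * x + (\<Sum>s\<in>S. of_int (c s) * s)"
      have "of_int u * y \<in> ?P" using c(1) unfolding y_def[symmetric]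
        by (auto intro!: image_eqI algebraic_int_mult simp: mult.left_commute)
      moreover have "of_int (int p * v) * x \<in> ?P" using P1 x by blast
      ultimately have "of_int u * y + of_int (int p * v) * x \<in> ?P" by (rule add_subgroupD(4)[OF P])
      also have "of_int u * y + of_int (int p * v) * x =
          of_int (u * c x + v * int p) * x + (\<Sum>s\<in>S. of_int (u * c s) * s)"
        by (simp add: y_def algebra_simps sum_distrib_left)
      also have "\<dots> = x - (\<Sum>s\<in>S. of_int (- u * c s) * s)" by (simp add: uv sum_negf)
      finally show ?thesis by (intro exI[of _ "\<lambda>s. - u * c s"])
    qed
    then obtain c where c: "x - (\<Sum>s\<in>S. of_int (c s) * s) \<in> ?P" by blast
    define d where "d = (\<lambda>s\<in>S. nat (c s mod int p))"
    have "(\<Sum>s\<in>S. of_int (c s) * s) - (\<Sum>s\<in>S. of_nat (d s) * s) =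
        (\<Sum>s\<in>S. of_int (int p * (c s div int p)) * s)"
    proof -
      have "of_int (c s) * s - of_nat (d s) * s = of_int (int p * (c s div int p)) * s" if "s \<in> S" for s
      proof -
        have "int (d s) = c s mod int p" using that p by (simp add: d_def prime_gt_0_nat)
        hence "c s = int p * (c s div int p) + int (d s)" by simp
        hence "of_int (c s) = (of_int (int p * (c s div int p)) + of_nat (d s) :: 'k)"
          by (metis of_int_add of_int_of_nat_eq)
        thus ?thesis by (simp add: algebra_simps)
      qed
      thus ?thesis by (simp flip: sum_subtractf)
    qed
    also have "\<dots> \<in> ?P" using SO P1 by (intro add_subgroup_sum[OF P]) auto
    finally have "(\<Sum>s\<in>S. of_int (c s) * s) - (\<Sum>s\<in>S. of_nat (d s) * s) \<in> ?P" .
    from add_subgroupD(4)[OF P c this] have "x - (\<Sum>s\<in>S. of_nat (d s) * s) \<in> ?P"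
      unfolding add_diff_eq diff_add_cancel .
    hence "C = add_coset ?P (\<Sum>s\<in>S. of_nat (d s) * s)" by (simp add: x coset_eq_iff[OF P])
    moreover have "d \<in> S \<rightarrow>\<^sub>E {..<p}" using p by (auto simp: d_def prime_gt_0_nat nat_less_iff)
    ultimately show "C \<in> add_coset ?P ` R" by (auto simp: R_def)
  qed
  ultimately have "finite (cosets ?O ?P)" by (meson finite_imageI finite_subset)
  thus ?thesis by (subst idx_pos_iff) (auto intro: algebraic_int_0 simp flip: ex_in_conv)
qed

lemma idx_mult_image:
  fixes a :: "'a :: field"
  assumes "a \<noteq> 0" and N: "add_subgroup N"
  shows "idx ((*) a ` L) ((*) a ` N) = idx L N"
  using assms
  by (intro idx_eqI[symmetric, of _ _ _ "(*) a"])
    (auto simp: add_subgroup_mult_image simp flip: right_diff_distrib,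
      metis add_subgroupD(1) diff_self image_eqI mult_zero_right)

text \<open>Strip off one prime factor at a time: n = p k gives the tower O, p O, p k O, and p O / p
  k O is isomorphic to O / k O.\<close>

lemma finite_algebraic_ints_mod_nat:
  assumes K: "number_field TYPE('k :: field_char_0)" and "n > 0"
  shows "idx (algebraic_ints :: 'k set) ((*) (of_nat n) ` algebraic_ints) > 0"
  using \<open>n > 0\<close>
proof (induction n rule: less_induct)
  case (less n)
  let ?O = "(algebraic_ints :: 'k set)"
  note O = add_subgroup_algebraic_ints[where 'k = 'k]
  show ?case
  proof (cases "n = 1")
    case True
    thus ?thesis using idx_self[OF O] by (simp add: image_def)
  next
    case False
    then obtain p where p: "prime p" "p dvd n" using prime_factor_nat by blast
    then obtain k where k: "n = p * k" by blast
    hence "k < n" "k > 0" using less.prems prime_gt_1_nat[OF p(1)] by auto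
    let ?pO = "(*) (of_nat p) ` ?O" and ?kO = "(*) (of_nat k) ` ?O"
    have nO: "(*) (of_nat n) ` ?O = (*) (of_nat p) ` ?kO" by (auto simp: k image_image mult.assoc)
    have sub: "(*) (of_nat j) ` ?O \<subseteq> ?O" for j by (auto intro!: algebraic_int_mult)
    have "idx ?O ((*) (of_nat n) ` ?O) = idx ?O ?pO * idx ?pO ((*) (of_nat n) ` ?O)"
      by (rule idx_mult) (use sub[of p] sub[of k] in \<open>auto simp: O add_subgroup_mult_image nO\<close>)
    also have "idx ?pO ((*) (of_nat n) ` ?O) = idx ?O ?kO"
      unfolding nO using p by (intro idx_mult_image) (auto simp: O add_subgroup_mult_image prime_gt_0_nat)
    finally show ?thesis
      using less.IH[OF \<open>k < n\<close> \<open>k > 0\<close>] finite_algebraic_ints_mod_prime[OF K p(1)] by simp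
  qed
qed

text \<open>The constant term of an integral polynomial vanishing at a is a multiple of a. Powers of
  X are divided out first, so that this constant is nonzero. The cofactor b is, up to sign, an
  integral polynomial in a.\<close>

lemma algebraic_int_dvd_nat:
  fixes a :: "'k :: field_char_0"
  assumes a: "algebraic_int a" "a \<noteq> 0"
  obtains b n where "algebraic_int b" "n > 0" "a * b = of_nat n"
proof -
  obtain p where p: "poly (map_poly of_int p) a = 0" "lead_coeff p = 1"
    using a algebraic_int_altdef_ipoly by blast
  have "p \<noteq> 0" using p by auto
  define k where "k = order 0 p"
  obtain q where q: "p = [:0, 1:] ^ k * q" "\<not> [:0, 1:] dvd q"
    using order_decomp[OF \<open>p \<noteq> 0\<close>, of 0] by (auto simp: k_def)
  have "poly (map_poly of_int p) a = a ^ k * poly (map_poly of_int q) a"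
    unfolding q(1) by (simp add: of_int_poly_hom.hom_mult of_int_poly_hom.hom_power map_poly_pCons)
  hence qa: "poly (map_poly of_int q) a = 0" using p a by simp
  obtain c r where cr: "q = pCons c r" by (cases q)
  have c0: "c \<noteq> 0" using q(2) unfolding cr by (auto simp: dvd_iff_poly_eq_0)
  define b where "b = poly (map_poly of_int r) a"
  have "algebraic_int b"
    unfolding b_def poly_altdef
    by (intro algebraic_int_sum algebraic_int_mult algebraic_int_power a) (simp add: coeff_map_poly)
  moreover have "a * b = of_int (- c)" using qa unfolding cr b_def
    by (cases "pCons c r = 0") (simp_all add: map_poly_pCons eq_neg_iff_add_eq_0 add.commute)
  ultimately show ?thesis
  proof (cases "c < 0")
    case True
    thus ?thesis using that[of b "nat (- c)"] \<open>algebraic_int b\<close> \<open>a * b = of_int (- c)\<close> by simp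
  next
    case False
    have "a * (- b) = of_int c" using \<open>a * b = of_int (- c)\<close> by simp
    thus ?thesis using that[of "- b" "nat c"] \<open>algebraic_int b\<close> False c0 by simp
  qed
qed

text \<open>If a b = n is a positive integer, then n O lies in a O, and n O has finite
  index.\<close>

lemma finite_algebraic_ints_mod:
  assumes K: "number_field TYPE('k :: field_char_0)" and a: "algebraic_int a" "a \<noteq> 0"
  shows "idx (algebraic_ints :: 'k set) ((*) a ` algebraic_ints) > 0"
proof -
  let ?O = "(algebraic_ints :: 'k set)"
  note O = add_subgroup_algebraic_ints[where 'k = 'k]
  obtain b n where bn: "algebraic_int b" "n > 0" "a * b = of_nat n"
    using algebraic_int_dvd_nat[OF a] by blast
  have "(*) (of_nat n) ` ?O \<subseteq> (*) a ` ?O"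
    using bn by (auto simp flip: bn(3) simp: mult.assoc intro!: image_eqI algebraic_int_mult)
  hence "idx ?O ((*) (of_nat n) ` ?O) = idx ?O ((*) a ` ?O) * idx ((*) a ` ?O) ((*) (of_nat n) ` ?O)"
    using a by (intro idx_mult) (auto simp: O add_subgroup_mult_image intro: algebraic_int_mult)
  thus ?thesis using finite_algebraic_ints_mod_nat[OF K bn(2)] by (metis mult_is_0 neq0_conv)
qed

section \<open>Ideals\<close>

text \<open>Translation by x permutes the cosets. So in the sum of the elements
  \<open>r C + x - r (p C)\<close>, which lie in N, the representatives cancel and x remains once
  for each coset.\<close>

lemma of_nat_idx_mult_mem:
  fixes x :: "'a :: comm_ring_1"
  assumes N: "add_subgroup N" and L: "add_subgroup L" and x: "x \<in> L" and pos: "idx L N > 0"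
  shows "of_nat (idx L N) * x \<in> N"
proof -
  define S where "S = cosets L N"
  have fin: "finite S" using pos by (simp add: idx_def S_def card_gt_0_iff)
  have "\<exists>y. y \<in> L \<and> C = add_coset N y" if "C \<in> S" for C
    using that by (auto simp: S_def cosets_def)
  then obtain r where r: "\<And>C. C \<in> S \<Longrightarrow> r C \<in> L" "\<And>C. C \<in> S \<Longrightarrow> add_coset N (r C) = C" by metis
  define p where "p C = add_coset N (r C + x)" for C
  have pS: "p C \<in> S" if "C \<in> S" for C
    using add_subgroupD(4)[OF L r(1)[OF that] x] by (auto simp: p_def S_def cosets_def)
  have inj: "inj_on p S"
  proof (rule inj_onI)
    fix C D assume CD: "C \<in> S" "D \<in> S" "p C = p D"
    hence "add_coset N (r C) = add_coset N (r D)" by (simp add: p_def coset_eq_iff[OF N])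
    thus "C = D" using r(2) CD by simp
  qed
  have pim: "p ` S = S" by (rule card_subset_eq[OF fin]) (auto simp: pS card_image[OF inj])
  have "(\<Sum>C\<in>S. r C + x - r (p C)) \<in> N"
  proof (rule add_subgroup_sum[OF N])
    fix C assume "C \<in> S"
    thus "r C + x - r (p C) \<in> N" using r(2)[OF pS] by (simp add: p_def flip: coset_eq_iff[OF N])
  qed
  moreover have "(\<Sum>C\<in>S. r (p C)) = (\<Sum>C\<in>S. r C)"
    using sum.reindex[OF inj, of r] by (simp add: pim o_def)
  ultimately show ?thesis by (simp add: sum.distrib sum_subtractf S_def idx_def)
qed

text \<open>Complete integral closedness is stated for x in the whole field. Its typical use: if x I
  lies in I for an ideal I containing a nonzero x0, then all x^n x0 lie in I, and so x is in
  R.\<close>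

locale number_ring =
  fixes R :: "'k :: field_char_0 set"
  assumes one_closed: "1 \<in> R"
    and diff_closed: "x \<in> R \<Longrightarrow> y \<in> R \<Longrightarrow> x - y \<in> R"
    and mult_closed: "x \<in> R \<Longrightarrow> y \<in> R \<Longrightarrow> x * y \<in> R"
    and finite_mod: "a \<in> R \<Longrightarrow> a \<noteq> 0 \<Longrightarrow> idx R ((*) a ` R) > 0"
    and completely_integrally_closed: "c \<noteq> 0 \<Longrightarrow> (\<And>n. x ^ n * c \<in> R) \<Longrightarrow> x \<in> R"
begin

lemma add_subgroup_R: "add_subgroup R"
  using diff_closed[OF one_closed one_closed] by (auto simp: add_subgroup_def diff_closed)

lemmas R_closed = one_closed diff_closed mult_closed add_subgroupD[OF add_subgroup_R]

lemma power_closed: "x \<in> R \<Longrightarrow> x ^ n \<in> R"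
  by (induction n) (auto simp: R_closed)

lemma of_nat_closed: "of_nat n \<in> R"
  by (induction n) (auto simp: R_closed)

definition rideal :: "'k set \<Rightarrow> bool" where
  "rideal I \<longleftrightarrow> I \<subseteq> R \<and> add_subgroup I \<and> (\<forall>r\<in>R. \<forall>x\<in>I. r * x \<in> I)"

lemma ridealD:
  assumes "rideal I"
  shows "x \<in> I \<Longrightarrow> x \<in> R" "add_subgroup I" "r \<in> R \<Longrightarrow> x \<in> I \<Longrightarrow> r * x \<in> I"
    "r \<in> R \<Longrightarrow> x \<in> I \<Longrightarrow> x * r \<in> I"
  using assms by (auto simp: rideal_def mult.commute[of x])

lemma rideal_eq_R_iff: "rideal I \<Longrightarrow> I = R \<longleftrightarrow> 1 \<in> I"
  using one_closed ridealD(3)[of I _ 1] ridealD(1)[of I] by fastforce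

lemma rideal_principal: "a \<in> R \<Longrightarrow> rideal ((*) a ` R)"
  by (auto simp: rideal_def add_subgroup_def R_closed image_iff mult.left_commute
      simp flip: right_diff_distrib intro: bexI[of _ 0])

text \<open>The ideal a I + b J. It occurs below as P + x R, as u R + k I and as u A + k I.\<close>

definition ideal_sum :: "'k set \<Rightarrow> 'k \<Rightarrow> 'k set \<Rightarrow> 'k \<Rightarrow> 'k set" where
  "ideal_sum I a J b = {x * a + y * b | x y. x \<in> I \<and> y \<in> J}"

lemma ideal_sumI: "x \<in> I \<Longrightarrow> y \<in> J \<Longrightarrow> x * a + y * b \<in> ideal_sum I a J b"
  by (auto simp: ideal_sum_def)

lemma rideal_ideal_sum:
  assumes I: "rideal I" and J: "rideal J" and ab: "a \<in> R" "b \<in> R"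
  shows "rideal (ideal_sum I a J b)"
  unfolding rideal_def add_subgroup_def
proof (intro conjI ballI)
  note ID = ridealD[OF I] and JD = ridealD[OF J]
  note IG = add_subgroupD[OF ID(2)] and JG = add_subgroupD[OF JD(2)]
  show "ideal_sum I a J b \<subseteq> R"
    using ID(1) JD(1) ab by (auto simp: ideal_sum_def R_closed)
  show "0 \<in> ideal_sum I a J b" using ideal_sumI[OF IG(1) JG(1), of a b] by simp
  fix z assume "z \<in> ideal_sum I a J b"
  then obtain x y where z: "z = x * a + y * b" "x \<in> I" "y \<in> J" by (auto simp: ideal_sum_def)
  show "r * z \<in> ideal_sum I a J b" if r: "r \<in> R" for r
    using ideal_sumI[OF ID(3)[OF r z(2)] JD(3)[OF r z(3)], of a b] by (simp add: z algebra_simps)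
  fix z' assume "z' \<in> ideal_sum I a J b"
  then obtain x' y' where z': "z' = x' * a + y' * b" "x' \<in> I" "y' \<in> J" by (auto simp: ideal_sum_def)
  show "z - z' \<in> ideal_sum I a J b"
    using ideal_sumI[OF IG(2)[OF z(2) z'(2)] JG(2)[OF z(3) z'(3)], of a b] by (simp add: z z' algebra_simps)
qed

lemma rideal_R: "rideal R"
  by (simp add: rideal_def add_subgroup_R R_closed)

lemma principal_subset: "rideal I \<Longrightarrow> a \<in> I \<Longrightarrow> (*) a ` R \<subseteq> I"
  by (auto simp: ridealD)

text \<open>In characteristic 0 this provides an explicit nonzero element in an ideal of finite
  index.\<close>

lemma idx_pos_nonzero:
  assumes I: "rideal I" and pos: "idx R I > 0"
  shows "of_nat (idx R I) \<in> I"
  using of_nat_idx_mult_mem[OF ridealD(2)[OF I] add_subgroup_R one_closed pos] by simp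

text \<open>A substitute for localization at A in the finite ring R / P. The powers of a repeat
  modulo P, so a^i (1 - a^l) lies in P for some i and some l > 0, and the factor 1 - a^l is 1 modulo
  A because a is in A. The product of these factors over \<open>T\<close> is
  \<open>f\<close>.\<close>

lemma exists_multiplier_aux:
  assumes fin: "finite T" and T: "T \<subseteq> A" and A: "rideal A" and P: "rideal P"
    and fP: "finite (cosets R P)"
  shows "\<exists>f\<in>R. 1 - f \<in> A \<and> (\<forall>a\<in>T. \<exists>i. a ^ i * f \<in> P)"
  using fin T
proof (induction T)
  case empty
  thus ?case using one_closed add_subgroupD(1)[OF ridealD(2)[OF A]] by (intro bexI[of _ 1]) auto
next
  case (insert a T)
  then obtain f where f: "f \<in> R" "1 - f \<in> A" "\<forall>a\<in>T. \<exists>i. a ^ i * f \<in> P" by auto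
  have a: "a \<in> A" "a \<in> R" using insert.prems ridealD[OF A] by auto
  have "\<not> inj (\<lambda>n. add_coset P (a ^ n))"
  proof
    assume inj: "inj (\<lambda>n. add_coset P (a ^ n))"
    have "range (\<lambda>n. add_coset P (a ^ n)) \<subseteq> cosets R P"
      using power_closed[OF a(2)] by (auto simp: cosets_def)
    hence "finite (range (\<lambda>n. add_coset P (a ^ n)))" using fP finite_subset by blast
    thus False using inj finite_imageD infinite_UNIV_nat by blast
  qed
  then obtain i j where ij: "i < j" "add_coset P (a ^ i) = add_coset P (a ^ j)"
    unfolding inj_on_def by (metis linorder_neqE_nat)
  define g where "g = 1 - a ^ (j - i)"
  have "a ^ i - a ^ j \<in> P" using ij(2) coset_eq_iff[OF ridealD(2)[OF P]] by simp
  moreover have "a ^ i * g = a ^ i - a ^ j" using ij(1) by (simp add: g_def algebra_simps flip: power_add)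
  ultimately have ag: "a ^ i * g \<in> P" by simp
  have gR: "g \<in> R" by (simp add: g_def R_closed power_closed a)
  have "a ^ (j - i) = a * a ^ (j - i - 1)" using ij(1) by (simp add: power_eq_if)
  hence g1: "1 - g \<in> A" using ridealD(4)[OF A power_closed[OF a(2)] a(1)] by (simp add: g_def)
  have "1 - f * g = (1 - f) + f * (1 - g)" by (simp add: algebra_simps)
  hence "1 - f * g \<in> A" using add_subgroupD(4)[OF ridealD(2)[OF A] f(2) ridealD(3)[OF A f(1) g1]] by metis
  moreover have "\<exists>i. b ^ i * (f * g) \<in> P" if bT: "b \<in> insert a T" for b
  proof (cases "b = a")
    case True
    have "a ^ i * (f * g) = f * (a ^ i * g)" by simp
    thus ?thesis using ridealD(3)[OF P f(1) ag] True by metis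
  next
    case False
    then obtain i where "b ^ i * f \<in> P" using f bT by auto
    hence "b ^ i * f * g \<in> P" using ridealD(4)[OF P gR] by blast
    thus ?thesis by (auto simp: mult.assoc)
  qed
  ultimately show ?case using f(1) gR mult_closed by blast
qed

text \<open>Treat the elements a of \<open>T\<close> one after the other and multiply by the highest
  power of a that still keeps the product outside P. Elements treated earlier go on annihilating it
  modulo P.\<close>

lemma exists_killer_aux:
  assumes fin: "finite T" and T: "T \<subseteq> R" and P: "rideal P" and f: "f \<in> R" "f \<notin> P"
    and pow: "\<And>a. a \<in> T \<Longrightarrow> \<exists>i. a ^ i * f \<in> P"
  shows "\<exists>r\<in>R. r * f \<notin> P \<and> (\<forall>a\<in>T. a * (r * f) \<in> P)"
  using fin T pow
proof (induction T)
  case empty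
  thus ?case using f one_closed by (intro bexI[of _ 1]) auto
next
  case (insert a T)
  then obtain r where r: "r \<in> R" "r * f \<notin> P" "\<forall>a\<in>T. a * (r * f) \<in> P" by auto
  have aR: "a \<in> R" using insert.prems by auto
  obtain i where "a ^ i * f \<in> P" using insert.prems by auto
  hence "a ^ i * f * r \<in> P" using ridealD(4)[OF P r(1)] by blast
  hence ex: "\<exists>i. a ^ i * (r * f) \<in> P" by (intro exI[of _ i]) (simp add: algebra_simps)
  define l where "l = (LEAST i. a ^ i * (r * f) \<in> P)"
  have l: "a ^ l * (r * f) \<in> P" unfolding l_def using ex by (rule LeastI_ex)
  hence "l \<noteq> 0" using r(2) by (intro notI) simp
  then obtain k where k: "l = Suc k" using not0_implies_Suc by blast
  hence "a ^ k * (r * f) \<notin> P" using not_less_Least[of k "\<lambda>i. a ^ i * (r * f) \<in> P"] by (simp add: l_def)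
  moreover have "a * (a ^ k * r * f) \<in> P" using l by (simp add: k algebra_simps)
  moreover have "b * (a ^ k * r * f) \<in> P" if "b \<in> T" for b
  proof -
    have "b * (a ^ k * r * f) = a ^ k * (b * (r * f))" by (simp add: algebra_simps)
    thus ?thesis using ridealD(3)[OF P power_closed[OF aR]] r(3) that by metis
  qed
  ultimately show ?case using r(1) mult_closed power_closed[OF aR]
    by (intro bexI[of _ "a ^ k * r"]) (auto simp: mult.assoc)
qed

text \<open>Modulo P = a0 R the ideal A has a finite set \<open>T\<close> of representatives. The
  two preceding lemmas give b outside P with b A inside P, and z is b / a0.\<close>

lemma proper_ideal_inverse:
  assumes A: "rideal A" "A \<noteq> R" and a0: "a0 \<in> A" "a0 \<noteq> 0"
  obtains z where "z \<notin> R" "\<And>x. x \<in> A \<Longrightarrow> z * x \<in> R"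
proof -
  define P where "P = (*) a0 ` R"
  have a0R: "a0 \<in> R" using A a0 ridealD by blast
  have P: "rideal P" unfolding P_def by (rule rideal_principal[OF a0R])
  have PA: "P \<subseteq> A" unfolding P_def by (rule principal_subset[OF A(1) a0(1)])
  have fP: "finite (cosets R P)" using finite_mod[OF a0R a0(2)] by (simp add: P_def idx_def card_gt_0_iff)
  have "add_coset P ` A \<subseteq> cosets R P" using ridealD(1)[OF A(1)] by (auto simp: cosets_def)
  hence "finite (add_coset P ` A)" using fP finite_subset by blast
  then obtain T where T: "T \<subseteq> A" "finite T" "add_coset P ` A = add_coset P ` T"
    using finite_subset_image[of "add_coset P ` A" "add_coset P" A] by auto
  obtain f where f: "f \<in> R" "1 - f \<in> A" "\<forall>a\<in>T. \<exists>i. a ^ i * f \<in> P"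
    using exists_multiplier_aux[OF T(2,1) A(1) P fP] by blast
  have "f \<notin> P"
  proof
    assume "f \<in> P"
    hence "(1 - f) + f \<in> A" using f PA add_subgroupD(4)[OF ridealD(2)[OF A(1)]] by blast
    thus False using A rideal_eq_R_iff by simp
  qed
  moreover have "T \<subseteq> R" using T ridealD(1)[OF A(1)] by blast
  ultimately obtain r where r: "r \<in> R" "r * f \<notin> P" "\<forall>a\<in>T. a * (r * f) \<in> P"
    using exists_killer_aux[OF T(2) _ P f(1)] f(3) by blast
  define b where "b = r * f"
  show ?thesis
  proof (rule that[of "b / a0"])
    show "b / a0 \<notin> R"
    proof
      assume "b / a0 \<in> R"
      hence "a0 * (b / a0) \<in> P" unfolding P_def by (rule imageI)
      thus False using r(2) a0(2) by (simp add: b_def)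
    qed
    fix x assume x: "x \<in> A"
    then obtain t where t: "t \<in> T" "add_coset P x = add_coset P t" using T(3) by blast
    have "x - t \<in> P" using t(2) coset_eq_iff[OF ridealD(2)[OF P]] by blast
    hence "b * (x - t) \<in> P" using ridealD(3)[OF P] r f by (simp add: b_def R_closed)
    moreover have "t * b \<in> P" using r t by (simp add: b_def)
    ultimately have "b * (x - t) + t * b \<in> P" using add_subgroupD(4)[OF ridealD(2)[OF P]] by blast
    hence "b * x \<in> P" by (simp add: algebra_simps)
    then obtain s where "s \<in> R" "b * x = a0 * s" by (auto simp: P_def)
    thus "b / a0 * x \<in> R" using a0 by (simp add: field_simps)
  qed
qed

text \<open>Let I' be the inverse of I, the set of all y with y I inside R. If I' I were contained
  in A, an element z from \<open>proper_ideal_inverse\<close> would map I' to itself. As 1 is in I',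
  all z^n would be in I' and all z^n x0 in R, so z would be in R by complete integral
  closedness.\<close>

lemma ideal_invertible:
  assumes I: "rideal I" "x0 \<in> I" "x0 \<noteq> 0" and A: "rideal A" "A \<noteq> R" "a0 \<in> A" "a0 \<noteq> 0"
  shows "\<exists>x\<in>I. \<exists>y. (\<forall>w\<in>I. y * w \<in> R) \<and> y * x \<notin> A"
proof (rule ccontr)
  assume "\<not> ?thesis"
  hence *: "y * x \<in> A" if "x \<in> I" "\<forall>w\<in>I. y * w \<in> R" for x y using that by blast
  obtain z where z: "z \<notin> R" "\<And>x. x \<in> A \<Longrightarrow> z * x \<in> R"
    using proper_ideal_inverse[OF A] by blast
  have "\<forall>w\<in>I. z ^ n * w \<in> R" for n
  proof (induction n)
    case 0
    thus ?case using ridealD[OF I(1)] by simp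
  next
    case (Suc n)
    have "z * (z ^ n * w) \<in> R" if "w \<in> I" for w using * Suc z(2) that by blast
    thus ?case by (simp add: mult.assoc)
  qed
  hence "z ^ n * x0 \<in> R" for n using I by blast
  hence "z \<in> R" using completely_integrally_closed[OF I(3)] by blast
  thus False using z by blast
qed

section \<open>Maximal ideals over a nonzero element k, and the quotients I / k I\<close>

lemma finite_ideals_containing:
  assumes k: "k \<in> R" "k \<noteq> 0"
  shows "finite {I. rideal I \<and> k \<in> I}"
proof (rule inj_on_finite)
  define P where "P = (*) k ` R"
  have P: "rideal P" unfolding P_def by (rule rideal_principal[OF k(1)])
  show "inj_on (\<lambda>I. add_coset P ` I) {I. rideal I \<and> k \<in> I}"
  proof (rule inj_onI)
    have "I \<subseteq> J" if I: "rideal I" "k \<in> I" and J: "rideal J" "k \<in> J"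
      and eq: "add_coset P ` I = add_coset P ` J" for I J
    proof
      fix x assume "x \<in> I"
      then obtain y where y: "y \<in> J" "add_coset P x = add_coset P y" using eq by blast
      have "P \<subseteq> J" unfolding P_def by (rule principal_subset[OF J])
      moreover have "x - y \<in> P" using y(2) coset_eq_iff[OF ridealD(2)[OF P]] by blast
      ultimately have "(x - y) + y \<in> J" using add_subgroupD(4)[OF ridealD(2)[OF J(1)]] y by blast
      thus "x \<in> J" by simp
    qed
    thus "I = J" if "I \<in> {I. rideal I \<and> k \<in> I}" "J \<in> {I. rideal I \<and> k \<in> I}"
      "add_coset P ` I = add_coset P ` J" for I J using that by blast
  qed
  show "(\<lambda>I. add_coset P ` I) ` {I. rideal I \<and> k \<in> I} \<subseteq> Pow (cosets R P)"
    by (auto simp: cosets_def ridealD)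
  show "finite (Pow (cosets R P))"
    using finite_mod[OF k] by (simp add: P_def idx_def card_gt_0_iff)
qed

definition maximal_over :: "'k \<Rightarrow> 'k set set" where
  "maximal_over k = {P. rideal P \<and> k \<in> P \<and> P \<noteq> R \<and> (\<forall>Q. rideal Q \<longrightarrow> P \<subseteq> Q \<longrightarrow> Q \<noteq> R \<longrightarrow> Q = P)}"

lemma exists_maximal_over:
  assumes k: "k \<in> R" "k \<noteq> 0" and B: "rideal B" "k \<in> B" "B \<noteq> R"
  obtains P where "P \<in> maximal_over k" "B \<subseteq> P"
proof -
  let ?S = "{I. rideal I \<and> k \<in> I} - {R}"
  have "finite ?S" using finite_ideals_containing[OF k] by simp
  moreover have "B \<in> ?S" using B by simp
  ultimately have "\<exists>P\<in>?S. B \<subseteq> P \<and> (\<forall>Q\<in>?S. P \<subseteq> Q \<longrightarrow> P = Q)"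
    by (rule finite_has_maximal2)
  then obtain P where P: "P \<in> ?S" "B \<subseteq> P \<and> (\<forall>Q\<in>?S. P \<subseteq> Q \<longrightarrow> P = Q)" by (rule bexE)
  have "Q = P" if "rideal Q" "P \<subseteq> Q" "Q \<noteq> R" for Q
    using bspec[OF conjunct2[OF P(2)], of Q] P(1) that by blast
  hence "P \<in> maximal_over k" using P(1) unfolding maximal_over_def by blast
  thus ?thesis using that P by blast
qed

lemma maximal_over_prime:
  assumes P: "P \<in> maximal_over k" and x: "x \<in> R" "x \<notin> P" and y: "y \<in> R" "y \<notin> P"
  shows "x * y \<notin> P"
proof
  assume xy: "x * y \<in> P"
  have P1: "rideal P" and P2: "\<And>Q. rideal Q \<Longrightarrow> P \<subseteq> Q \<Longrightarrow> Q \<noteq> R \<Longrightarrow> Q = P"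
    using P by (auto simp: maximal_over_def)
  note PD = ridealD[OF P1]
  define Q where "Q = ideal_sum P 1 R x"
  have QI: "p + r * x \<in> Q" if "p \<in> P" "r \<in> R" for p r
    using ideal_sumI[OF that, of 1 x] by (simp add: Q_def)
  have Q: "rideal Q" unfolding Q_def by (rule rideal_ideal_sum[OF P1 rideal_R one_closed x(1)])
  have "P \<subseteq> Q" using QI[OF _ R_closed(4)] by auto
  moreover have "x \<in> Q" using QI[OF add_subgroupD(1)[OF PD(2)] one_closed] by simp
  ultimately have "Q = R" using P2[OF Q] x(2) by blast
  hence "1 \<in> Q" using one_closed by simp
  then obtain p r where pr: "1 = p + r * x" "p \<in> P" "r \<in> R" by (auto simp: Q_def ideal_sum_def)
  have "y = y * (p + r * x)" by (simp flip: pr(1))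
  also have "\<dots> = y * p + r * (x * y)" by (simp add: algebra_simps)
  also have "\<dots> \<in> P" by (rule add_subgroupD(4)[OF PD(2) PD(3)[OF y(1) pr(2)] PD(3)[OF pr(3) xy]])
  finally show False using y(2) by blast
qed

text \<open>The element \<open>u\<close> identifies \<open>R / k R\<close> with \<open>I / k I\<close>.\<close>

lemma ideal_cyclic_mod:
  assumes I: "rideal I" "x0 \<in> I" "x0 \<noteq> 0" and k: "k \<in> R" "k \<noteq> 0"
  obtains u where "u \<in> I" "\<And>x. x \<in> I \<Longrightarrow> \<exists>r\<in>R. \<exists>y\<in>I. x = r * u + k * y"
    "\<And>r y. r \<in> R \<Longrightarrow> y \<in> I \<Longrightarrow> r * u = k * y \<Longrightarrow> \<exists>s\<in>R. r = k * s"
proof -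
  note ID = ridealD[OF I(1)]
  let ?M = "maximal_over k"
  have finM: "finite ?M"
    by (rule finite_subset[OF _ finite_ideals_containing[OF k]]) (auto simp: maximal_over_def)
  have M: "rideal P" "k \<in> P" "P \<noteq> R" if "P \<in> ?M" for P using that by (auto simp: maximal_over_def)
  \<comment> \<open>A local generator at P: some product v w, with w in I and v in the inverse of I,
    is nonzero modulo P.\<close>
  have "\<exists>x y. x \<in> I \<and> (\<forall>w\<in>I. y * w \<in> R) \<and> y * x \<notin> P" if "P \<in> ?M" for P
    using ideal_invertible[OF I M(1,3)[OF that] M(2)[OF that] k(2)] by blast
  then obtain w v where wv: "\<And>P. P \<in> ?M \<Longrightarrow> w P \<in> I \<and> (\<forall>z\<in>I. v P * z \<in> R) \<and> v P * w P \<notin> P" by metis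
  hence w: "\<And>P. P \<in> ?M \<Longrightarrow> w P \<in> I" and v: "\<And>P w. P \<in> ?M \<Longrightarrow> w \<in> I \<Longrightarrow> v P * w \<in> R"
    and vw: "\<And>P. P \<in> ?M \<Longrightarrow> v P * w P \<notin> P" by blast+
  \<comment> \<open>The finitely many maximal ideals over k are separated: each Q other than P has
    an element outside P, and by primality of P the product of these elements stays outside
    P.\<close>
  have "\<exists>e\<in>R. e \<notin> P \<and> (\<forall>Q\<in>?M - {P}. e \<in> Q)" if P: "P \<in> ?M" for P
  proof -
    have "\<exists>q. q \<in> Q \<and> q \<notin> P" if "Q \<in> ?M - {P}" for Q
      using that P by (auto simp: maximal_over_def)
    then obtain q where q: "\<And>Q. Q \<in> ?M - {P} \<Longrightarrow> q Q \<in> Q \<and> q Q \<notin> P" by metis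
    have "prod q T \<in> R \<and> prod q T \<notin> P \<and> (\<forall>Q\<in>T. prod q T \<in> Q)" if "finite T" "T \<subseteq> ?M - {P}" for T
      using that
    proof (induction T)
      case empty
      thus ?case using one_closed M[OF P] rideal_eq_R_iff by auto
    next
      case (insert Q T)
      have QM: "Q \<in> ?M - {P}" using insert.prems by blast
      have Q: "q Q \<in> Q" "q Q \<notin> P" "rideal Q" using q[OF QM] M QM by blast+
      hence "q Q \<in> R" using ridealD by blast
      moreover have T: "prod q T \<in> R \<and> prod q T \<notin> P \<and> (\<forall>Q\<in>T. prod q T \<in> Q)" using insert by auto
      ultimately have "q Q * prod q T \<in> R" "q Q * prod q T \<notin> P" "q Q * prod q T \<in> Q"
        using maximal_over_prime[OF P] Q ridealD(4)[OF Q(3)] mult_closed by auto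
      moreover have "q Q * prod q T \<in> Q'" if "Q' \<in> T" for Q'
        using ridealD(3)[of Q' "q Q" "prod q T"] T that M insert.prems \<open>q Q \<in> R\<close> by auto
      ultimately show ?case using insert.hyps by auto
    qed
    from this[of "?M - {P}"] show ?thesis using finM by auto
  qed
  hence "\<forall>P\<in>?M. \<exists>e. e \<in> R \<and> e \<notin> P \<and> (\<forall>Q\<in>?M - {P}. e \<in> Q)" by blast
  from bchoice[OF this] obtain e
    where e': "\<forall>P\<in>?M. e P \<in> R \<and> e P \<notin> P \<and> (\<forall>Q\<in>?M - {P}. e P \<in> Q)" ..
  hence e: "\<And>P. P \<in> ?M \<Longrightarrow> e P \<in> R" "\<And>P. P \<in> ?M \<Longrightarrow> e P \<notin> P"
    "\<And>P Q. P \<in> ?M \<Longrightarrow> Q \<in> ?M \<Longrightarrow> Q \<noteq> P \<Longrightarrow> e P \<in> Q" by blast+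
  \<comment> \<open>The Chinese remainder idea: modulo P only the term belonging to P survives in
    \<open>v P * u\<close>, so u is a local generator at every P at once.\<close>
  define u where "u = (\<Sum>P\<in>?M. e P * w P)"
  have u: "u \<in> I" unfolding u_def by (intro add_subgroup_sum[OF ID(2)] ID(3) e w)
  have vu: "v P * u \<notin> P" if P: "P \<in> ?M" for P
  proof
    assume "v P * u \<in> P"
    have "v P * u = e P * (v P * w P) + (\<Sum>Q\<in>?M - {P}. e Q * (v P * w Q))"
      unfolding u_def using finM P by (simp add: sum.remove[of _ P] sum_distrib_left algebra_simps)
    moreover have "(\<Sum>Q\<in>?M - {P}. e Q * (v P * w Q)) \<in> P"
    proof (rule add_subgroup_sum[OF ridealD(2)[OF M(1)[OF P]]])
      fix Q assume "Q \<in> ?M - {P}"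
      thus "e Q * (v P * w Q) \<in> P"
        using e(3)[of Q P] P v[OF P w] by (intro ridealD(4)[OF M(1)[OF P]]) auto
    qed
    ultimately have "e P * (v P * w P) \<in> P"
      using add_subgroupD(2)[OF ridealD(2)[OF M(1)[OF P]] \<open>v P * u \<in> P\<close>] by fastforce
    thus False using maximal_over_prime[OF P e(1,2)[OF P] v[OF P w[OF P]] vw[OF P]] by blast
  qed
  define J where "J = ideal_sum R u I k"
  have JI: "r * u + k * y \<in> J" if "y \<in> I" "r \<in> R" for r y
    using ideal_sumI[OF that(2,1), of u k] by (simp add: J_def mult.commute)
  have "rideal J" unfolding J_def using ID(1) u k by (intro rideal_ideal_sum rideal_R I)
  hence J: "add_subgroup J" and JR: "\<And>s a. s \<in> R \<Longrightarrow> a \<in> J \<Longrightarrow> s * a \<in> J" using ridealD by blast+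
  have uJ: "r * u \<in> J" if "r \<in> R" for r
    using JI[OF add_subgroupD(1)[OF ID(2)] that] by simp
  have kJ: "k * y \<in> J" if "y \<in> I" for y
    using JI[OF that R_closed(4)] by simp
  have IJ: "x \<in> J" if x: "x \<in> I" for x
  proof -
    \<comment> \<open>All multipliers of I into J = u R + k I. They form an ideal containing k; if
      it were proper, it would lie in some maximal P over k. But \<open>v P * u\<close> is a
      multiplier, since \<open>v P * x\<close> is in R for x in I, and it is not in P.\<close>
    define B where "B = {r\<in>R. \<forall>x\<in>I. r * x \<in> J}"
    have B: "rideal B"
      unfolding rideal_def add_subgroup_def B_def
      using add_subgroupD[OF J] JR R_closed by (auto simp: left_diff_distrib mult.assoc)
    have kB: "k \<in> B" using kJ k by (auto simp: B_def)
    have "B = R"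
    proof (rule ccontr)
      assume "B \<noteq> R"
      then obtain P where P: "P \<in> ?M" "B \<subseteq> P" using exists_maximal_over[OF k B kB] by blast
      have "v P * u * x \<in> J" if "x \<in> I" for x
        using uJ[OF v[OF P(1) that]] by (simp add: algebra_simps)
      hence "v P * u \<in> B" using v[OF P(1) u] by (auto simp: B_def)
      thus False using vu P by blast
    qed
    hence "1 \<in> B" using one_closed by simp
    thus ?thesis using x by (auto simp: B_def)
  qed
  \<comment> \<open>If r u = k y, then r / k maps I = u R + k I into I, and complete integral
    closedness puts it into R.\<close>
  have inj: "\<exists>s\<in>R. r = k * s" if r: "r \<in> R" "y \<in> I" "r * u = k * y" for r y
  proof -
    have zI: "r / k * x \<in> I" if x: "x \<in> I" for x
    proof -
      obtain s t where st: "s \<in> R" "t \<in> I" "x = s * u + k * t"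
        using IJ[OF x] by (auto simp: J_def ideal_sum_def mult.commute)
      have "r / k * x = s * (r * u) / k + r * t" using k by (simp add: st field_simps)
      also have "\<dots> = s * y + r * t" using k by (simp add: r)
      also have "\<dots> \<in> I" using st r by (intro add_subgroupD(4)[OF ID(2)] ID(3))
      finally show ?thesis .
    qed
    have "(r / k) ^ n * x0 \<in> I" for n
      by (induction n) (auto simp: I mult.assoc simp del: times_divide_eq_left intro: zI)
    hence "r / k \<in> R" using completely_integrally_closed[OF I(3)] ID(1) by blast
    thus ?thesis using k by (intro bexI[of _ "r / k"]) auto
  qed
  show ?thesis
  proof (rule that[OF u _ inj])
    show "\<exists>r\<in>R. \<exists>y\<in>I. x = r * u + k * y" if "x \<in> I" for x
      using IJ[OF that] by (auto simp: J_def ideal_sum_def mult.commute)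
  qed
qed

end

section \<open>Submodules of lattices\<close>

lemma fds_shift_0 [simp]: "fds_shift 0 f = f"
  by (rule fds_eqI) (simp add: fds_shift_def fds_nth_fds)

lemma fds_shift_shift: "fds_shift a (fds_shift b f) = fds_shift (a + b) f"
  by (rule fds_eqI) (simp add: fds_shift_def fds_nth_fds power_add)

lemma fds_shift_1: "fds_shift c 1 = 1"
  by (rule fds_eqI) (simp add: fds_shift_def fds_nth_fds one_fds_def)

lemma fds_shift_mult: "fds_shift c (f * g) = fds_shift c f * fds_shift c g"
proof (rule fds_eqI)
  fix k :: nat assume k: "k > 0"
  have *: "of_nat k ^ c * (fds_nth f d * fds_nth g (k div d)) =
      (of_nat d ^ c * fds_nth f d) * (of_nat (k div d) ^ c * fds_nth g (k div d))" if "d dvd k" for d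
  proof -
    have "of_nat k = (of_nat d * of_nat (k div d) :: complex)" using that by (simp flip: of_nat_mult)
    thus ?thesis by (simp add: power_mult_distrib)
  qed
  have "fds_nth (fds_shift c (f * g)) k = (\<Sum>d | d dvd k. of_nat k ^ c * (fds_nth f d * fds_nth g (k div d)))"
    using k by (simp add: fds_shift_def times_fds_def fds_nth_fds sum_distrib_left)
  also have "\<dots> = (\<Sum>d | d dvd k. fds_nth (fds_shift c f) d * fds_nth (fds_shift c g) (k div d))"
  proof (rule sum.cong[OF refl])
    fix d assume "d \<in> {d. d dvd k}"
    hence d: "d dvd k" by simp
    hence "d > 0" "k div d > 0" using k by (auto simp: dvd_pos_nat)
    thus "of_nat k ^ c * (fds_nth f d * fds_nth g (k div d)) =
        fds_nth (fds_shift c f) d * fds_nth (fds_shift c g) (k div d)"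
      unfolding *[OF d] by (simp add: fds_shift_def fds_nth_fds)
  qed
  also have "\<dots> = fds_nth (fds_shift c f * fds_shift c g) k"
    using k by (simp add: times_fds_def fds_nth_fds)
  finally show "fds_nth (fds_shift c (f * g)) k = fds_nth (fds_shift c f * fds_shift c g) k" .
qed

lemma fds_shift_prod: "fds_shift c (\<Prod>i\<in>A. f i) = (\<Prod>i\<in>A. fds_shift c (f i))"
  by (induction A rule: infinite_finite_induct) (simp_all add: fds_shift_1 fds_shift_mult)

definition vscale :: "'a :: times \<Rightarrow> ('i \<Rightarrow> 'a) \<Rightarrow> 'i \<Rightarrow> 'a" where
  "vscale r x = (\<lambda>i. r * x i)"

lemma vscale_apply [simp]: "vscale r x i = r * x i"
  by (simp add: vscale_def)

lemma vscale_simps: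
  fixes r s :: "'a :: comm_ring_1"
  shows "vscale r (x + y) = vscale r x + vscale r y" "vscale r (x - y) = vscale r x - vscale r y"
    "vscale r (vscale s x) = vscale (r * s) x" "vscale (r + s) x = vscale r x + vscale s x"
    "vscale (r - s) x = vscale r x - vscale s x" "vscale r 0 = 0" "vscale 0 x = 0" "vscale 1 x = x"
  by (simp_all add: fun_eq_iff algebra_simps)

section \<open>Counting ideals and submodules of a given index\<close>

context number_ring
begin

definition ideal_count :: "nat \<Rightarrow> nat" where
  "ideal_count n = card {I. rideal I \<and> idx R I = n}"

lemma finite_ideals_of_index:
  assumes "n > 0"
  shows "finite {I. rideal I \<and> idx R I = n}"
proof (rule finite_subset)
  show "{I. rideal I \<and> idx R I = n} \<subseteq> {I. rideal I \<and> of_nat n \<in> I}"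
    using idx_pos_nonzero assms by auto
  show "finite {I. rideal I \<and> of_nat n \<in> I}"
    using assms by (intro finite_ideals_containing of_nat_closed) simp
qed

text \<open>With u from \<open>ideal_cyclic_mod\<close> for k = n, multiplication by u identifies R
  / n R with I / n I. Ideals of index n in R contain n R, and those of index n in I contain n I, so
  they correspond: J goes to the set of r with r u in J, and A goes back to u A + n I.\<close>

lemma subideals_of_index:
  assumes I: "rideal I" "x0 \<in> I" "x0 \<noteq> 0" and n: "n > 0"
  shows "finite {J. rideal J \<and> J \<subseteq> I \<and> idx I J = n}"
    and "card {J. rideal J \<and> J \<subseteq> I \<and> idx I J = n} = ideal_count n"
proof -
  note ID = ridealD[OF I(1)]
  define k :: 'k where "k = of_nat n"
  have k: "k \<in> R" "k \<noteq> 0" using n by (auto simp: k_def of_nat_closed)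
  obtain u where u: "u \<in> I" "\<And>x. x \<in> I \<Longrightarrow> \<exists>r\<in>R. \<exists>y\<in>I. x = r * u + k * y"
    "\<And>r y. r \<in> R \<Longrightarrow> y \<in> I \<Longrightarrow> r * u = k * y \<Longrightarrow> \<exists>s\<in>R. r = k * s"
    using ideal_cyclic_mod[OF I k] by metis
  define S where "S = {J. rideal J \<and> J \<subseteq> I \<and> idx I J = n}"
  define g where "g J = {r\<in>R. r * u \<in> J}" for J
  have g_ideal: "rideal (g J)" if "rideal J" for J
    using ridealD[OF that] add_subgroupD[OF ridealD(2)[OF that]] R_closed
    by (auto simp: rideal_def add_subgroup_def g_def left_diff_distrib mult.assoc)
  have kI: "k * y \<in> J" if "J \<in> S" "y \<in> I" for J y
    using of_nat_idx_mult_mem[of J I y] that n ID(2) ridealD(2)[of J] by (auto simp: S_def k_def)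
  have idx: "idx R (g J) = idx I J" if J: "rideal J" and kJ: "\<And>y. y \<in> I \<Longrightarrow> k * y \<in> J" for J
  proof (rule idx_eqI[of _ _ _ "\<lambda>r. r * u"])
    show "add_subgroup (g J)" "add_subgroup J" using g_ideal[OF J] J ridealD(2) by auto
    show "\<exists>x\<in>R. y - x * u \<in> J" if "y \<in> I" for y using u(2)[OF that] kJ by force
  qed (use u ID R_closed in \<open>auto simp: g_def simp flip: left_diff_distrib\<close>)
  have sub: "J \<subseteq> J'" if "J \<in> S" "J' \<in> S" "g J = g J'" for J J'
  proof
    fix x assume x: "x \<in> J"
    hence "x \<in> I" using that by (auto simp: S_def)
    then obtain r y where ry: "r \<in> R" "y \<in> I" "x = r * u + k * y" using u(2) by blast
    have JJ: "add_subgroup J" "add_subgroup J'" using that ridealD(2) by (auto simp: S_def)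
    have "r * u \<in> J" using add_subgroupD(2)[OF JJ(1) x kI[OF that(1) ry(2)]] by (simp add: ry)
    hence "r * u \<in> J'" using that(3) ry(1) by (auto simp: g_def)
    thus "x \<in> J'" using add_subgroupD(4)[OF JJ(2) _ kI[OF that(2) ry(2)]] by (simp add: ry)
  qed
  have "bij_betw g S {A. rideal A \<and> idx R A = n}"
  proof (rule bij_betw_imageI)
    show "inj_on g S" by (rule inj_onI) (use sub in blast)
    show "g ` S = {A. rideal A \<and> idx R A = n}"
    proof
      show "g ` S \<subseteq> {A. rideal A \<and> idx R A = n}"
        using g_ideal idx kI by (auto simp: S_def)
      show "{A. rideal A \<and> idx R A = n} \<subseteq> g ` S"
      proof
        fix A assume "A \<in> {A. rideal A \<and> idx R A = n}"
        hence A: "rideal A" "idx R A = n" by auto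
        note AD = ridealD[OF A(1)]
        have kA: "k \<in> A" using idx_pos_nonzero[OF A(1)] A n by (simp add: k_def)
        define J where "J = ideal_sum A u I k"
        have JI: "r * u + k * y \<in> J" if "r \<in> A" "y \<in> I" for r y
          using ideal_sumI[OF that, of u k] by (simp add: J_def mult.commute)
        have J: "rideal J" unfolding J_def using ID(1) u(1) k by (intro rideal_ideal_sum A I)
        have JsubI: "J \<subseteq> I"
          using add_subgroupD(4)[OF ID(2) ID(3)[OF AD(1) u(1)] ID(4)[OF k(1)]]
          by (auto simp: J_def ideal_sum_def)
        have kJ: "k * y \<in> J" if "y \<in> I" for y
          using JI[OF add_subgroupD(1)[OF AD(2)] that] by simp
        have "g J = A"
        proof
          show "A \<subseteq> g J"
            using JI[OF _ add_subgroupD(1)[OF ID(2)]] AD(1) by (auto simp: g_def)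
          show "g J \<subseteq> A"
          proof
            fix r assume "r \<in> g J"
            then obtain r' y where r: "r \<in> R" "r * u = r' * u + k * y" "r' \<in> A" "y \<in> I"
              by (auto simp: g_def J_def ideal_sum_def mult.commute)
            hence "(r - r') * u = k * y" by (simp add: algebra_simps)
            then obtain s where "s \<in> R" "r - r' = k * s" using u(3) r AD(1) R_closed by metis
            hence "r - r' \<in> A" using AD(4)[OF _ kA] by auto
            from add_subgroupD(4)[OF AD(2) this r(3)] show "r \<in> A" by simp
          qed
        qed
        moreover have "J \<in> S" using J JsubI idx[OF J kJ] A \<open>g J = A\<close> by (simp add: S_def)
        ultimately show "A \<in> g ` S" by blast
      qed
    qed
  qed
  thus "finite {J. rideal J \<and> J \<subseteq> I \<and> idx I J = n}"
    and "card {J. rideal J \<and> J \<subseteq> I \<and> idx I J = n} = ideal_count n"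
    using bij_betw_finite[of g S] finite_ideals_of_index[OF n] bij_betw_same_card[of g S]
    by (auto simp: S_def ideal_count_def)
qed

text \<open>R^m as sequences that vanish from m on: the kernel of coordinate m on
  \<open>vecs (Suc m)\<close> is \<open>vecs m\<close> itself, so the induction on m needs no
  reindexing.\<close>

definition vecs :: "nat \<Rightarrow> (nat \<Rightarrow> 'k) set" where
  "vecs m = {x. (\<forall>i<m. x i \<in> R) \<and> (\<forall>i\<ge>m. x i = 0)}"

definition submod :: "(nat \<Rightarrow> 'k) set \<Rightarrow> bool" where
  "submod N \<longleftrightarrow> add_subgroup N \<and> (\<forall>r\<in>R. \<forall>x\<in>N. vscale r x \<in> N)"

lemma submodD:
  assumes "submod N"
  shows "add_subgroup N" "r \<in> R \<Longrightarrow> x \<in> N \<Longrightarrow> vscale r x \<in> N"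
  using assms by (auto simp: submod_def)

lemma submod_vecs: "submod (vecs m)"
  by (auto simp: submod_def add_subgroup_def vecs_def R_closed)

definition submods_of_index :: "(nat \<Rightarrow> 'k) set \<Rightarrow> nat \<Rightarrow> (nat \<Rightarrow> 'k) set set" where
  "submods_of_index L k = {N. submod N \<and> N \<subseteq> L \<and> idx L N = k}"

lemma rideal_coordinate:
  assumes "submod N" "N \<subseteq> vecs m"
  shows "rideal ((\<lambda>x. x i) ` N)"
  unfolding rideal_def add_subgroup_def
proof (intro conjI ballI)
  note ND = submodD[OF assms(1)]
  note NG = add_subgroupD[OF ND(1)]
  show "(\<lambda>x. x i) ` N \<subseteq> R"
  proof
    fix a assume "a \<in> (\<lambda>x. x i) ` N"
    then obtain x where "x \<in> vecs m" "a = x i" using assms(2) by blast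
    thus "a \<in> R" using R_closed(4) by (cases "i < m") (auto simp: vecs_def)
  qed
  show "0 \<in> (\<lambda>x. x i) ` N" using NG(1) by (rule rev_image_eqI) simp
  show "a - b \<in> (\<lambda>x. x i) ` N" if ab: "a \<in> (\<lambda>x. x i) ` N" "b \<in> (\<lambda>x. x i) ` N" for a b
  proof -
    obtain x y where "x \<in> N" "y \<in> N" "a = x i" "b = y i" using ab by auto
    thus ?thesis using NG(2)[of x y] by (intro image_eqI[of _ _ "x - y"]) auto
  qed
  show "r * a \<in> (\<lambda>x. x i) ` N" if r: "r \<in> R" and a: "a \<in> (\<lambda>x. x i) ` N" for r a
  proof -
    obtain x where "x \<in> N" "a = x i" using a by auto
    thus ?thesis using ND(2)[OF r, of x] by (intro image_eqI[of _ _ "vscale r x"]) auto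
  qed
qed

lemma submod_kernel: "submod N \<Longrightarrow> submod {x\<in>N. x i = 0}"
  by (auto simp: submod_def add_subgroup_def)

text \<open>
  A submodule \<open>N\<close> of \<open>L\<close> with prescribed last coordinates \<open>J\<close> and prescribed kernel \<open>N'\<close> is
  determined by a vector in \<open>N\<close> whose last coordinate generates \<open>J\<close> modulo the exponent of \<open>L' / N'\<close>;
  such a vector is arbitrary modulo \<open>N'\<close>.
\<close>

lemma submods_with_projection:
  assumes L: "submod L" "L \<subseteq> vecs (Suc m)"
    and J: "rideal J" "J \<subseteq> (\<lambda>x. x m) ` L" "j0 \<in> J" "j0 \<noteq> 0"
    and N': "submod N'" "N' \<subseteq> {x\<in>L. x m = 0}" and pos: "idx {x\<in>L. x m = 0} N' > 0"
  defines "F \<equiv> {N. submod N \<and> N \<subseteq> L \<and> (\<lambda>x. x m) ` N = J \<and> {x\<in>N. x m = 0} = N'}"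
  shows "finite F" "card F = idx {x\<in>L. x m = 0} N'"
proof -
  define L' where "L' = {x\<in>L. x m = 0}"
  define b where "b = idx L' N'"
  define d :: 'k where "d = of_nat b"
  have d: "d \<in> R" "d \<noteq> 0" using pos by (auto simp: d_def b_def L'_def of_nat_closed)
  note JD = ridealD[OF J(1)]
  note LD = submodD[OF L(1)]
  note LG = add_subgroupD[OF LD(1)]
  note N'D = submodD[OF N'(1)]
  note N'G = add_subgroupD[OF N'D(1)]
  have L'G: "add_subgroup L'" using submod_kernel[OF L(1)] submodD by (simp add: L'_def)
  have N'L': "N' \<subseteq> L'" using N' by (simp add: L'_def)
  have dL': "vscale d y \<in> N'" if "y \<in> L'" for y
  proof -
    \<comment> \<open>\<open>of_nat b\<close> is a constant function here, and the product is
      pointwise.\<close>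
    have "of_nat b * y \<in> N'"
      unfolding b_def by (rule of_nat_idx_mult_mem[OF N'D(1) L'G that]) (use pos in \<open>simp add: L'_def\<close>)
    moreover have "of_nat b * y = vscale d y" by (simp add: fun_eq_iff d_def of_nat_fun)
    ultimately show ?thesis by simp
  qed
  obtain u where u: "u \<in> J" "\<And>x. x \<in> J \<Longrightarrow> \<exists>r\<in>R. \<exists>y\<in>J. x = r * u + d * y"
    "\<And>r y. r \<in> R \<Longrightarrow> y \<in> J \<Longrightarrow> r * u = d * y \<Longrightarrow> \<exists>s\<in>R. r = d * s"
    using ideal_cyclic_mod[OF J(1,3,4) d] by metis
  obtain x0 where x0: "x0 \<in> L" "x0 m = u" using u(1) J(2) by auto
  define LJ where "LJ = {l\<in>L. l m \<in> J}"
  \<comment> \<open>\<open>LJ\<close> consists of the vectors of L with last coordinate in J. For x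
    with last coordinate u, the submodule N' + R x + d \<open>LJ\<close> is the only possible member
    of \<open>F\<close> that contains x.\<close>
  define gen where "gen x = {n + vscale r x + vscale d l | n r l. n \<in> N' \<and> r \<in> R \<and> l \<in> LJ}" for x
  \<comment> \<open>The vectors of N with last coordinate u, translated by x0; they turn out to form
    a single coset of N'.\<close>
  define Phi where "Phi N = {y\<in>L'. x0 + y \<in> N}" for N
  have F: "submod N" "N \<subseteq> L" "(\<lambda>x. x m) ` N = J" "{x\<in>N. x m = 0} = N'" if "N \<in> F" for N
    using that by (auto simp: F_def)
  have gen_eq: "N = gen x" if N: "N \<in> F" and x: "x \<in> N" "x m = u" for N x
  proof
    note ND = submodD[OF F(1)[OF N]]
    note NG = add_subgroupD[OF ND(1)]
    have N'N: "N' \<subseteq> N" using F(4)[OF N] by blast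
    \<comment> \<open>Any l in \<open>LJ\<close> agrees in the last coordinate with some y in N, and
      d annihilates L' modulo N'.\<close>
    have dLJ: "vscale d l \<in> N" if l: "l \<in> LJ" for l
    proof -
      obtain y where y: "y \<in> N" "l m = y m" using F(3)[OF N] l by (auto simp: LJ_def)
      have "l - y \<in> L'" using y l F(2)[OF N] LG by (auto simp: L'_def LJ_def)
      from dL'[OF this] have "vscale d (l - y) \<in> N" using N'N by blast
      moreover have "vscale d y \<in> N" using ND(2) d y by blast
      ultimately have "vscale d (l - y) + vscale d y \<in> N" by (rule NG(4))
      thus ?thesis by (simp add: vscale_simps)
    qed
    show "gen x \<subseteq> N"
      using dLJ N'N ND(2)[OF _ x(1)] by (auto simp: gen_def intro!: NG(4))
    show "N \<subseteq> gen x"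
    proof
      fix z assume z: "z \<in> N"
      hence "z m \<in> J" using F(3)[OF N] by blast
      then obtain r j where rj: "r \<in> R" "j \<in> J" "z m = r * u + d * j" using u(2) by blast
      then obtain l where l: "l \<in> L" "l m = j" using J(2) by auto
      hence lJ: "l \<in> LJ" using rj by (simp add: LJ_def)
      define n where "n = z - vscale r x - vscale d l"
      have "n \<in> N" unfolding n_def using z ND(2)[OF rj(1) x(1)] dLJ[OF lJ] by (intro NG(2))
      moreover have "n m = 0" using rj l x by (simp add: n_def)
      ultimately have "n \<in> N'" using F(4)[OF N] by blast
      moreover have "z = n + vscale r x + vscale d l" by (simp add: n_def)
      ultimately show "z \<in> gen x" unfolding gen_def using rj lJ by blast
    qed
  qed
  have Phi_eq: "Phi N = add_coset N' (x - x0)" if N: "N \<in> F" and x: "x \<in> N" "x m = u" for N x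
  proof -
    note NG = add_subgroupD[OF submodD(1)[OF F(1)[OF N]]]
    have xL: "x - x0 \<in> L'" using x x0 F(2)[OF N] LG by (auto simp: L'_def)
    have "y \<in> L' \<and> x0 + y \<in> N \<longleftrightarrow> y - (x - x0) \<in> N'" for y
    proof
      assume y: "y \<in> L' \<and> x0 + y \<in> N"
      have "(x0 + y) - x \<in> N" using y x NG(2) by blast
      moreover have "((x0 + y) - x) m = 0" using y x x0 by (simp add: L'_def)
      ultimately have "(x0 + y) - x \<in> N'" using F(4)[OF N] by blast
      thus "y - (x - x0) \<in> N'" by (simp add: algebra_simps)
    next
      assume y: "y - (x - x0) \<in> N'"
      have "y - (x - x0) + (x - x0) \<in> L'" using y N'L' xL by (intro add_subgroupD(4)[OF L'G]) auto
      moreover have "y - (x - x0) + x \<in> N" using y F(4)[OF N] x by (intro NG(4)) auto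
      ultimately show "y \<in> L' \<and> x0 + y \<in> N" by (simp add: algebra_simps)
    qed
    thus ?thesis unfolding Phi_def add_coset_def by blast
  qed
  have ex_gen: "\<exists>x\<in>N. x m = u" if "N \<in> F" for N using F(3)[OF that] u(1) by auto
  have gen_F: "gen x \<in> F" "x \<in> gen x" if x: "x \<in> L" "x m = u" for x
  proof -
    have genI: "n + vscale r x + vscale d l \<in> gen x" if "n \<in> N'" "r \<in> R" "l \<in> LJ" for n r l
      using that by (auto simp: gen_def)
    have LJ: "submod LJ"
      using LG LD JD add_subgroupD[OF JD(2)] by (auto simp: LJ_def submod_def add_subgroup_def)
    note LJD = submodD[OF LJ]
    note LJG = add_subgroupD[OF LJD(1)]
    show "x \<in> gen x" using genI[OF N'G(1) one_closed LJG(1)] by (simp add: vscale_simps)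
    have "submod (gen x)"
      unfolding submod_def add_subgroup_def
    proof (intro conjI ballI)
      show "0 \<in> gen x" using genI[OF N'G(1) R_closed(4) LJG(1)] by (simp add: vscale_simps)
      show "y - z \<in> gen x" if yz: "y \<in> gen x" "z \<in> gen x" for y z
      proof -
        obtain n r l n' r' l' where *: "y = n + vscale r x + vscale d l" "z = n' + vscale r' x + vscale d l'"
          "n \<in> N'" "r \<in> R" "l \<in> LJ" "n' \<in> N'" "r' \<in> R" "l' \<in> LJ"
          using yz by (auto simp: gen_def)
        have "y - z = (n - n') + vscale (r - r') x + vscale d (l - l')"
          by (simp add: * vscale_simps)
        thus ?thesis using genI[OF N'G(2)[OF *(3,6)] R_closed(2)[OF *(4,7)] LJG(2)[OF *(5,8)]] by simp
      qed
      show "vscale s y \<in> gen x" if s: "s \<in> R" and y: "y \<in> gen x" for s y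
      proof -
        obtain n r l where *: "y = n + vscale r x + vscale d l" "n \<in> N'" "r \<in> R" "l \<in> LJ"
          using y by (auto simp: gen_def)
        have "vscale s y = vscale s n + vscale (s * r) x + vscale d (vscale s l)"
          by (simp add: * vscale_simps mult.commute)
        thus ?thesis using genI[OF N'D(2)[OF s *(2)] mult_closed[OF s *(3)] LJD(2)[OF s *(4)]] by simp
      qed
    qed
    moreover have "gen x \<subseteq> L"
      using N' x d by (auto simp: gen_def LJ_def intro!: LG(4) LD(2))
    moreover have "(\<lambda>x. x m) ` gen x = J"
    proof
      have "n m + r * x m + d * l m \<in> J" if "n \<in> N'" "r \<in> R" "l \<in> LJ" for n r l
      proof -
        have "n m = 0" using that N' by auto
        thus ?thesis using that x u(1) d JD by (auto simp: LJ_def intro!: add_subgroupD(4)[OF JD(2)])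
      qed
      thus "(\<lambda>x. x m) ` gen x \<subseteq> J" by (auto simp: gen_def)
      show "J \<subseteq> (\<lambda>x. x m) ` gen x"
      proof
        fix j assume "j \<in> J"
        then obtain r i where ri: "r \<in> R" "i \<in> J" "j = r * u + d * i" using u(2) by blast
        then obtain l where l: "l \<in> L" "l m = i" using J(2) by auto
        have "0 + vscale r x + vscale d l \<in> gen x"
          by (rule genI) (use N'G ri l in \<open>auto simp: LJ_def\<close>)
        moreover have "(0 + vscale r x + vscale d l) m = j" using l x ri by simp
        ultimately show "j \<in> (\<lambda>x. x m) ` gen x" by (metis image_eqI)
      qed
    qed
    moreover have "{y\<in>gen x. y m = 0} = N'"
    proof
      show "N' \<subseteq> {y\<in>gen x. y m = 0}"
        using genI[OF _ R_closed(4) LJG(1)] N' by (auto simp: vscale_simps)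
      show "{y\<in>gen x. y m = 0} \<subseteq> N'"
      proof
        fix y assume "y \<in> {y\<in>gen x. y m = 0}"
        then obtain n r l where *: "y = n + vscale r x + vscale d l" "n \<in> N'" "r \<in> R" "l \<in> LJ" "y m = 0"
          by (auto simp: gen_def)
        have "n m = 0" using * N' by auto
        \<comment> \<open>The injectivity property of u gives r = d s. Then y is n plus d times
          \<open>vscale s x + l\<close>; the latter vector is in L', and d L' lies in N'.\<close>
        hence eq: "r * u + d * l m = 0" using * x by simp
        hence "r * u = d * (- l m)" by (simp add: add_eq_0_iff)
        moreover have "- l m \<in> J" using * add_subgroupD(3)[OF JD(2)] by (simp add: LJ_def)
        ultimately obtain s where s: "s \<in> R" "r = d * s" using u(3) *(3) by blast
        have "d * (s * u + l m) = 0" using eq s by (simp add: algebra_simps)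
        hence "s * u + l m = 0" using d by simp
        moreover have "vscale s x + l \<in> L" using * s x by (auto simp: LJ_def intro!: LG(4) LD(2))
        ultimately have "vscale s x + l \<in> L'" using x by (simp add: L'_def)
        from dL'[OF this] have "n + vscale d (vscale s x + l) \<in> N'" using *(2) by (intro N'G(4))
        moreover have "y = n + vscale d (vscale s x + l)" by (simp add: * s vscale_simps add.assoc)
        ultimately show "y \<in> N'" by simp
      qed
    qed
    ultimately show "gen x \<in> F" by (simp add: F_def)
  qed
  have "bij_betw Phi F (cosets L' N')"
  proof (rule bij_betw_imageI)
    show "inj_on Phi F"
    proof (rule inj_onI)
      fix N1 N2 assume N: "N1 \<in> F" "N2 \<in> F" "Phi N1 = Phi N2"
      obtain x where x: "x \<in> N1" "x m = u" using ex_gen[OF N(1)] by blast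
      have "x - x0 \<in> Phi N1" using Phi_eq[OF N(1) x] add_coset_mem[OF N'D(1)] by simp
      hence "x - x0 \<in> Phi N2" using N(3) by simp
      hence "x0 + (x - x0) \<in> N2" unfolding Phi_def by blast
      hence "x \<in> N2" by simp
      thus "N1 = N2" using gen_eq[OF N(1) x] gen_eq[of N2 x] N(2) x(2) by simp
    qed
    show "Phi ` F = cosets L' N'"
    proof
      show "Phi ` F \<subseteq> cosets L' N'"
      proof
        fix C assume "C \<in> Phi ` F"
        then obtain N where N: "N \<in> F" "C = Phi N" by blast
        obtain x where x: "x \<in> N" "x m = u" using ex_gen[OF N(1)] by blast
        have "x - x0 \<in> L'" using x x0 F(2)[OF N(1)] LG by (auto simp: L'_def)
        thus "C \<in> cosets L' N'" using Phi_eq[OF N(1) x] N by (auto simp: cosets_def)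
      qed
      show "cosets L' N' \<subseteq> Phi ` F"
      proof
        fix C assume "C \<in> cosets L' N'"
        then obtain y where y: "y \<in> L'" "C = add_coset N' y" by (auto simp: cosets_def)
        have x: "x0 + y \<in> L" "(x0 + y) m = u" using y x0 LG by (auto simp: L'_def)
        have "Phi (gen (x0 + y)) = C"
          using Phi_eq[of "gen (x0 + y)" "x0 + y"] gen_F[of "x0 + y"] x y(2) by simp
        thus "C \<in> Phi ` F" using gen_F(1)[of "x0 + y"] x by blast
      qed
    qed
  qed
  moreover have "finite (cosets L' N')"
    using pos by (simp add: L'_def idx_def card_gt_0_iff)
  ultimately show "finite F" "card F = idx {x\<in>L. x m = 0} N'"
    by (auto simp: bij_betw_finite bij_betw_same_card idx_def L'_def)
qed

text \<open>Submodules N are sorted by their last coordinates J and their kernel N'. By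
  \<open>idx_hom\<close> the index of N is the product of the indices of J in I and of N' in L', and
  each pair (J, N') comes from [L' : N'] submodules. This multiplicity is the factor
  \<open>k div d\<close>, which becomes a shift by 1 of the Dirichlet series.\<close>

lemma submods_of_index_Suc:
  assumes L: "submod L" "L \<subseteq> vecs (Suc m)" and pos: "idx (vecs (Suc m)) L > 0" and k: "k > 0"
  defines "L' \<equiv> {x\<in>L. x m = 0}"
  assumes fin: "\<And>k. k > 0 \<Longrightarrow> finite (submods_of_index L' k)"
  shows "finite (submods_of_index L k)"
    and "card (submods_of_index L k) =
      (\<Sum>d | d dvd k. ideal_count d * ((k div d) * card (submods_of_index L' (k div d))))"
proof -
  define I where "I = (\<lambda>x. x m) ` L"
  have I: "rideal I" unfolding I_def by (rule rideal_coordinate[OF L])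
  have pr: "(\<lambda>x. x m) ` vecs (Suc m) = R"
  proof
    show "R \<subseteq> (\<lambda>x. x m) ` vecs (Suc m)"
    proof
      fix r assume "r \<in> R"
      hence "(\<lambda>i. if i = m then r else 0) \<in> vecs (Suc m)" by (auto simp: vecs_def R_closed)
      thus "r \<in> (\<lambda>x. x m) ` vecs (Suc m)" by (rule rev_image_eqI) simp
    qed
  qed (auto simp: vecs_def)
  have "idx (vecs (Suc m)) L = idx ((\<lambda>x. x m) ` vecs (Suc m)) I * idx {x \<in> vecs (Suc m). x m = 0} L'"
    unfolding L'_def I_def
    using L by (intro idx_hom submodD(1) submod_vecs) auto
  hence "idx (vecs (Suc m)) L = idx R I * idx {x \<in> vecs (Suc m). x m = 0} L'" unfolding pr .
  hence "idx R I > 0" using pos by simp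
  \<comment> \<open>L has finite index, so its ideal of last coordinates contains a nonzero
    integer.\<close>
  hence j: "of_nat (idx R I) \<in> I" "of_nat (idx R I) \<noteq> (0 :: 'k)" using idx_pos_nonzero[OF I] by auto
  define A where "A d = {J. rideal J \<and> J \<subseteq> I \<and> idx I J = d}" for d
  have A: "finite (A d)" "card (A d) = ideal_count d" if "d > 0" for d
    unfolding A_def using subideals_of_index[OF I j that] by auto
  define P where "P = (SIGMA d:{d. d dvd k}. A d \<times> submods_of_index L' (k div d))"
  have dk: "d > 0" "k div d > 0" if "d dvd k" for d using that k by (auto intro: Nat.gr0I simp: dvd_div_eq_0_iff)
  have finP: "finite P"
    unfolding P_def using k dk A fin by (intro finite_SigmaI finite_cartesian_product) auto
  define Fib where "Fib = (\<lambda>(d :: nat, J, N'). {N. submod N \<and> N \<subseteq> L \<and> (\<lambda>x. x m) ` N = J \<and> {x\<in>N. x m = 0} = N'})"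
  have Fib: "finite (Fib p)" "card (Fib p) = k div fst p" if pP: "p \<in> P" for p
  proof -
    obtain d J N' where p: "p = (d, J, N')" "d dvd k" "J \<in> A d" "N' \<in> submods_of_index L' (k div d)"
      using pP by (auto simp: P_def)
    have J: "rideal J" "J \<subseteq> (\<lambda>x. x m) ` L" using p by (auto simp: A_def I_def)
    have "idx R J = idx R I * idx I J"
      using J p I by (intro idx_mult) (auto simp: ridealD add_subgroup_R A_def)
    moreover have "idx I J = d" using p by (simp add: A_def)
    ultimately have posJ: "idx R J > 0" using \<open>idx R I > 0\<close> dk[OF p(2)] by simp
    have N': "submod N'" "N' \<subseteq> {x\<in>L. x m = 0}" "idx {x\<in>L. x m = 0} N' = k div d"
      using p by (auto simp: submods_of_index_def L'_def)
    have "of_nat (idx R J) \<in> J" "of_nat (idx R J) \<noteq> (0 :: 'k)"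
      using idx_pos_nonzero[OF J(1) posJ] posJ by auto
    note W = submods_with_projection[of L m J "of_nat (idx R J)" N', OF L J this N'(1,2)]
    have "idx {x\<in>L. x m = 0} N' > 0" using N'(3) dk[OF p(2)] by simp
    from W[OF this] show "finite (Fib p)" "card (Fib p) = k div fst p"
      by (simp_all add: Fib_def p N'(3))
  qed
  have "submods_of_index L k = (\<Union>p\<in>P. Fib p)"
  proof
    show "submods_of_index L k \<subseteq> (\<Union>p\<in>P. Fib p)"
    proof
      fix N assume "N \<in> submods_of_index L k"
      hence N: "submod N" "N \<subseteq> L" "idx L N = k" by (auto simp: submods_of_index_def)
      define J where "J = (\<lambda>x. x m) ` N"
      define N' where "N' = {x\<in>N. x m = 0}"
      have eq: "k = idx I J * idx L' N'"
        unfolding L'_def I_def J_def N'_def N(3)[symmetric]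
        using N L by (intro idx_hom submodD(1)) auto
      have "J \<in> A (idx I J)" using rideal_coordinate[OF N(1)] N L by (auto simp: A_def J_def I_def)
      moreover have "N' \<in> submods_of_index L' (k div idx I J)"
        using submod_kernel[OF N(1)] N eq k by (auto simp: submods_of_index_def N'_def L'_def)
      ultimately have "(idx I J, J, N') \<in> P" using eq by (simp add: P_def)
      moreover have "N \<in> Fib (idx I J, J, N')" using N by (simp add: Fib_def J_def N'_def)
      ultimately show "N \<in> (\<Union>p\<in>P. Fib p)" by blast
    qed
    show "(\<Union>p\<in>P. Fib p) \<subseteq> submods_of_index L k"
    proof
      fix N assume "N \<in> (\<Union>p\<in>P. Fib p)"
      then obtain d J N' where p: "d dvd k" "J \<in> A d" "N' \<in> submods_of_index L' (k div d)"
        "N \<in> Fib (d, J, N')" by (auto simp: P_def)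
      have N: "submod N" "N \<subseteq> L" "(\<lambda>x. x m) ` N = J" "{x\<in>N. x m = 0} = N'" using p by (auto simp: Fib_def)
      have "idx L N = idx I J * idx L' N'"
        unfolding L'_def I_def N(3,4)[symmetric]
        using N L by (intro idx_hom submodD(1)) auto
      also have "\<dots> = k" using p by (simp add: A_def submods_of_index_def)
      finally show "N \<in> submods_of_index L k" using N by (simp add: submods_of_index_def)
    qed
  qed
  moreover have "finite (\<Union>p\<in>P. Fib p)" using finP Fib by blast
  moreover have "card (\<Union>p\<in>P. Fib p) = (\<Sum>p\<in>P. card (Fib p))"
  proof (rule card_UN_disjoint[OF finP])
    show "\<forall>p\<in>P. \<forall>q\<in>P. p \<noteq> q \<longrightarrow> Fib p \<inter> Fib q = {}"
      by (auto simp: P_def Fib_def A_def)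
  qed (use Fib in blast)
  moreover have "(\<Sum>p\<in>P. card (Fib p)) = (\<Sum>p\<in>P. k div fst p)"
    using Fib by (intro sum.cong) auto
  moreover have "(\<Sum>p\<in>P. k div fst p) = (\<Sum>d | d dvd k. \<Sum>q\<in>A d \<times> submods_of_index L' (k div d). k div d)"
    unfolding P_def using k dk A fin by (subst sum.Sigma) (auto simp: case_prod_beta)
  moreover have "\<dots> = (\<Sum>d | d dvd k. ideal_count d * ((k div d) * card (submods_of_index L' (k div d))))"
    using dk A by (intro sum.cong) (auto simp: card_cartesian_product)
  ultimately show "finite (submods_of_index L k)"
    and "card (submods_of_index L k) =
      (\<Sum>d | d dvd k. ideal_count d * ((k div d) * card (submods_of_index L' (k div d))))" by simp_all
qed

text \<open>Stated for every \<open>L\<close> of finite index because it is applied to radicals as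
  well as to R^m. The kernel of the last coordinate on L has finite index in \<open>vecs m\<close>,
  so the induction stays in this class.\<close>

lemma submods_of_index_count:
  assumes "submod L" "L \<subseteq> vecs m" "idx (vecs m) L > 0" "k > 0"
  shows "finite (submods_of_index L k) \<and> of_nat (card (submods_of_index L k)) =
    fds_nth (\<Prod>i<m. fds_shift i (fds (\<lambda>n. of_nat (ideal_count n)))) k"
  using assms
proof (induction m arbitrary: L k)
  case 0
  have "vecs 0 = {0}" by (auto simp: vecs_def fun_eq_iff)
  hence L: "L = {0}" using 0 add_subgroupD(1)[OF submodD(1)[OF 0(1)]] by auto
  have "idx {0} {0 :: nat \<Rightarrow> 'k} = 1" by (rule idx_self) (simp add: add_subgroup_def)
  moreover have "N = {0}" if "submod N" "N \<subseteq> {0}" for N :: "(nat \<Rightarrow> 'k) set"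
    using add_subgroupD(1)[OF submodD(1)[OF that(1)]] that(2) by auto
  ultimately have "submods_of_index L k = (if k = 1 then {L} else {})"
    using 0(1) L by (auto simp: submods_of_index_def)
  thus ?case using 0 by (simp add: one_fds_def fds_nth_fds)
next
  case (Suc m)
  define L' where "L' = {x\<in>L. x m = 0}"
  let ?Z = "fds (\<lambda>n. of_nat (ideal_count n))"
  have ker: "{x \<in> vecs (Suc m). x m = 0} = vecs m"
  proof -
    have "(\<forall>i\<ge>m. x i = 0) \<longleftrightarrow> x m = 0 \<and> (\<forall>i\<ge>Suc m. x i = 0)" for x :: "nat \<Rightarrow> 'k"
      by (metis Suc_leI le_neq_implies_less order_refl Suc_leD)
    thus ?thesis using R_closed(4) by (auto simp: vecs_def less_Suc_eq)
  qed
  have L': "submod L'" "L' \<subseteq> vecs m"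
    using submod_kernel[OF Suc.prems(1)] Suc.prems(2) ker by (auto simp: L'_def)
  have "idx (vecs (Suc m)) L = idx ((\<lambda>x. x m) ` vecs (Suc m)) ((\<lambda>x. x m) ` L) * idx (vecs m) L'"
    unfolding L'_def ker[symmetric]
    using Suc.prems by (intro idx_hom submodD(1) submod_vecs) auto
  hence "idx (vecs m) L' > 0" using Suc.prems by simp
  note IH = Suc.IH[OF L' this]
  note S = submods_of_index_Suc[OF Suc.prems, folded L'_def]
  have dk: "k div d > 0" if "d dvd k" for d
    using that Suc.prems(4) by (auto intro: Nat.gr0I simp: dvd_div_eq_0_iff)
  have "of_nat (card (submods_of_index L k)) =
      (\<Sum>d | d dvd k. of_nat (ideal_count d) *
        (of_nat (k div d) * (of_nat (card (submods_of_index L' (k div d))) :: complex)))"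
    using S(2) IH by simp
  also have "\<dots> = fds_nth (?Z * fds_shift 1 (\<Prod>i<m. fds_shift i ?Z)) k"
    unfolding times_fds_def using Suc.prems(4) IH dk
    by (auto simp: fds_nth_fds fds_shift_def dvd_pos_nat intro!: sum.cong)
  \<comment> \<open>The new coordinate contributes the factor i = 0, and the weight
    \<open>k div d\<close> moves each old factor from i to i + 1.\<close>
  also have "?Z * fds_shift 1 (\<Prod>i<m. fds_shift i ?Z) = (\<Prod>i<Suc m. fds_shift i ?Z)"
    by (subst prod.lessThan_Suc_shift) (simp add: fds_shift_prod fds_shift_shift)
  finally show ?case using S(1) IH by simp
qed

end

section \<open>Characters of finite quotients\<close>

text \<open>Homomorphisms to the multiplicative group of the complex numbers, not only to the unit
  circle. Fixing the values outside L makes cardinalities meaningful.\<close>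

definition add_chars :: "'a :: ab_group_add set \<Rightarrow> ('a \<Rightarrow> complex) set" where
  "add_chars L = {\<chi> \<in> extensional L. (\<forall>x\<in>L. \<chi> x \<noteq> 0) \<and> (\<forall>x\<in>L. \<forall>y\<in>L. \<chi> (x + y) = \<chi> x * \<chi> y)}"

lemma add_charsD:
  assumes "\<chi> \<in> add_chars L"
  shows "\<chi> \<in> extensional L" "x \<in> L \<Longrightarrow> \<chi> x \<noteq> 0" "x \<in> L \<Longrightarrow> y \<in> L \<Longrightarrow> \<chi> (x + y) = \<chi> x * \<chi> y"
  using assms by (auto simp: add_chars_def)

lemma add_chars_0:
  assumes "add_subgroup L" "\<chi> \<in> add_chars L"
  shows "\<chi> 0 = 1"
  using add_charsD(2,3)[OF assms(2), of 0] add_charsD(3)[OF assms(2), of 0 0] add_subgroupD(1)[OF assms(1)] by simp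

lemma add_chars_diff:
  assumes L: "add_subgroup L" and \<chi>: "\<chi> \<in> add_chars L" and xy: "x \<in> L" "y \<in> L"
  shows "\<chi> (x - y) = \<chi> x / \<chi> y"
  using add_charsD(3)[OF \<chi> add_subgroupD(2)[OF L xy] xy(2)] add_charsD(2)[OF \<chi> xy(2)] by (simp add: field_simps)

lemma add_subgroup_of_nat_mult:
  fixes x :: "'a :: comm_ring_1"
  shows "add_subgroup L \<Longrightarrow> x \<in> L \<Longrightarrow> of_nat n * x \<in> L"
  by (induction n) (auto simp: add_subgroupD algebra_simps)

lemma add_chars_of_nat_mult:
  fixes x :: "'a :: comm_ring_1"
  assumes L: "add_subgroup L" and \<chi>: "\<chi> \<in> add_chars L" and x: "x \<in> L"
  shows "\<chi> (of_nat n * x) = \<chi> x ^ n"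
proof (induction n)
  case 0
  thus ?case using add_chars_0[OF L \<chi>] by simp
next
  case (Suc n)
  have "of_nat (Suc n) * x = x + of_nat n * x" by (simp add: algebra_simps)
  thus ?case using add_charsD(3)[OF \<chi> x add_subgroup_of_nat_mult[OF L x, of n]] Suc by simp
qed

definition char_extensions :: "'a :: ab_group_add set \<Rightarrow> 'a set \<Rightarrow> ('a \<Rightarrow> complex) \<Rightarrow> ('a \<Rightarrow> complex) set" where
  "char_extensions L N \<chi>0 = {\<chi> \<in> add_chars L. \<forall>x\<in>N. \<chi> x = \<chi>0 x}"

text \<open>Here n is the order of x modulo N. An extension to the group generated by N and x is
  determined by its value w at x, and the condition on w is
  \<open>w ^ n = \<chi>0 (of_nat n * x)\<close>, which has n solutions. Natural multiples of x
  suffice in \<open>N1\<close>, as -x is (n - 1) x modulo N.\<close>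

lemma char_extensions_adjoin:
  fixes x :: "'a :: comm_ring_1"
  assumes N: "add_subgroup N" and \<chi>0: "\<chi>0 \<in> add_chars N"
    and n: "n > 0" "of_nat n * x \<in> N" and least: "\<And>i. of_nat i * x \<in> N \<Longrightarrow> n dvd i"
  defines "N1 \<equiv> {y + of_nat i * x | y i. y \<in> N}"
  shows "add_subgroup N1" "idx N1 N = n" "card (char_extensions N1 N \<chi>0) = n"
proof -
  note ND = add_subgroupD[OF N]
  have N1I: "y + of_nat i * x \<in> N1" if "y \<in> N" for y i using that by (auto simp: N1_def)
  show N1: "add_subgroup N1"
    unfolding add_subgroup_def
  proof (intro conjI ballI)
    show "0 \<in> N1" using N1I[OF ND(1), of 0] by simp
    fix a b assume ab: "a \<in> N1" "b \<in> N1"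
    then obtain y i y' i' where *: "a = y + of_nat i * x" "b = y' + of_nat i' * x" "y \<in> N" "y' \<in> N"
      by (auto simp: N1_def)
    have "of_nat n = (1 + of_nat (n - 1) :: 'a)" using n(1) by (metis Suc_diff_1 of_nat_Suc)
    hence "of_nat (i + i' * (n - 1)) = (of_nat i + of_nat i' * (of_nat n - 1) :: 'a)" by simp
    hence "a - b = (y - y' - of_nat i' * (of_nat n * x)) + of_nat (i + i' * (n - 1)) * x"
      by (simp only: *) (simp add: algebra_simps)
    moreover have "y - y' - of_nat i' * (of_nat n * x) \<in> N"
      by (rule ND(2)[OF ND(2)[OF *(3,4)] add_subgroup_of_nat_mult[OF N n(2)]])
    ultimately show "a - b \<in> N1" using N1I by metis
  qed
  note N1D = add_subgroupD[OF N1]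
  have NN1: "N \<subseteq> N1" using N1I[of _ 0] by auto
  have xN1: "x \<in> N1" using N1I[OF ND(1), of 1] by simp
  have red: "\<exists>z\<in>N. of_nat i * x = z + of_nat (i mod n) * x" for i
  proof -
    have "of_nat i = (of_nat (i div n) * of_nat n + of_nat (i mod n) :: 'a)"
      by (metis div_mult_mod_eq of_nat_add of_nat_mult)
    hence "of_nat i * x = of_nat (i div n) * (of_nat n * x) + of_nat (i mod n) * x"
      by (simp add: algebra_simps)
    thus ?thesis using add_subgroup_of_nat_mult[OF N n(2)] by blast
  qed
  have "cosets N1 N = (\<lambda>i. add_coset N (of_nat i * x)) ` {..<n}"
  proof
    show "cosets N1 N \<subseteq> (\<lambda>i. add_coset N (of_nat i * x)) ` {..<n}"
    proof
      fix C assume "C \<in> cosets N1 N"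
      then obtain y i where yi: "y \<in> N" "C = add_coset N (y + of_nat i * x)" by (auto simp: cosets_def N1_def)
      obtain z where z: "z \<in> N" "of_nat i * x = z + of_nat (i mod n) * x" using red by blast
      have "C = add_coset N (of_nat (i mod n) * x)"
        unfolding yi(2) coset_eq_iff[OF N] using ND(4)[OF yi(1) z(1)] z(2)
          by (metis add.assoc add_diff_cancel_right')
      thus "C \<in> (\<lambda>i. add_coset N (of_nat i * x)) ` {..<n}" using n(1) by auto
    qed
    show "(\<lambda>i. add_coset N (of_nat i * x)) ` {..<n} \<subseteq> cosets N1 N"
      using N1I[OF ND(1)] by (auto simp: cosets_def)
  qed
  moreover have "inj_on (\<lambda>i. add_coset N (of_nat i * x)) {..<n}"
  proof -
    have "i = j" if "i < n" "j < n" "add_coset N (of_nat i * x) = add_coset N (of_nat j * x)" "i \<le> j" for i j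
    proof -
      have "of_nat j * x - of_nat i * x \<in> N" using that(3) coset_eq_iff[OF N] by metis
      hence "of_nat (j - i) * x \<in> N" using that(4) by (simp add: of_nat_diff algebra_simps)
      hence "n dvd j - i" by (rule least)
      thus "i = j" using that
        by (metis diff_is_0_eq dvd_imp_le le_antisym less_imp_diff_less linorder_not_less not_gr_zero)
    qed
    thus ?thesis unfolding inj_on_def by (metis lessThan_iff nat_le_linear)
  qed
  ultimately show "idx N1 N = n" by (simp add: idx_def card_image)
  have val: "\<chi> (y + of_nat i * x) = \<chi>0 y * \<chi> x ^ i" if "\<chi> \<in> char_extensions N1 N \<chi>0" "y \<in> N" for \<chi> y i
  proof -
    have \<chi>: "\<chi> \<in> add_chars N1" "\<chi> y = \<chi>0 y" using that by (auto simp: char_extensions_def)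
    have "y \<in> N1" using that NN1 by blast
    thus ?thesis using add_charsD(3)[OF \<chi>(1) _ add_subgroup_of_nat_mult[OF N1 xN1]]
        add_chars_of_nat_mult[OF N1 \<chi>(1) xN1] \<chi>(2) by simp
  qed
  have "bij_betw (\<lambda>\<chi>. \<chi> x) (char_extensions N1 N \<chi>0) {w. w ^ n = \<chi>0 (of_nat n * x)}"
  proof (rule bij_betw_imageI)
    show "inj_on (\<lambda>\<chi>. \<chi> x) (char_extensions N1 N \<chi>0)"
    proof (rule inj_onI)
      fix \<chi> \<chi>' assume \<chi>: "\<chi> \<in> char_extensions N1 N \<chi>0" "\<chi>' \<in> char_extensions N1 N \<chi>0" "\<chi> x = \<chi>' x"
      have ext: "\<chi> \<in> extensional N1" "\<chi>' \<in> extensional N1"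
        using \<chi> by (auto simp: char_extensions_def add_chars_def)
      show "\<chi> = \<chi>'"
      proof (rule extensionalityI[OF ext])
        fix z assume "z \<in> N1"
        then obtain y i where "y \<in> N" "z = y + of_nat i * x" by (auto simp: N1_def)
        thus "\<chi> z = \<chi>' z" using val[OF \<chi>(1)] val[OF \<chi>(2)] \<chi>(3) by simp
      qed
    qed
    show "(\<lambda>\<chi>. \<chi> x) ` char_extensions N1 N \<chi>0 = {w. w ^ n = \<chi>0 (of_nat n * x)}"
    proof
      show "(\<lambda>\<chi>. \<chi> x) ` char_extensions N1 N \<chi>0 \<subseteq> {w. w ^ n = \<chi>0 (of_nat n * x)}"
        using add_chars_of_nat_mult[OF N1 _ xN1, of _ n] n(2) by (auto simp: char_extensions_def)
      show "{w. w ^ n = \<chi>0 (of_nat n * x)} \<subseteq> (\<lambda>\<chi>. \<chi> x) ` char_extensions N1 N \<chi>0"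
      proof
        fix w assume "w \<in> {w. w ^ n = \<chi>0 (of_nat n * x)}"
        hence w: "w ^ n = \<chi>0 (of_nat n * x)" by simp
        have w0: "w \<noteq> 0" using add_charsD(2)[OF \<chi>0 n(2)] w n(1) by (metis power_0_left zero_less_iff_neq_zero)
        \<comment> \<open>Two presentations of the same element differ by a multiple of n x, where
          the n-th power of w agrees with \<open>\<chi>0\<close>; so the character defined below has
          well-defined values.\<close>
        have wd': "\<chi>0 y * w ^ i = \<chi>0 y' * w ^ i'"
          if y: "y \<in> N" "y' \<in> N" and eq: "y + of_nat i * x = y' + of_nat i' * x" and le: "i \<le> i'" for y y' i i'
        proof -
          have d: "of_nat (i' - i) * x = y - y'" using eq le by (simp add: of_nat_diff algebra_simps)
          hence "of_nat (i' - i) * x \<in> N" using ND(2) y by simp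
          hence "n dvd i' - i" by (rule least)
          then obtain q where q: "i' - i = n * q" by blast
          have "w ^ i' = w ^ i * w ^ (i' - i)" using le by (simp flip: power_add)
          also have "w ^ (i' - i) = \<chi>0 (of_nat n * x) ^ q" by (simp add: q power_mult w)
          also have "\<dots> = \<chi>0 (of_nat q * (of_nat n * x))"
            by (rule add_chars_of_nat_mult[OF N \<chi>0 n(2), symmetric])
          also have "of_nat q * (of_nat n * x) = y - y'" using d by (simp add: q algebra_simps)
          also have "\<chi>0 (y - y') = \<chi>0 y / \<chi>0 y'" by (rule add_chars_diff[OF N \<chi>0 y])
          finally show ?thesis using add_charsD(2)[OF \<chi>0 y(2)] by simp
        qed
        have wd: "\<chi>0 y * w ^ i = \<chi>0 y' * w ^ i'"
          if "y \<in> N" "y' \<in> N" "y + of_nat i * x = y' + of_nat i' * x" for y y' i i'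
          using wd'[OF that] wd'[OF that(2,1) that(3)[symmetric]] by (cases "i \<le> i'") auto
        define \<chi> where "\<chi> = (\<lambda>z\<in>N1. SOME v. \<exists>y\<in>N. \<exists>i. z = y + of_nat i * x \<and> v = \<chi>0 y * w ^ i)"
        have \<chi>: "\<chi> (y + of_nat i * x) = \<chi>0 y * w ^ i" if y: "y \<in> N" for y i
        proof -
          have "(SOME v. \<exists>y'\<in>N. \<exists>i'. y + of_nat i * x = y' + of_nat i' * x \<and> v = \<chi>0 y' * w ^ i') = \<chi>0 y * w ^ i"
          proof (rule some_equality)
            show "\<exists>y'\<in>N. \<exists>i'. y + of_nat i * x = y' + of_nat i' * x \<and> \<chi>0 y * w ^ i = \<chi>0 y' * w ^ i'"
              using y by blast
          qed (use wd y in metis)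
          thus ?thesis using N1I[OF y] by (simp add: \<chi>_def)
        qed
        have "\<chi> \<in> add_chars N1"
          unfolding add_chars_def
        proof (intro CollectI conjI ballI)
          show "\<chi> \<in> extensional N1" by (simp add: \<chi>_def)
          show "\<chi> z \<noteq> 0" if z: "z \<in> N1" for z
          proof -
            obtain y i where "y \<in> N" "z = y + of_nat i * x" using z by (auto simp: N1_def)
            thus ?thesis using \<chi> add_charsD(2)[OF \<chi>0] w0 by simp
          qed
          show "\<chi> (a + b) = \<chi> a * \<chi> b" if ab: "a \<in> N1" "b \<in> N1" for a b
          proof -
            obtain y i y' i' where *: "a = y + of_nat i * x" "b = y' + of_nat i' * x" "y \<in> N" "y' \<in> N"
              using ab by (auto simp: N1_def)
            have "a + b = (y + y') + of_nat (i + i') * x" by (simp add: * algebra_simps)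
            hence "\<chi> (a + b) = \<chi>0 y * \<chi>0 y' * w ^ (i + i')"
              using \<chi>[OF ND(4)[OF *(3,4)], of "i + i'"] add_charsD(3)[OF \<chi>0 *(3,4)] by metis
            thus ?thesis using *(3,4) by (simp add: *(1,2) \<chi> power_add)
          qed
        qed
        moreover have "\<chi> y = \<chi>0 y" if "y \<in> N" for y using \<chi>[OF that, of 0] by simp
        moreover have "\<chi> x = w" using \<chi>[OF ND(1), of 1] add_chars_0[OF N \<chi>0] by simp
        ultimately show "w \<in> (\<lambda>\<chi>. \<chi> x) ` char_extensions N1 N \<chi>0"
          by (auto simp: char_extensions_def)
      qed
    qed
  qed
  hence "card (char_extensions N1 N \<chi>0) = card {w. w ^ n = \<chi>0 (of_nat n * x)}"
    by (rule bij_betw_same_card)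
  also have "\<dots> = n" by (rule card_nth_roots) (use n add_charsD(2)[OF \<chi>0 n(2)] in auto)
  finally show "card (char_extensions N1 N \<chi>0) = n" .
qed

text \<open>Induction on the index. When some x outside N is adjoined to give \<open>N1\<close>, the
  extensions to L are partitioned by their restrictions to \<open>N1\<close>, and these are counted
  by \<open>char_extensions_adjoin\<close>.\<close>

lemma card_char_extensions:
  fixes L :: "'a :: comm_ring_1 set"
  assumes L: "add_subgroup L" and N: "add_subgroup N" "N \<subseteq> L" and pos: "idx L N > 0"
    and \<chi>0: "\<chi>0 \<in> add_chars N"
  shows "card (char_extensions L N \<chi>0) = idx L N"
  using N pos \<chi>0
proof (induction "idx L N" arbitrary: N \<chi>0 rule: less_induct)
  case (less N)
  show ?case
  proof (cases "N = L")
    case True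
    have "\<chi> = \<chi>0" if "\<chi> \<in> char_extensions L N \<chi>0" for \<chi>
      using that less.prems True by (intro extensionalityI[of _ L]) (auto simp: char_extensions_def add_chars_def)
    hence "char_extensions L N \<chi>0 = {\<chi>0}" using less.prems True by (auto simp: char_extensions_def)
    thus ?thesis using True idx_self[OF L] by simp
  next
    case False
    then obtain x where x: "x \<in> L" "x \<notin> N" using less.prems by blast
    note ND = add_subgroupD[OF less.prems(1)]
    define n where "n = (LEAST n. n > 0 \<and> of_nat n * x \<in> N)"
    \<comment> \<open>The index annihilates L / N, so x has finite order modulo N.\<close>
    have "idx L N > 0 \<and> of_nat (idx L N) * x \<in> N"
      using of_nat_idx_mult_mem[OF less.prems(1) L x(1)] less.prems by simp
    hence n: "n > 0 \<and> of_nat n * x \<in> N" unfolding n_def by (rule LeastI)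
    have least: "n dvd i" if i: "of_nat i * x \<in> N" for i
    proof (rule ccontr)
      assume "\<not> n dvd i"
      hence "i mod n > 0" by (simp add: mod_greater_zero_iff_not_dvd)
      have "of_nat i = (of_nat (i div n) * of_nat n + of_nat (i mod n) :: 'a)"
        by (metis div_mult_mod_eq of_nat_add of_nat_mult)
      hence "of_nat (i mod n) * x = of_nat i * x - of_nat (i div n) * (of_nat n * x)"
        by (simp add: algebra_simps)
      hence "of_nat (i mod n) * x \<in> N"
        using ND(2)[OF i add_subgroup_of_nat_mult[OF less.prems(1)]] n by metis
      hence "n \<le> i mod n" unfolding n_def using \<open>i mod n > 0\<close> by (intro Least_le) (simp add: n_def)
      thus False using n by (metis mod_less_divisor linorder_not_less)
    qed
    define N1 where "N1 = {y + of_nat i * x | y i. y \<in> N}"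
    note adj = char_extensions_adjoin[OF less.prems(1,4) conjunct1[OF n] conjunct2[OF n] least, folded N1_def]
    have N1L: "N1 \<subseteq> L" using less.prems x add_subgroup_of_nat_mult[OF L] add_subgroupD[OF L]
      by (auto simp: N1_def)
    have NN1: "N \<subseteq> N1" unfolding N1_def by (force intro: exI[of _ "0 :: nat"])
    have mult: "idx L N = idx L N1 * n"
      using idx_mult[OF less.prems(1) adj(1) L NN1 N1L] adj(2) by simp
    have "n \<noteq> 1" using n x by auto
    hence lt: "idx L N1 < idx L N" and pos1: "idx L N1 > 0" using mult less.prems(3) n by auto
    have IH: "card (char_extensions L N1 \<chi>) = idx L N1" if "\<chi> \<in> char_extensions N1 N \<chi>0" for \<chi>
      using less.hyps[OF lt adj(1) N1L pos1] that by (auto simp: char_extensions_def)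
    have fin: "finite (char_extensions N1 N \<chi>0)" using adj(3) n by (metis card.infinite less_not_refl)
    have un: "char_extensions L N \<chi>0 = (\<Union>\<chi>\<in>char_extensions N1 N \<chi>0. char_extensions L N1 \<chi>)"
    proof
      show "char_extensions L N \<chi>0 \<subseteq> (\<Union>\<chi>\<in>char_extensions N1 N \<chi>0. char_extensions L N1 \<chi>)"
      proof
        fix \<chi> assume \<chi>: "\<chi> \<in> char_extensions L N \<chi>0"
        have "restrict \<chi> N1 \<in> char_extensions N1 N \<chi>0"
          using \<chi> N1L NN1 add_subgroupD(4)[OF adj(1)] by (auto simp: char_extensions_def add_chars_def subset_iff)
        moreover have "\<chi> \<in> char_extensions L N1 (restrict \<chi> N1)"
          using \<chi> by (auto simp: char_extensions_def)
        ultimately show "\<chi> \<in> (\<Union>\<chi>\<in>char_extensions N1 N \<chi>0. char_extensions L N1 \<chi>)" by blast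
      qed
      show "(\<Union>\<chi>\<in>char_extensions N1 N \<chi>0. char_extensions L N1 \<chi>) \<subseteq> char_extensions L N \<chi>0"
        using NN1 by (auto simp: char_extensions_def subset_iff)
    qed
    have "card (\<Union>\<chi>\<in>char_extensions N1 N \<chi>0. char_extensions L N1 \<chi>) =
        (\<Sum>\<chi>\<in>char_extensions N1 N \<chi>0. card (char_extensions L N1 \<chi>))"
    proof (rule card_UN_disjoint[OF fin])
      show "\<forall>\<chi>\<in>char_extensions N1 N \<chi>0. finite (char_extensions L N1 \<chi>)"
        using IH pos1 by (metis card.infinite less_not_refl)
      show "\<forall>\<chi>\<in>char_extensions N1 N \<chi>0. \<forall>\<chi>'\<in>char_extensions N1 N \<chi>0. \<chi> \<noteq> \<chi>' \<longrightarrow>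
          char_extensions L N1 \<chi> \<inter> char_extensions L N1 \<chi>' = {}"
      proof (intro ballI impI, rule ccontr)
        fix \<chi> \<chi>' assume *: "\<chi> \<in> char_extensions N1 N \<chi>0" "\<chi>' \<in> char_extensions N1 N \<chi>0" "\<chi> \<noteq> \<chi>'"
          "char_extensions L N1 \<chi> \<inter> char_extensions L N1 \<chi>' \<noteq> {}"
        from *(4) obtain \<psi> where \<psi>: "\<psi> \<in> char_extensions L N1 \<chi>" "\<psi> \<in> char_extensions L N1 \<chi>'" by blast
        have "\<chi> \<in> extensional N1" "\<chi>' \<in> extensional N1" using * by (auto simp: char_extensions_def add_chars_def)
        hence "\<chi> = \<chi>'" by (rule extensionalityI) (use \<psi> in \<open>auto simp: char_extensions_def\<close>)
        thus False using * by blast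
      qed
    qed
    also have "\<dots> = idx L N" using IH adj(3) mult by simp
    finally show ?thesis unfolding un .
  qed
qed

section \<open>Common eigenvectors\<close>

locale complex_vector_space = vector_space scale
  for scale :: "complex \<Rightarrow> 'b :: ab_group_add \<Rightarrow> 'b" (infixr "*s" 75)
begin

definition linear_on_subspace :: "'b set \<Rightarrow> ('b \<Rightarrow> 'b) \<Rightarrow> bool" where
  "linear_on_subspace W f \<longleftrightarrow> (\<forall>x\<in>W. f x \<in> W) \<and> (\<forall>x\<in>W. \<forall>y\<in>W. f (x + y) = f x + f y) \<and>
     (\<forall>c. \<forall>x\<in>W. f (c *s x) = c *s f x)"

lemma linear_on_subspaceD:
  assumes "linear_on_subspace W f"
  shows "x \<in> W \<Longrightarrow> f x \<in> W" "x \<in> W \<Longrightarrow> y \<in> W \<Longrightarrow> f (x + y) = f x + f y"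
    "x \<in> W \<Longrightarrow> f (c *s x) = c *s f x"
  using assms by (auto simp: linear_on_subspace_def)

text \<open>Split off a root: p = (X - z) q. Either q(f) w is an eigenvector for z, or it is 0 and q
  annihilates w in smaller degree. The fixed bound \<open>N\<close> lets p and q be evaluated by
  sums over the same range.\<close>

lemma eigenvector_of_annihilating_poly:
  assumes W: "subspace W" and f: "linear_on_subspace W f" and w: "w \<in> W" "w \<noteq> 0"
    and p: "p \<noteq> 0" "degree p \<le> N" "(\<Sum>i\<le>N. coeff p i *s (f ^^ i) w) = 0"
  shows "\<exists>v\<in>W. \<exists>c. v \<noteq> 0 \<and> f v = c *s v"
  using p
proof (induction "degree p" arbitrary: p rule: less_induct)
  case less
  note fD = linear_on_subspaceD[OF f]
  have fw: "(f ^^ i) w \<in> W" for i by (induction i) (auto simp: w fD)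
  define E where "E q = (\<Sum>i\<le>N. coeff q i *s (f ^^ i) w)" for q
  have EW: "E q \<in> W" for q unfolding E_def by (intro subspace_sum subspace_scale W fw)
  show ?case
  proof (cases "degree p = 0")
    case True
    then obtain c where c: "p = [:c:]" by (metis degree_eq_zeroE)
    have "E p = (\<Sum>i\<le>N. if i = 0 then c *s w else 0)"
      unfolding E_def by (intro sum.cong) (auto simp: c coeff_pCons split: nat.splits)
    hence "E p = c *s w" by simp
    hence "c *s w = 0" using less.prems by (simp add: E_def)
    thus ?thesis using w less.prems c by simp
  next
    case False
    hence "\<not> constant (poly p)" by (simp add: constant_degree)
    then obtain z where "poly p z = 0" using fundamental_theorem_of_algebra by blast
    then obtain q where q: "p = [:- z, 1:] * q" using poly_eq_0_iff_dvd by blast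
    have q0: "q \<noteq> 0" using less.prems q by auto
    have deg: "degree p = Suc (degree q)" unfolding q using q0 by (subst degree_mult_eq) auto
    have p_eq: "p = Polynomial.smult (- z) q + pCons 0 q" unfolding q by simp
    obtain M where M: "N = Suc M" using deg less.prems by (cases N) auto
    have qN: "coeff q N = 0" using deg less.prems by (intro coeff_eq_0) auto
    have f0: "f 0 = 0" using fD(3)[OF w(1), of 0] by simp
    have fsum: "f (\<Sum>i\<in>I. g i) = (\<Sum>i\<in>I. f (g i))" if "\<And>i. i \<in> I \<Longrightarrow> g i \<in> W" for g and I :: "nat set"
      using that by (induction I rule: infinite_finite_induct) (auto simp: f0 fD(2) subspace_sum[OF W])
    have "E (pCons 0 q) = (\<Sum>i\<le>M. coeff q i *s (f ^^ Suc i) w)"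
      unfolding E_def M by (subst sum.atMost_Suc_shift) simp
    also have "\<dots> = f (\<Sum>i\<le>M. coeff q i *s (f ^^ i) w)"
      by (subst fsum) (auto intro: subspace_scale[OF W] fw simp: fD(3)[OF fw])
    also have "(\<Sum>i\<le>M. coeff q i *s (f ^^ i) w) = E q"
      unfolding E_def M using qN M by simp
    finally have Ep: "E p = - z *s E q + f (E q)"
      unfolding p_eq by (simp add: E_def scale_left_diff_distrib sum_subtractf scale_sum_right sum_negf)
    have "E p = 0" using less.prems by (simp add: E_def)
    hence ev: "f (E q) = z *s E q" using Ep by simp
    show ?thesis
    proof (cases "E q = 0")
      case True
      show ?thesis
        by (rule less.hyps[of q]) (use True q0 deg less.prems in \<open>auto simp: E_def\<close>)
    next
      case False
      thus ?thesis using EW ev by blast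
    qed
  qed
qed

text \<open>With N = \<open>card B\<close>, the N + 1 vectors w, f w, ..., f^N w lie in the span of
  N vectors, so a nonzero polynomial in f annihilates w.\<close>

lemma exists_eigenvector:
  assumes W: "subspace W" "W \<subseteq> span B" "finite B" and f: "linear_on_subspace W f"
    and w: "w \<in> W" "w \<noteq> 0"
  shows "\<exists>v\<in>W. \<exists>c. v \<noteq> 0 \<and> f v = c *s v"
proof -
  note fD = linear_on_subspaceD[OF f]
  have fw: "(f ^^ i) w \<in> W" for i by (induction i) (auto simp: w fD)
  define N where "N = card B"
  have "\<exists>u. (\<exists>i\<le>N. u i \<noteq> 0) \<and> (\<Sum>i\<le>N. u i *s (f ^^ i) w) = 0"
  \<comment> \<open>Linear dependence concerns sets, so a repetition among the iterates is treated
    separately; it gives a relation directly.\<close>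
  proof (cases "inj_on (\<lambda>i. (f ^^ i) w) {..N}")
    case True
    define S where "S = (\<lambda>i. (f ^^ i) w) ` {..N}"
    have "card S = Suc N" using card_image[OF True] by (simp add: S_def)
    moreover have "S \<subseteq> span B" using W fw by (auto simp: S_def)
    ultimately have "dependent S" using independent_span_bound[OF W(3), of S] by (auto simp: N_def)
    then obtain u where "\<exists>v\<in>S. u v \<noteq> 0" "(\<Sum>v\<in>S. u v *s v) = 0"
      using dependent_finite[of S] by (auto simp: S_def)
    thus ?thesis
      by (intro exI[of _ "\<lambda>i. u ((f ^^ i) w)"]) (auto simp: S_def sum.reindex[OF True])
  next
    case False
    then obtain i j where ij: "i \<le> N" "j \<le> N" "i \<noteq> j" "(f ^^ i) w = (f ^^ j) w" by (auto simp: inj_on_def)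
    define u where "u = (\<lambda>k. if k = i then 1 else if k = j then - 1 else 0 :: complex)"
    have "(\<Sum>k\<le>N. u k *s (f ^^ k) w) =
        (\<Sum>k\<le>N. (if k = i then (f ^^ i) w else 0) - (if k = j then (f ^^ j) w else 0))"
      using ij by (intro sum.cong) (auto simp: u_def)
    also have "\<dots> = 0" using ij by (simp add: sum_subtractf)
    finally show ?thesis using ij by (intro exI[of _ u]) (auto simp: u_def)
  qed
  then obtain u i0 where u: "i0 \<le> N" "u i0 \<noteq> 0" "(\<Sum>i\<le>N. u i *s (f ^^ i) w) = 0" by blast
  define p where "p = (\<Sum>i\<le>N. monom (u i) i)"
  have coeff: "coeff p i = (if i \<le> N then u i else 0)" for i
    by (simp add: p_def coeff_sum)
  have "degree p \<le> N" by (rule degree_le) (simp add: coeff)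
  moreover have "p \<noteq> 0" using u coeff by (metis coeff_0)
  moreover have "(\<Sum>i\<le>N. coeff p i *s (f ^^ i) w) = 0" using u(3) by (simp add: coeff)
  ultimately show ?thesis using eigenvector_of_annihilating_poly[OF W(1) f w] by blast
qed

lemma subspace_eqI_dim:
  assumes U: "subspace U" "U \<subseteq> W" and W: "subspace W" "W \<subseteq> span B" "finite B" and dim: "dim W \<le> dim U"
  shows "U = W"
proof (rule ccontr)
  assume "U \<noteq> W"
  then obtain x where x: "x \<in> W" "x \<notin> U" using U by blast
  obtain C where C: "C \<subseteq> U" "independent C" "U \<subseteq> span C" "card C = dim U" using basis_exists by metis
  obtain D where D: "D \<subseteq> W" "independent D" "W \<subseteq> span D" "card D = dim W" using basis_exists by metis
  have finC: "finite C" using independent_span_bound[OF W(3) C(2)] C(1) U W by blast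
  have finD: "finite D" using independent_span_bound[OF W(3) D(2)] D(1) W by blast
  have "x \<notin> span C" using x C span_minimal[OF C(1) U(1)] by blast
  hence "independent (insert x C)" using C(2) by (simp add: independent_insertI)
  moreover have "insert x C \<subseteq> span D" using x C U D by blast
  ultimately have "card (insert x C) \<le> card D" using independent_span_bound[OF finD] by blast
  moreover have "x \<notin> C" using x C by blast
  ultimately show False using finC C D dim by simp
qed

text \<open>Choose a nonzero subspace U of least dimension that every member of \<open>F\<close>
  preserves. An eigenspace in U of one member is preserved by all the others because they commute
  with it, so it is U. Hence all of \<open>F\<close> acts on U by scalars.\<close>

lemma common_eigenvector:
  assumes W: "subspace W" "W \<subseteq> span B" "finite B" and nz: "w0 \<in> W" "w0 \<noteq> 0"
    and lin: "\<And>f. f \<in> F \<Longrightarrow> linear_on_subspace W f"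
    and comm: "\<And>f g x. f \<in> F \<Longrightarrow> g \<in> F \<Longrightarrow> x \<in> W \<Longrightarrow> f (g x) = g (f x)"
  shows "\<exists>w\<in>W. w \<noteq> 0 \<and> (\<forall>f\<in>F. \<exists>c. f w = c *s w)"
proof -
  define Q where "Q U \<longleftrightarrow> subspace U \<and> U \<subseteq> W \<and> U \<noteq> {0} \<and> (\<forall>f\<in>F. \<forall>x\<in>U. f x \<in> U)" for U
  have "Q W" using W nz lin linear_on_subspaceD by (auto simp: Q_def)
  then obtain U where U: "Q U" and min: "\<And>V. Q V \<Longrightarrow> dim U \<le> dim V"
    using arg_min_nat_lemma[of Q W dim] by blast
  have Us: "subspace U" "U \<subseteq> W" "U \<noteq> {0}" and Uinv: "\<And>f x. f \<in> F \<Longrightarrow> x \<in> U \<Longrightarrow> f x \<in> U"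
    using U by (auto simp: Q_def)
  obtain u where u: "u \<in> U" "u \<noteq> 0" using Us subspace_0[OF Us(1)] by blast
  have scalar: "\<exists>c. \<forall>x\<in>U. f x = c *s x" if f: "f \<in> F" for f
  proof -
    note fD = linear_on_subspaceD[OF lin[OF f]]
    have linU: "linear_on_subspace U f"
      unfolding linear_on_subspace_def using Uinv[OF f] fD(2,3) subsetD[OF Us(2)] by auto
    obtain v c where v: "v \<in> U" "v \<noteq> 0" "f v = c *s v"
      using exists_eigenvector[OF Us(1) _ W(3) linU u] Us W by blast
    define V where "V = {x\<in>U. f x = c *s x}"
    have "subspace V"
    proof (rule subspaceI)
      have "f 0 = 0" using fD(3)[OF nz(1), of 0] by simp
      thus "0 \<in> V" using subspace_0[OF Us(1)] by (simp add: V_def)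
      show "x + y \<in> V" if "x \<in> V" "y \<in> V" for x y
        using that Us(2) subspace_add[OF Us(1), of x y] fD(2)[of x y]
        by (auto simp: V_def scale_right_distrib)
      show "a *s x \<in> V" if "x \<in> V" for a x
        using that Us(2) subspace_scale[OF Us(1), of x a] fD(3)[of x a]
        by (auto simp: V_def mult.commute)
    qed
    moreover have "g x \<in> V" if g: "g \<in> F" and x: "x \<in> V" for g x
    proof -
      have xU: "x \<in> U" "x \<in> W" "f x = c *s x" using x Us by (auto simp: V_def)
      have "f (g x) = g (f x)" by (rule comm[OF f g xU(2)])
      also have "\<dots> = c *s g x" using xU linear_on_subspaceD(3)[OF lin[OF g] xU(2)] by simp
      finally show ?thesis using Uinv[OF g xU(1)] by (simp add: V_def)
    qed
    ultimately have "Q V" using v Us by (auto simp: Q_def V_def)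
    from min[OF this] have "V = U"
      using \<open>subspace V\<close> Us W by (intro subspace_eqI_dim[of V U B]) (auto simp: V_def)
    thus ?thesis by (auto simp: V_def)
  qed
  thus ?thesis using u Us by blast
qed

end

section \<open>Irreducible representations up to twist\<close>

lemma subspace_vec_iff:
  "VectorSpace.subspace class_ring W (module_vec TYPE(complex) d) \<longleftrightarrow> W \<subseteq> carrier_vec d \<and> 0\<^sub>v d \<in> W \<and>
     (\<forall>v\<in>W. \<forall>w\<in>W. v + w \<in> W) \<and> (\<forall>c. \<forall>v\<in>W. c \<cdot>\<^sub>v v \<in> W)"
proof -
  have "Module.module (class_ring :: complex ring) (module_vec TYPE(complex) d)"
    using vec_vs[of d, where 'a = complex] by (simp add: vectorspace_def)
  thus ?thesis using vec_vs[of d, where 'a = complex]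
    by (auto simp: VectorSpace.subspace_def submodule_def module_vec_simps)
qed

lemma mat_eqI_mult_vec:
  fixes A B :: "'a :: comm_ring_1 mat"
  assumes "A \<in> carrier_mat m n" "B \<in> carrier_mat m n" "\<And>v. v \<in> carrier_vec n \<Longrightarrow> A *\<^sub>v v = B *\<^sub>v v"
  shows "A = B"
proof (rule mat_col_eqI)
  fix j assume "j < dim_col B"
  hence "j < n" using assms by simp
  thus "col A j = col B j"
    using assms(3)[of "unit_vec n j"] assms(1,2)
    by (auto simp: vec_eq_iff intro!: eq_vecI)
qed (use assms in auto)

lemma smult_mult_mat_vec:
  assumes "A \<in> carrier_mat m n" "v \<in> carrier_vec n"
  shows "(c \<cdot>\<^sub>m A) *\<^sub>v v = c \<cdot>\<^sub>v (A *\<^sub>v v)"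
  using assms by (auto intro!: eq_vecI simp: scalar_prod_def sum_distrib_left mult.assoc)

lemma irreducible_repD:
  assumes "irreducible_rep G d \<rho>"
  shows "matrix_rep G d \<rho>" "d > 0"
    and "\<And>W. W \<subseteq> carrier_vec d \<Longrightarrow> 0\<^sub>v d \<in> W \<Longrightarrow> (\<And>v w. v \<in> W \<Longrightarrow> w \<in> W \<Longrightarrow> v + w \<in> W) \<Longrightarrow>
      (\<And>c v. v \<in> W \<Longrightarrow> c \<cdot>\<^sub>v v \<in> W) \<Longrightarrow> (\<And>g w. g \<in> carrier G \<Longrightarrow> w \<in> W \<Longrightarrow> \<rho> g *\<^sub>v w \<in> W) \<Longrightarrow>
      W = {0\<^sub>v d} \<or> W = carrier_vec d"
proof -
  show "matrix_rep G d \<rho>" "d > 0" using assms by (simp_all add: irreducible_rep_def)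
  fix W assume "W \<subseteq> carrier_vec d" "0\<^sub>v d \<in> W" "\<And>v w. v \<in> W \<Longrightarrow> w \<in> W \<Longrightarrow> v + w \<in> W"
    "\<And>c v. v \<in> W \<Longrightarrow> c \<cdot>\<^sub>v v \<in> W" "\<And>g w. g \<in> carrier G \<Longrightarrow> w \<in> W \<Longrightarrow> \<rho> g *\<^sub>v w \<in> W"
  thus "W = {0\<^sub>v d} \<or> W = carrier_vec d"
    using assms unfolding irreducible_rep_def subspace_vec_iff by simp
qed

lemma trace_mult_commute:
  fixes A B :: "'a :: comm_ring_1 mat"
  assumes "A \<in> carrier_mat m n" "B \<in> carrier_mat n m"
  shows "(\<Sum>i<m. (A * B) $$ (i, i)) = (\<Sum>j<n. (B * A) $$ (j, j))"
proof -
  have "(\<Sum>i<m. (A * B) $$ (i, i)) = (\<Sum>i<m. \<Sum>j<n. A $$ (i, j) * B $$ (j, i))"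
    using assms by (intro sum.cong) (auto simp: scalar_prod_def atLeast0LessThan)
  also have "\<dots> = (\<Sum>j<n. \<Sum>i<m. A $$ (i, j) * B $$ (j, i))" by (rule sum.swap)
  also have "\<dots> = (\<Sum>j<n. (B * A) $$ (j, j))"
    using assms by (intro sum.cong) (auto simp: scalar_prod_def atLeast0LessThan mult.commute intro!: sum.cong)
  finally show ?thesis .
qed

section \<open>Schur's lemma for matrix representations\<close>

context group
begin

lemma matrix_repD:
  assumes \<rho>: "matrix_rep G d \<rho>"
  shows "g \<in> carrier G \<Longrightarrow> \<rho> g \<in> carrier_mat d d"
    and "g \<in> carrier G \<Longrightarrow> h \<in> carrier G \<Longrightarrow> \<rho> (g \<otimes> h) = \<rho> g * \<rho> h"
    and "\<rho> \<one> = 1\<^sub>m d"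
proof -
  interpret M: ring "ring_mat TYPE(complex) d ()" by (rule ring_mat)
  have hom: "\<rho> \<in> hom G (units_of (ring_mat TYPE(complex) d ()))" using \<rho> by (simp add: matrix_rep_def)
  show "\<rho> g \<in> carrier_mat d d" if "g \<in> carrier G" for g
    using hom_in_carrier[OF hom that] by (simp add: units_of_def Units_def ring_mat_simps)
  show "\<rho> (g \<otimes> h) = \<rho> g * \<rho> h" if "g \<in> carrier G" "h \<in> carrier G"
    using hom_mult[OF hom that] by (simp add: units_of_def ring_mat_simps)
  have "\<rho> \<one> = \<one>\<^bsub>units_of (ring_mat TYPE(complex) d ())\<^esub>"
    by (rule hom_one[OF hom group_axioms M.units_group])
  thus "\<rho> \<one> = 1\<^sub>m d" by (simp add: units_of_def ring_mat_simps)
qed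

lemma matrix_rep_inv:
  assumes \<rho>: "matrix_rep G d \<rho>" and g: "g \<in> carrier G"
  shows "\<rho> (inv g) * \<rho> g = 1\<^sub>m d" "\<rho> g * \<rho> (inv g) = 1\<^sub>m d"
  using g by (simp_all add: matrix_repD[OF \<rho>] l_inv r_inv inv_closed
      flip: matrix_repD(2)[OF \<rho>])

lemma matrix_repI:
  assumes \<rho>: "\<And>g. g \<in> carrier G \<Longrightarrow> \<rho> g \<in> carrier_mat d d"
    "\<And>g h. g \<in> carrier G \<Longrightarrow> h \<in> carrier G \<Longrightarrow> \<rho> (g \<otimes> h) = \<rho> g * \<rho> h" "\<rho> \<one> = 1\<^sub>m d"
  shows "matrix_rep G d \<rho>"
proof -
  have "\<rho> (inv g) * \<rho> g = 1\<^sub>m d" "\<rho> g * \<rho> (inv g) = 1\<^sub>m d" if "g \<in> carrier G" for g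
    using that \<rho>(3) by (simp_all add: l_inv r_inv inv_closed flip: \<rho>(2))
  hence "\<rho> g \<in> Units (ring_mat TYPE(complex) d ())" if "g \<in> carrier G" for g
    using that \<rho>(1)[OF that] \<rho>(1)[OF inv_closed[OF that]]
    unfolding Units_def ring_mat_simps by blast
  thus ?thesis using \<rho>(2) by (auto simp: matrix_rep_def hom_def units_of_def ring_mat_simps)
qed

text \<open>An eigenspace of \<open>\<rho> z\<close> is nonzero and preserved by the representation,
  hence everything.\<close>

lemma schur_scalar:
  assumes \<rho>: "irreducible_rep G d \<rho>" and z: "z \<in> carrier G"
    and central: "\<And>g. g \<in> carrier G \<Longrightarrow> z \<otimes> g = g \<otimes> z"
  obtains c where "\<rho> z = c \<cdot>\<^sub>m 1\<^sub>m d"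
proof -
  note I = irreducible_repD[OF \<rho>]
  note R = matrix_repD[OF I(1)]
  have "spectrum (\<rho> z) \<noteq> {}" by (rule spectrum_non_empty[OF R(1)[OF z] I(2)])
  then obtain c v where cv: "eigenvector (\<rho> z) v c" by (auto simp: spectrum_def eigenvalue_def)
  have v: "v \<in> carrier_vec d" "v \<noteq> 0\<^sub>v d" "\<rho> z *\<^sub>v v = c \<cdot>\<^sub>v v"
    using cv R(1)[OF z] by (auto simp: eigenvector_def)
  define W where "W = {v \<in> carrier_vec d. \<rho> z *\<^sub>v v = c \<cdot>\<^sub>v v}"
  have "W = {0\<^sub>v d} \<or> W = carrier_vec d"
  proof (rule I(3))
    show "0\<^sub>v d \<in> W" using R(1)[OF z] by (auto simp: W_def)
    show "v + w \<in> W" if "v \<in> W" "w \<in> W" for v w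
      using that R(1)[OF z] by (auto simp: W_def mult_add_distrib_mat_vec smult_add_distrib_vec)
    show "a \<cdot>\<^sub>v v \<in> W" if "v \<in> W" for a v
      using that R(1)[OF z] by (auto simp: W_def mult_mat_vec smult_smult_assoc mult.commute)
    show "\<rho> g *\<^sub>v w \<in> W" if g: "g \<in> carrier G" and w: "w \<in> W" for g w
    proof -
      have w': "w \<in> carrier_vec d" "\<rho> z *\<^sub>v w = c \<cdot>\<^sub>v w" using w by (auto simp: W_def)
      have "\<rho> z *\<^sub>v (\<rho> g *\<^sub>v w) = \<rho> (z \<otimes> g) *\<^sub>v w"
        using R(1)[OF z] R(1)[OF g] w'(1) by (simp add: R(2) z g)
      also have "\<dots> = \<rho> g *\<^sub>v (\<rho> z *\<^sub>v w)"
        unfolding central[OF g] R(2)[OF g z] by (rule assoc_mult_mat_vec[OF R(1)[OF g] R(1)[OF z] w'(1)])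
      also have "\<dots> = c \<cdot>\<^sub>v (\<rho> g *\<^sub>v w)" unfolding w'(2) using R(1)[OF g] w'(1) by (simp add: mult_mat_vec)
      finally show ?thesis using R(1)[OF g] w' by (auto simp: W_def)
    qed
  qed (auto simp: W_def)
  hence W: "W = carrier_vec d" using v by (auto simp: W_def)
  have "\<rho> z = c \<cdot>\<^sub>m 1\<^sub>m d"
  proof (rule mat_eqI_mult_vec[of _ d d])
    fix v :: "complex vec" assume v: "v \<in> carrier_vec d"
    hence "\<rho> z *\<^sub>v v = c \<cdot>\<^sub>v v" using W by (auto simp: W_def)
    thus "\<rho> z *\<^sub>v v = (c \<cdot>\<^sub>m 1\<^sub>m d) *\<^sub>v v" using v by (simp add: smult_mult_mat_vec[of _ d d])
  qed (use R(1)[OF z] in auto)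
  thus ?thesis by (rule that)
qed

text \<open>Schur's lemma up to twist: the factors \<open>\<chi> g\<close> are nonzero because T is,
  so kernel and image of T are still invariant. At this stage \<open>\<chi>\<close> is an arbitrary
  function; that it is a homomorphism is derived later.\<close>

lemma intertwiner_bijective:
  assumes \<rho>1: "irreducible_rep G d1 \<rho>1" and \<rho>2: "irreducible_rep G d2 \<rho>2"
    and T: "T \<in> carrier_mat d1 d2" "T \<noteq> 0\<^sub>m d1 d2"
    and tw: "\<And>g. g \<in> carrier G \<Longrightarrow> \<rho>1 g * T = \<chi> g \<cdot>\<^sub>m (T * \<rho>2 g)"
  obtains S where "S \<in> carrier_mat d2 d1" "T * S = 1\<^sub>m d1" "S * T = 1\<^sub>m d2"
proof -
  note I1 = irreducible_repD[OF \<rho>1] and I2 = irreducible_repD[OF \<rho>2]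
  note R1 = matrix_repD[OF I1(1)] and R2 = matrix_repD[OF I2(1)]
  have \<chi>0: "\<chi> g \<noteq> 0" if g: "g \<in> carrier G" for g
  proof
    assume "\<chi> g = 0"
    hence "\<rho>1 g * T = 0\<^sub>m d1 d2" using tw[OF g] T R2(1)[OF g] by (intro eq_matI) auto
    hence "\<rho>1 (inv g) * (\<rho>1 g * T) = 0\<^sub>m d1 d2"
      using R1(1)[OF inv_closed[OF g]] by simp
    moreover have "\<rho>1 (inv g) * (\<rho>1 g * T) = T"
      using R1(1)[OF inv_closed[OF g]] R1(1)[OF g] T matrix_rep_inv[OF I1(1) g]
      by (simp flip: assoc_mult_mat)
    ultimately show False using T by simp
  qed
  have comm: "T *\<^sub>v (\<rho>2 g *\<^sub>v v) = inverse (\<chi> g) \<cdot>\<^sub>v (\<rho>1 g *\<^sub>v (T *\<^sub>v v))"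
    if g: "g \<in> carrier G" and v: "v \<in> carrier_vec d2" for g v
  proof -
    have "\<rho>1 g *\<^sub>v (T *\<^sub>v v) = (\<rho>1 g * T) *\<^sub>v v" using R1(1)[OF g] T v by (simp add: assoc_mult_mat_vec)
    also have "\<dots> = \<chi> g \<cdot>\<^sub>v (T *\<^sub>v (\<rho>2 g *\<^sub>v v))"
      unfolding tw[OF g] using R2(1)[OF g] T v by (simp add: assoc_mult_mat_vec smult_mult_mat_vec[of _ d1 d2])
    finally show ?thesis using \<chi>0[OF g] by (simp add: smult_smult_assoc)
  qed
  define K where "K = {v \<in> carrier_vec d2. T *\<^sub>v v = 0\<^sub>v d1}"
  have "K = {0\<^sub>v d2} \<or> K = carrier_vec d2"
  proof (rule I2(3))
    show "v + w \<in> K" if "v \<in> K" "w \<in> K" for v w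
      using that T by (auto simp: K_def mult_add_distrib_mat_vec)
    show "a \<cdot>\<^sub>v v \<in> K" if "v \<in> K" for a v
      using that T by (auto simp: K_def mult_mat_vec)
    show "\<rho>2 g *\<^sub>v w \<in> K" if g: "g \<in> carrier G" and w: "w \<in> K" for g w
      using w comm[OF g, of w] R1(1)[OF g] R2(1)[OF g] by (auto simp: K_def)
  qed (use T in \<open>auto simp: K_def\<close>)
  moreover have "K \<noteq> carrier_vec d2"
  proof
    assume "K = carrier_vec d2"
    hence "T *\<^sub>v v = 0\<^sub>v d1" if "v \<in> carrier_vec d2" for v using that by (auto simp: K_def)
    hence "T = 0\<^sub>m d1 d2" using T by (intro mat_eqI_mult_vec[of _ d1 d2]) (auto intro!: eq_vecI)
    thus False using T by simp
  qed
  ultimately have K: "K = {0\<^sub>v d2}" by simp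
  define J where "J = {T *\<^sub>v v | v. v \<in> carrier_vec d2}"
  have "J = {0\<^sub>v d1} \<or> J = carrier_vec d1"
  proof (rule I1(3))
    show "0\<^sub>v d1 \<in> J" using T by (auto simp: J_def intro!: exI[of _ "0\<^sub>v d2"])
    show "v + w \<in> J" if vw: "v \<in> J" "w \<in> J" for v w
    proof -
      obtain v' w' where *: "v = T *\<^sub>v v'" "w = T *\<^sub>v w'" "v' \<in> carrier_vec d2" "w' \<in> carrier_vec d2"
        using vw by (auto simp: J_def)
      hence "v + w = T *\<^sub>v (v' + w')" using T by (simp add: mult_add_distrib_mat_vec)
      thus ?thesis using * by (auto simp: J_def)
    qed
    show "a \<cdot>\<^sub>v v \<in> J" if v: "v \<in> J" for a v
    proof -
      obtain v' where *: "v = T *\<^sub>v v'" "v' \<in> carrier_vec d2" using v by (auto simp: J_def)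
      hence "a \<cdot>\<^sub>v v = T *\<^sub>v (a \<cdot>\<^sub>v v')" using T by (simp add: mult_mat_vec)
      thus ?thesis using * by (auto simp: J_def)
    qed
    show "\<rho>1 g *\<^sub>v w \<in> J" if g: "g \<in> carrier G" and w: "w \<in> J" for g w
    proof -
      obtain v where v: "w = T *\<^sub>v v" "v \<in> carrier_vec d2" using w by (auto simp: J_def)
      have "\<rho>1 g *\<^sub>v w = \<chi> g \<cdot>\<^sub>v (T *\<^sub>v (\<rho>2 g *\<^sub>v v))"
        unfolding v comm[OF g v(2)] using \<chi>0[OF g] by (simp add: smult_smult_assoc)
      also have "\<dots> = T *\<^sub>v (\<chi> g \<cdot>\<^sub>v (\<rho>2 g *\<^sub>v v))"
        using T R2(1)[OF g] v by (simp add: mult_mat_vec)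
      finally show ?thesis using R2(1)[OF g] v by (auto simp: J_def)
    qed
  qed (use T in \<open>auto simp: J_def\<close>)
  moreover have "J \<noteq> {0\<^sub>v d1}"
  proof
    assume J: "J = {0\<^sub>v d1}"
    have "T *\<^sub>v v \<in> J" if "v \<in> carrier_vec d2" for v using that by (auto simp: J_def)
    hence "K = carrier_vec d2" using J by (auto simp: K_def)
    thus False using \<open>K \<noteq> carrier_vec d2\<close> by simp
  qed
  ultimately have "\<forall>i. \<exists>v. i < d1 \<longrightarrow> v \<in> carrier_vec d2 \<and> T *\<^sub>v v = unit_vec d1 i"
    unfolding J_def by (smt (verit, best) mem_Collect_eq unit_vec_carrier)
  then obtain s where s: "\<And>i. i < d1 \<Longrightarrow> s i \<in> carrier_vec d2 \<and> T *\<^sub>v s i = unit_vec d1 i" by metis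
  \<comment> \<open>The columns of S are preimages of the unit vectors under T.\<close>
  define S where "S = mat d2 d1 (\<lambda>(i, j). s j $ i)"
  have S: "S \<in> carrier_mat d2 d1" by (simp add: S_def)
  have colS: "col S j = s j" if "j < d1" for j using that s[OF that] by (auto simp: S_def)
  have TS: "T * S = 1\<^sub>m d1"
  proof (rule mat_col_eqI)
    fix j assume "j < dim_col (1\<^sub>m d1 :: complex mat)"
    hence j: "j < d1" by simp
    show "col (T * S) j = col (1\<^sub>m d1) j"
      using j S T s[OF j] colS[OF j] by (simp add: col_mult2[OF T(1) S j])
  qed (use T S in auto)
  have "S * T = 1\<^sub>m d2"
  proof (rule mat_eqI_mult_vec[of _ d2 d2])
    fix v :: "complex vec" assume v: "v \<in> carrier_vec d2"
    have STv: "(S * T) *\<^sub>v v \<in> carrier_vec d2" using S T v by simp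
    have "T *\<^sub>v ((S * T) *\<^sub>v v) = (T * S) *\<^sub>v (T *\<^sub>v v)" using S T v
      by (simp add: assoc_mult_mat_vec)
    also have "\<dots> = T *\<^sub>v v" using T v TS by simp
    finally have "T *\<^sub>v ((S * T) *\<^sub>v v - v) = 0\<^sub>v d1"
      using T v STv by (simp add: mult_minus_distrib_mat_vec)
    hence "(S * T) *\<^sub>v v - v \<in> K" using STv v by (simp add: K_def)
    hence "(S * T) *\<^sub>v v - v = 0\<^sub>v d2" using K by simp
    hence "(S * T) *\<^sub>v v = v" using STv v S
      by (intro eq_vecI) (auto dest!: arg_cong[of _ _ "\<lambda>u. u $ _"] simp: vec_eq_iff)
    thus "(S * T) *\<^sub>v v = 1\<^sub>m d2 *\<^sub>v v" using v by simp
  qed (use S T in auto)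
  thus ?thesis using that S TS by blast
qed

end

lemma complex_vector_space_fun: "complex_vector_space (\<lambda>c (f :: 'i \<Rightarrow> complex) i. c * f i)"
  by unfold_locales (auto simp: fun_eq_iff algebra_simps)

section \<open>Twisted intertwiners and twist equivalence\<close>

context group
begin

text \<open>
  The operators \<open>T \<mapsto> \<rho>1 g * T * (\<rho>2 g)\<inverse>\<close> commute since the two representations agree on commutators.
\<close>

lemma exists_twisted_intertwiner:
  assumes \<rho>1: "matrix_rep G d1 \<rho>1" "d1 > 0" and \<rho>2: "matrix_rep G d2 \<rho>2" "d2 > 0"
    and comm: "\<And>g h. g \<in> carrier G \<Longrightarrow> h \<in> carrier G \<Longrightarrow> \<exists>z\<in>carrier G. \<exists>c.
      g \<otimes> h = z \<otimes> (h \<otimes> g) \<and> \<rho>1 z = c \<cdot>\<^sub>m 1\<^sub>m d1 \<and> \<rho>2 z = c \<cdot>\<^sub>m 1\<^sub>m d2"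
  obtains T \<chi> where "T \<in> carrier_mat d1 d2" "T \<noteq> 0\<^sub>m d1 d2"
    "\<And>g. g \<in> carrier G \<Longrightarrow> \<rho>1 g * T = \<chi> g \<cdot>\<^sub>m (T * \<rho>2 g)"
proof -
  interpret V: complex_vector_space "\<lambda>c (f :: nat \<times> nat \<Rightarrow> complex) i. c * f i"
    by (rule complex_vector_space_fun)
  note R1 = matrix_repD[OF \<rho>1(1)] and R2 = matrix_repD[OF \<rho>2(1)]
  define I where "I = {..<d1} \<times> {..<d2}"
  \<comment> \<open>The d1 by d2 matrices, modelled as functions supported on \<open>I\<close>
    inside a vector space type; \<open>M\<close> and \<open>E\<close> translate between the
    two.\<close>
  define W where "W = {f :: nat \<times> nat \<Rightarrow> complex. \<forall>p. p \<notin> I \<longrightarrow> f p = 0}"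
  define M where "M f = mat d1 d2 f" for f :: "nat \<times> nat \<Rightarrow> complex"
  define E where "E A = (\<lambda>p. if p \<in> I then A $$ p else 0)" for A :: "complex mat"
  have M: "M f \<in> carrier_mat d1 d2" for f by (simp add: M_def)
  have ME: "M (E A) = A" if "A \<in> carrier_mat d1 d2" for A
    using that by (intro eq_matI) (auto simp: M_def E_def I_def)
  have EM: "E (M f) = f" if "f \<in> W" for f
    using that by (auto simp: fun_eq_iff E_def M_def W_def I_def)
  have EW: "E A \<in> W" for A by (auto simp: E_def W_def)
  define \<Phi> where "\<Phi> g f = E (\<rho>1 g * M f * \<rho>2 (inv g))" for g f
  have car: "\<rho>1 g * A * \<rho>2 (inv g) \<in> carrier_mat d1 d2"
    if "g \<in> carrier G" "A \<in> carrier_mat d1 d2" for g A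
    using R1(1)[OF that(1)] R2(1)[OF inv_closed[OF that(1)]] that(2) by auto
  have M\<Phi>: "M (\<Phi> g f) = \<rho>1 g * M f * \<rho>2 (inv g)" if "g \<in> carrier G" for g f
    unfolding \<Phi>_def by (rule ME[OF car[OF that M]])
  have Madd: "M (x + y) = M x + M y" for x y by (intro eq_matI) (auto simp: M_def)
  have Msc: "M (\<lambda>i. c * x i) = c \<cdot>\<^sub>m M x" for c x by (intro eq_matI) (auto simp: M_def)
  have Eadd: "E (A + B) = E A + E B" if "A \<in> carrier_mat d1 d2" "B \<in> carrier_mat d1 d2" for A B
    using that by (auto simp: E_def I_def fun_eq_iff)
  have Esc: "E (c \<cdot>\<^sub>m A) = (\<lambda>i. c * E A i)" if "A \<in> carrier_mat d1 d2" for c A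
    using that by (auto simp: E_def I_def fun_eq_iff)
  have lin: "V.linear_on_subspace W (\<Phi> g)" if g: "g \<in> carrier G" for g
    unfolding V.linear_on_subspace_def
  proof (intro conjI ballI allI)
    note c = R1(1)[OF g] R2(1)[OF inv_closed[OF g]]
    show "\<Phi> g x \<in> W" for x by (simp add: \<Phi>_def EW)
    show "\<Phi> g (x + y) = \<Phi> g x + \<Phi> g y" for x y
    proof -
      have "\<rho>1 g * M (x + y) * \<rho>2 (inv g) = (\<rho>1 g * M x + \<rho>1 g * M y) * \<rho>2 (inv g)"
        unfolding Madd using mult_add_distrib_mat[OF c(1) M M] by simp
      also have "\<dots> = \<rho>1 g * M x * \<rho>2 (inv g) + \<rho>1 g * M y * \<rho>2 (inv g)"
        by (rule add_mult_distrib_mat[OF mult_carrier_mat[OF c(1) M] mult_carrier_mat[OF c(1) M] c(2)])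
      finally show ?thesis unfolding \<Phi>_def using Eadd[OF car[OF g M] car[OF g M]] by simp
    qed
    show "\<Phi> g (\<lambda>i. a * x i) = (\<lambda>i. a * \<Phi> g x i)" for a x
    proof -
      have "\<rho>1 g * M (\<lambda>i. a * x i) * \<rho>2 (inv g) = (a \<cdot>\<^sub>m (\<rho>1 g * M x)) * \<rho>2 (inv g)"
        unfolding Msc using mult_smult_distrib[OF c(1) M] by simp
      also have "\<dots> = a \<cdot>\<^sub>m (\<rho>1 g * M x * \<rho>2 (inv g))"
        by (rule mult_smult_assoc_mat[OF mult_carrier_mat[OF c(1) M] c(2)])
      finally show ?thesis unfolding \<Phi>_def using Esc[OF car[OF g M]] by simp
    qed
  qed
  have comp: "\<Phi> g (\<Phi> h x) = E (\<rho>1 (g \<otimes> h) * M x * \<rho>2 (inv (g \<otimes> h)))"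
    if gh: "g \<in> carrier G" "h \<in> carrier G" for g h x
  proof -
    note c1 = R1(1)[OF gh(1)] R1(1)[OF gh(2)]
    note c2 = R2(1)[OF inv_closed[OF gh(1)]] R2(1)[OF inv_closed[OF gh(2)]]
    have "\<rho>1 g * (\<rho>1 h * M x * \<rho>2 (inv h)) * \<rho>2 (inv g) =
        (\<rho>1 g * \<rho>1 h) * M x * (\<rho>2 (inv h) * \<rho>2 (inv g))"
      using c1 c2 M[of x] by (simp add: assoc_mult_mat[of _ d1 d1 _ d1 _ d2] assoc_mult_mat[of _ d1 d1 _ d2 _ d2]
          assoc_mult_mat[of _ d1 d2 _ d2 _ d2] mult_carrier_mat[of _ d1 d1 _ d2] mult_carrier_mat[of _ d1 d2 _ d2]
          mult_carrier_mat[of _ d2 d2 _ d2])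
    also have "\<dots> = \<rho>1 (g \<otimes> h) * M x * \<rho>2 (inv (g \<otimes> h))"
      using gh by (simp add: R1(2) R2(2) inv_mult_group)
    finally show ?thesis unfolding \<Phi>_def[of g "\<Phi> h x"] M\<Phi>[OF gh(2)] by simp
  qed
  have \<Phi>comm: "\<Phi> g (\<Phi> h x) = \<Phi> h (\<Phi> g x)" if gh: "g \<in> carrier G" "h \<in> carrier G" for g h x
  proof -
    obtain z c where z: "z \<in> carrier G" "g \<otimes> h = z \<otimes> (h \<otimes> g)"
      "\<rho>1 z = c \<cdot>\<^sub>m 1\<^sub>m d1" "\<rho>2 z = c \<cdot>\<^sub>m 1\<^sub>m d2" using comm[OF gh] by blast
    \<comment> \<open>With g h = z k, the scalar c by which z acts on the left cancels against its
      inverse on the right, so the operators of g h and of h g coincide.\<close>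
    define k where "k = h \<otimes> g"
    have k: "k \<in> carrier G" using gh by (simp add: k_def)
    note c = R1(1)[OF k] R2(1)[OF inv_closed[OF k]] R2(1)[OF inv_closed[OF z(1)]]
    have inv: "c \<cdot>\<^sub>m \<rho>2 (inv z) = 1\<^sub>m d2"
      using matrix_rep_inv(1)[OF \<rho>2(1) z(1)] c(3) unfolding z(4)
      by (simp add: mult_smult_distrib[of _ d2 d2 _ d2])
    have "\<rho>1 (z \<otimes> k) = c \<cdot>\<^sub>m \<rho>1 k"
      using c by (simp add: R1(2)[OF z(1) k] z(3) mult_smult_assoc_mat[of _ d1 d1 _ d1])
    moreover have "\<rho>2 (inv (z \<otimes> k)) = \<rho>2 (inv k) * \<rho>2 (inv z)"
      using z(1) k by (simp add: inv_mult_group R2(2))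
    ultimately have "\<rho>1 (z \<otimes> k) * M x * \<rho>2 (inv (z \<otimes> k)) =
        (c \<cdot>\<^sub>m \<rho>1 k) * M x * (\<rho>2 (inv k) * \<rho>2 (inv z))" by simp
    also have "\<dots> = (\<rho>1 k * M x * \<rho>2 (inv k)) * (c \<cdot>\<^sub>m \<rho>2 (inv z))"
    proof -
      have A: "\<rho>1 k * M x \<in> carrier_mat d1 d2" by (rule mult_carrier_mat[OF c(1) M])
      show ?thesis
        unfolding mult_smult_assoc_mat[OF c(1) M] mult_smult_assoc_mat[OF A mult_carrier_mat[OF c(2,3)]]
          mult_smult_distrib[OF mult_carrier_mat[OF A c(2)] c(3)] assoc_mult_mat[OF A c(2,3)] ..
    qed
    also have "\<dots> = \<rho>1 k * M x * \<rho>2 (inv k)"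
      unfolding inv by (rule right_mult_one_mat[OF car[OF k M]])
    finally have "\<Phi> g (\<Phi> h x) = E (\<rho>1 k * M x * \<rho>2 (inv k))"
      unfolding comp[OF gh] z(2) k_def[symmetric] by simp
    thus ?thesis unfolding comp[OF gh(2,1)] k_def .
  qed
  define B where "B = (\<lambda>p q. if q = p then 1 else 0 :: complex) ` I"
  have W: "V.subspace W" by (auto simp: V.subspace_def W_def)
  have finI: "finite I" by (simp add: I_def)
  have "f \<in> V.span B" if f: "f \<in> W" for f
  proof -
    have "f = (\<Sum>p\<in>I. (\<lambda>q. f p * (if q = p then 1 else 0)))"
    proof
      fix q
      have "(\<Sum>p\<in>I. (\<lambda>q. f p * (if q = p then 1 else 0))) q = (\<Sum>p\<in>I. f p * (if q = p then 1 else 0))"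
        by (induction I rule: infinite_finite_induct) auto
      also have "\<dots> = (\<Sum>p\<in>I. if q = p then f p else 0)" by (rule sum.cong) auto
      also have "\<dots> = (if q \<in> I then f q else 0)" using finI by simp
      also have "\<dots> = f q"
      proof -
        have "q \<notin> I \<Longrightarrow> f q = 0" using f unfolding W_def by blast
        thus ?thesis by simp
      qed
      finally show "f q = (\<Sum>p\<in>I. (\<lambda>q. f p * (if q = p then 1 else 0))) q" by simp
    qed
    also have "\<dots> \<in> V.span B" by (intro V.span_sum V.span_scale V.span_base) (auto simp: B_def)
    finally show ?thesis .
  qed
  hence WB: "W \<subseteq> V.span B" by blast
  have finB: "finite B" by (simp add: B_def I_def)
  \<comment> \<open>Both dimensions are positive, so the position (0, 0) exists and the space is
    nonzero.\<close>
  define w0 where "w0 = (\<lambda>q :: nat \<times> nat. if q = (0, 0) then 1 else 0 :: complex)"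
  have w0: "w0 \<in> W" "w0 \<noteq> 0" using \<rho>1(2) \<rho>2(2) by (auto simp: w0_def W_def I_def fun_eq_iff)
  have "\<exists>w\<in>W. w \<noteq> 0 \<and> (\<forall>f\<in>\<Phi> ` carrier G. \<exists>c. f w = (\<lambda>i. c * w i))"
    by (rule V.common_eigenvector[OF W WB finB w0]) (use lin \<Phi>comm in blast)+
  then obtain w where w: "w \<in> W" "w \<noteq> 0" "\<forall>g\<in>carrier G. \<exists>c. \<Phi> g w = (\<lambda>i. c * w i)" by auto
  then obtain \<chi> where \<chi>: "\<And>g. g \<in> carrier G \<Longrightarrow> \<Phi> g w = (\<lambda>i. \<chi> g * w i)" by metis
  show ?thesis
  proof (rule that[of "M w" \<chi>])
    show "M w \<noteq> 0\<^sub>m d1 d2"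
    proof
      assume "M w = 0\<^sub>m d1 d2"
      hence "w = E (0\<^sub>m d1 d2)" using EM[OF w(1)] by simp
      hence "w = 0" by (auto simp: E_def I_def fun_eq_iff)
      thus False using w by simp
    qed
    fix g assume g: "g \<in> carrier G"
    note c = R1(1)[OF g] R2(1)[OF inv_closed[OF g]] R2(1)[OF g]
    have "\<rho>1 g * M w * \<rho>2 (inv g) = \<chi> g \<cdot>\<^sub>m M w"
      using M\<Phi>[OF g, of w] \<chi>[OF g] Msc by simp
    hence "\<rho>1 g * M w * \<rho>2 (inv g) * \<rho>2 g = (\<chi> g \<cdot>\<^sub>m M w) * \<rho>2 g" by simp
    also have "\<rho>1 g * M w * \<rho>2 (inv g) * \<rho>2 g = \<rho>1 g * M w * (\<rho>2 (inv g) * \<rho>2 g)"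
      by (rule assoc_mult_mat[OF mult_carrier_mat[OF c(1) M] c(2,3)])
    also have "\<dots> = \<rho>1 g * M w"
      unfolding matrix_rep_inv(1)[OF \<rho>2(1) g] by (rule right_mult_one_mat[OF mult_carrier_mat[OF c(1) M]])
    also have "(\<chi> g \<cdot>\<^sub>m M w) * \<rho>2 g = \<chi> g \<cdot>\<^sub>m (M w * \<rho>2 g)" by (rule mult_smult_assoc_mat[OF M c(3)])
    finally show "\<rho>1 g * M w = \<chi> g \<cdot>\<^sub>m (M w * \<rho>2 g)" .
  qed (rule M)
qed

lemma Irr_1I:
  assumes \<chi>: "\<chi> \<in> extensional (carrier G)" "\<chi> \<one> = 1"
    "\<And>g h. g \<in> carrier G \<Longrightarrow> h \<in> carrier G \<Longrightarrow> \<chi> (g \<otimes> h) = \<chi> g * \<chi> h"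
  shows "\<chi> \<in> Irr G 1"
proof -
  define \<rho> where "\<rho> g = mat 1 1 (\<lambda>_. \<chi> g)" for g
  have "matrix_rep G 1 \<rho>"
  proof (rule matrix_repI)
    show "\<rho> (g \<otimes> h) = \<rho> g * \<rho> h" if "g \<in> carrier G" "h \<in> carrier G" for g h
      using that by (intro eq_matI) (auto simp: \<rho>_def \<chi>(3) scalar_prod_def)
    show "\<rho> \<one> = 1\<^sub>m 1" by (intro eq_matI) (auto simp: \<rho>_def \<chi>(2))
  qed (simp add: \<rho>_def)
  moreover have "W = {0\<^sub>v 1} \<or> W = carrier_vec 1"
    if W: "W \<subseteq> carrier_vec 1" "0\<^sub>v 1 \<in> W" "\<forall>c. \<forall>v\<in>W. c \<cdot>\<^sub>v v \<in> W" for W :: "complex vec set"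
  proof (cases "W = {0\<^sub>v 1}")
    case False
    then obtain v where v: "v \<in> W" "v \<noteq> 0\<^sub>v 1" using W(2) by blast
    hence vc: "v \<in> carrier_vec 1" using W by blast
    hence v0: "v $ 0 \<noteq> 0" using v(2) by (auto simp: vec_eq_iff)
    have "u \<in> W" if u: "u \<in> carrier_vec 1" for u
    proof -
      have "u = (u $ 0 / v $ 0) \<cdot>\<^sub>v v" using u vc v0 by (auto simp: vec_eq_iff)
      thus ?thesis using W(3) v(1) by metis
    qed
    thus ?thesis using W by blast
  qed simp
  ultimately have "irreducible_rep G 1 \<rho>"
    unfolding irreducible_rep_def subspace_vec_iff by simp
  moreover have "rep_character G 1 \<rho> = \<chi>"
    using \<chi>(1) by (auto simp: rep_character_def \<rho>_def fun_eq_iff extensional_def restrict_def)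
  ultimately show ?thesis unfolding Irr_def by blast
qed

text \<open>The traces of T S and S T, for an intertwiner T with inverse S, give equal dimensions,
  and \<open>\<rho>1 g\<close> is \<open>\<chi> g\<close> times a conjugate of
  \<open>\<rho>2 g\<close>. Comparing entries of multiples of the nonzero matrix
  \<open>T * \<rho>2 (g \<otimes> h)\<close> shows that \<open>\<chi>\<close> is
  multiplicative.\<close>

lemma twist_equivalent_if_same_central_character:
  assumes \<rho>1: "irreducible_rep G d1 \<rho>1" and \<rho>2: "irreducible_rep G d2 \<rho>2"
    and comm: "\<And>g h. g \<in> carrier G \<Longrightarrow> h \<in> carrier G \<Longrightarrow> \<exists>z\<in>carrier G. \<exists>c.
      g \<otimes> h = z \<otimes> (h \<otimes> g) \<and> \<rho>1 z = c \<cdot>\<^sub>m 1\<^sub>m d1 \<and> \<rho>2 z = c \<cdot>\<^sub>m 1\<^sub>m d2"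
  shows "d1 = d2" "(rep_character G d1 \<rho>1, rep_character G d2 \<rho>2) \<in> twist_rel G d1"
proof -
  note I1 = irreducible_repD[OF \<rho>1] and I2 = irreducible_repD[OF \<rho>2]
  note R1 = matrix_repD[OF I1(1)] and R2 = matrix_repD[OF I2(1)]
  obtain T \<chi> where T: "T \<in> carrier_mat d1 d2" "T \<noteq> 0\<^sub>m d1 d2"
    and tw: "\<And>g. g \<in> carrier G \<Longrightarrow> \<rho>1 g * T = \<chi> g \<cdot>\<^sub>m (T * \<rho>2 g)"
    using exists_twisted_intertwiner[OF I1(1,2) I2(1,2) comm] by blast
  obtain S where S: "S \<in> carrier_mat d2 d1" "T * S = 1\<^sub>m d1" "S * T = 1\<^sub>m d2"
    using intertwiner_bijective[OF \<rho>1 \<rho>2 T tw] by blast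
  have "of_nat d1 = (of_nat d2 :: complex)"
    using trace_mult_commute[OF T(1) S(1)] S(2,3) by simp
  thus d: "d1 = d2" by simp
  have conj: "\<rho>1 g = \<chi> g \<cdot>\<^sub>m (T * \<rho>2 g * S)" if g: "g \<in> carrier G" for g
  proof -
    note c = R1(1)[OF g] R2(1)[OF g]
    have "\<rho>1 g = \<rho>1 g * (T * S)" using c by (simp add: S)
    also have "\<dots> = \<rho>1 g * T * S" by (rule assoc_mult_mat[OF c(1) T(1) S(1), symmetric])
    also have "\<dots> = \<chi> g \<cdot>\<^sub>m (T * \<rho>2 g * S)"
      unfolding tw[OF g] by (rule mult_smult_assoc_mat[OF mult_carrier_mat[OF T(1) c(2)] S(1)])
    finally show ?thesis .
  qed
  have tr: "(\<Sum>i<d1. \<rho>1 g $$ (i, i)) = \<chi> g * (\<Sum>i<d2. \<rho>2 g $$ (i, i))" if g: "g \<in> carrier G" for g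
  proof -
    note c = R1(1)[OF g] R2(1)[OF g]
    have "(\<Sum>i<d1. \<rho>1 g $$ (i, i)) = \<chi> g * (\<Sum>i<d1. (T * (\<rho>2 g * S)) $$ (i, i))"
      unfolding conj[OF g] assoc_mult_mat[OF T(1) c(2) S(1)] sum_distrib_left
      using T S c by (intro sum.cong) auto
    also have "(\<Sum>i<d1. (T * (\<rho>2 g * S)) $$ (i, i)) = (\<Sum>i<d2. ((\<rho>2 g * S) * T) $$ (i, i))"
      by (rule trace_mult_commute[OF T(1) mult_carrier_mat[OF c(2) S(1)]])
    also have "(\<rho>2 g * S) * T = \<rho>2 g"
      using c S T by (simp add: assoc_mult_mat[OF c(2) S(1) T(1)])
    finally show ?thesis .
  qed
  have mult: "\<chi> (g \<otimes> h) = \<chi> g * \<chi> h" if gh: "g \<in> carrier G" "h \<in> carrier G" for g h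
  proof -
    note c = R1(1)[OF gh(1)] R1(1)[OF gh(2)] R2(1)[OF gh(1)] R2(1)[OF gh(2)]
    have "\<chi> (g \<otimes> h) \<cdot>\<^sub>m (T * \<rho>2 (g \<otimes> h)) = \<rho>1 g * \<rho>1 h * T"
      using tw[of "g \<otimes> h"] gh by (simp add: R1(2))
    also have "\<dots> = \<rho>1 g * (\<rho>1 h * T)" by (rule assoc_mult_mat[OF c(1,2) T(1)])
    also have "\<dots> = \<chi> h \<cdot>\<^sub>m (\<rho>1 g * T * \<rho>2 h)"
      unfolding tw[OF gh(2)] using mult_smult_distrib[OF c(1) mult_carrier_mat[OF T(1) c(4)]]
        assoc_mult_mat[OF c(1) T(1) c(4)] by simp
    also have "\<dots> = (\<chi> g * \<chi> h) \<cdot>\<^sub>m (T * \<rho>2 (g \<otimes> h))"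
      unfolding tw[OF gh(1)] mult_smult_assoc_mat[OF mult_carrier_mat[OF T(1) c(3)] c(4)]
        assoc_mult_mat[OF T(1) c(3,4)] R2(2)[OF gh] by (intro eq_matI) auto
    finally have eq: "\<chi> (g \<otimes> h) \<cdot>\<^sub>m (T * \<rho>2 (g \<otimes> h)) = (\<chi> g * \<chi> h) \<cdot>\<^sub>m (T * \<rho>2 (g \<otimes> h))" .
    define X where "X = T * \<rho>2 (g \<otimes> h)"
    have X: "X \<in> carrier_mat d1 d2" using T R2(1)[of "g \<otimes> h"] gh by (simp add: X_def)
    have "X \<noteq> 0\<^sub>m d1 d2"
    proof
      assume "X = 0\<^sub>m d1 d2"
      hence "X * \<rho>2 (inv (g \<otimes> h)) = 0\<^sub>m d1 d2"
        using R2(1)[OF inv_closed[of "g \<otimes> h"]] gh by simp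
      moreover have "X * \<rho>2 (inv (g \<otimes> h)) = T * (\<rho>2 (g \<otimes> h) * \<rho>2 (inv (g \<otimes> h)))"
        unfolding X_def
        by (rule assoc_mult_mat[OF T(1) R2(1)[OF m_closed[OF gh]] R2(1)[OF inv_closed[OF m_closed[OF gh]]]])
      ultimately show False
        using matrix_rep_inv(2)[OF I2(1), of "g \<otimes> h"] gh T by simp
    qed
    then obtain i j where ij: "i < d1" "j < d2" "X $$ (i, j) \<noteq> 0" using X by (auto simp: mat_eq_iff)
    have "(\<chi> (g \<otimes> h) \<cdot>\<^sub>m X) $$ (i, j) = ((\<chi> g * \<chi> h) \<cdot>\<^sub>m X) $$ (i, j)"
      using eq by (simp only: X_def)
    thus ?thesis using ij X by simp
  qed
  have one: "\<chi> \<one> = 1"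
  proof -
    have "of_nat d1 = \<chi> \<one> * of_nat d2" using tr[OF one_closed] by (simp add: R1(3) R2(3))
    thus ?thesis using d I1(2) by simp
  qed
  have "restrict \<chi> (carrier G) \<in> Irr G 1"
    using mult one by (intro Irr_1I) auto
  moreover have "rep_character G d1 \<rho>1 = (\<lambda>g\<in>carrier G. restrict \<chi> (carrier G) g * rep_character G d2 \<rho>2 g)"
    using tr by (auto simp: rep_character_def fun_eq_iff restrict_def)
  moreover have "rep_character G d1 \<rho>1 \<in> Irr G d1" "rep_character G d2 \<rho>2 \<in> Irr G d1"
    using \<rho>1 \<rho>2 d by (auto simp: Irr_def)
  ultimately show "(rep_character G d1 \<rho>1, rep_character G d2 \<rho>2) \<in> twist_rel G d1"
    unfolding twist_rel_def by blast
qed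

end

section \<open>Representations of the groups of points\<close>

locale gmn = number_ring R for R :: "'k :: field_char_0 set" +
  fixes m n :: nat
begin

definition ring_str :: "'k ring" where
  "ring_str = class_ring\<lparr>carrier := R\<rparr>"

lemma cring_ring_str: "cring ring_str"
proof (rule cringI)
  show "abelian_group ring_str"
  proof (rule abelian_groupI)
    fix x assume "x \<in> carrier ring_str"
    thus "\<exists>y\<in>carrier ring_str. y \<oplus>\<^bsub>ring_str\<^esub> x = \<zero>\<^bsub>ring_str\<^esub>"
      by (intro bexI[of _ "- x"]) (auto simp: ring_str_def R_closed)
  qed (auto simp: ring_str_def R_closed)
  show "comm_monoid ring_str"
    by (rule comm_monoidI) (auto simp: ring_str_def R_closed)
qed (auto simp: ring_str_def algebra_simps)

abbreviation G where "G \<equiv> Gmn m n ring_str"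

sublocale G: group G
  by (rule cring.group_Gmn[OF cring_ring_str])

text \<open>Group elements carry vectors that are undefined outside the index range;
  \<open>zext\<close> turns them into sequences as in \<open>vecs m\<close>, and
  \<open>mcols\<close> does the same for the columns of a matrix.\<close>

definition zext :: "(nat \<Rightarrow> 'k) \<Rightarrow> nat \<Rightarrow> 'k" where
  "zext a = (\<lambda>i. if i < m then a i else 0)"

definition mcols :: "(nat \<times> nat \<Rightarrow> 'k) \<Rightarrow> nat \<Rightarrow> nat \<Rightarrow> 'k" where
  "mcols c j = (\<lambda>i. if i < m then c (i, j) else 0)"

text \<open>Central elements are described by the columns of their matrix, so that characters of
  this subgroup split into characters of R^m.\<close>

definition zel :: "(nat \<Rightarrow> nat \<Rightarrow> 'k) \<Rightarrow> (nat \<Rightarrow> 'k) \<times> (nat \<Rightarrow> 'k) \<times> (nat \<times> nat \<Rightarrow> 'k)" where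
  "zel v = (\<lambda>i\<in>{..<m}. 0, \<lambda>j\<in>{..<n}. 0, \<lambda>(i, j)\<in>{..<m} \<times> {..<n}. v j i)"

lemma carrier_G: "(a, b, c) \<in> carrier G \<longleftrightarrow> a \<in> {..<m} \<rightarrow>\<^sub>E R \<and> b \<in> {..<n} \<rightarrow>\<^sub>E R \<and> c \<in> {..<m} \<times> {..<n} \<rightarrow>\<^sub>E R"
  by (simp add: Gmn_def ring_str_def)

lemma mult_G: "(a, b, c) \<otimes>\<^bsub>G\<^esub> (a', b', c') =
    (\<lambda>i\<in>{..<m}. a i + a' i, \<lambda>j\<in>{..<n}. b j + b' j,
     \<lambda>(i, j)\<in>{..<m} \<times> {..<n}. c (i, j) + c' (i, j) + a i * b' j)"
  by (simp add: Gmn_def ring_str_def)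

lemma one_G: "\<one>\<^bsub>G\<^esub> = zel (\<lambda>_. 0)"
  by (simp add: Gmn_def ring_str_def zel_def)

lemma vecsD: "x \<in> vecs m \<Longrightarrow> i < m \<Longrightarrow> x i \<in> R" "x \<in> vecs m \<Longrightarrow> \<not> i < m \<Longrightarrow> x i = 0"
  by (auto simp: vecs_def)

lemmas vecs_add_subgroup = submodD(1)[OF submod_vecs[of m]]
lemmas vecs_closed = add_subgroupD[OF vecs_add_subgroup] submodD(2)[OF submod_vecs[of m]]

text \<open>Only the entries below n are constrained, so equality of such families is replaced by
  agreement below n in \<open>zel_cong\<close> and \<open>cchar_cong\<close>.\<close>

definition vfams :: "(nat \<Rightarrow> nat \<Rightarrow> 'k) set" where
  "vfams = {v. \<forall>j<n. v j \<in> vecs m}"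

lemma vfamsI: "(\<And>j. j < n \<Longrightarrow> v j \<in> vecs m) \<Longrightarrow> v \<in> vfams"
  by (simp add: vfams_def)

lemma vfamsD: "v \<in> vfams \<Longrightarrow> j < n \<Longrightarrow> v j \<in> vecs m"
  by (simp add: vfams_def)

lemma vfams_add: "v \<in> vfams \<Longrightarrow> w \<in> vfams \<Longrightarrow> (\<lambda>j. v j + w j) \<in> vfams"
  by (simp add: vfams_def vecs_closed)

lemma vfams_0: "(\<lambda>_. 0) \<in> vfams"
  by (simp add: vfams_def vecs_closed)

lemma vfams_vscale: "x \<in> vecs m \<Longrightarrow> (\<And>j. j < n \<Longrightarrow> b j \<in> R) \<Longrightarrow> (\<lambda>j. vscale (b j) x) \<in> vfams"
  by (simp add: vfams_def vecs_closed)

lemma zext_vecs: "a \<in> {..<m} \<rightarrow>\<^sub>E R \<Longrightarrow> zext a \<in> vecs m"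
  by (auto simp: zext_def vecs_def PiE_iff)

lemma zext_restrict: "x \<in> vecs m \<Longrightarrow> zext (restrict x {..<m}) = x"
  by (auto simp: zext_def vecs_def fun_eq_iff)

lemma restrict_vecs: "x \<in> vecs m \<Longrightarrow> restrict x {..<m} \<in> {..<m} \<rightarrow>\<^sub>E R"
  by (auto simp: vecs_def)

lemma mcols_vecs: "c \<in> {..<m} \<times> {..<n} \<rightarrow>\<^sub>E R \<Longrightarrow> j < n \<Longrightarrow> mcols c j \<in> vecs m"
  by (auto simp: mcols_def vecs_def PiE_iff)

lemma zel_carrier: "v \<in> vfams \<Longrightarrow> zel v \<in> carrier G"
  unfolding zel_def carrier_G by (auto simp: R_closed vecs_def vfams_def)

lemma zel_cong: "(\<And>j. j < n \<Longrightarrow> v j = w j) \<Longrightarrow> zel v = zel w"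
  by (auto simp: zel_def fun_eq_iff)

lemma zel_mult: "zel v \<otimes>\<^bsub>G\<^esub> zel w = zel (\<lambda>j. v j + w j)"
  unfolding zel_def mult_G by (auto simp: fun_eq_iff)

lemma zel_central: "g \<in> carrier G \<Longrightarrow> zel v \<otimes>\<^bsub>G\<^esub> g = g \<otimes>\<^bsub>G\<^esub> zel v"
  by (cases g) (auto simp: zel_def mult_G fun_eq_iff algebra_simps)

lemma commutator_G:
  "(a, b, c) \<otimes>\<^bsub>G\<^esub> (a', b', c') =
    zel (\<lambda>j. vscale (b' j) (zext a) - vscale (b j) (zext a')) \<otimes>\<^bsub>G\<^esub> ((a', b', c') \<otimes>\<^bsub>G\<^esub> (a, b, c))"
  unfolding zel_def mult_G by (auto simp: fun_eq_iff zext_def algebra_simps)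

text \<open>A character of the additive group of m by n matrices, split into one character of R^m
  for each column; \<open>cchar\<close> puts them together again.\<close>

definition families :: "(nat \<Rightarrow> (nat \<Rightarrow> 'k) \<Rightarrow> complex) set" where
  "families = {..<n} \<rightarrow>\<^sub>E add_chars (vecs m)"

lemma familiesD:
  assumes "\<Psi> \<in> families" and "j < n"
  shows "\<Psi> j \<in> add_chars (vecs m)" "\<Psi> j 0 = 1"
    "x \<in> vecs m \<Longrightarrow> \<Psi> j x \<noteq> 0" "x \<in> vecs m \<Longrightarrow> y \<in> vecs m \<Longrightarrow> \<Psi> j (x + y) = \<Psi> j x * \<Psi> j y"
    "x \<in> vecs m \<Longrightarrow> y \<in> vecs m \<Longrightarrow> \<Psi> j (x - y) = \<Psi> j x / \<Psi> j y"
proof -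
  show 1: "\<Psi> j \<in> add_chars (vecs m)" using assms by (auto simp: families_def)
  show "\<Psi> j 0 = 1" by (rule add_chars_0[OF vecs_add_subgroup 1])
  show "x \<in> vecs m \<Longrightarrow> \<Psi> j x \<noteq> 0" "x \<in> vecs m \<Longrightarrow> y \<in> vecs m \<Longrightarrow> \<Psi> j (x + y) = \<Psi> j x * \<Psi> j y"
    using add_charsD[OF 1] by auto
  show "x \<in> vecs m \<Longrightarrow> y \<in> vecs m \<Longrightarrow> \<Psi> j (x - y) = \<Psi> j x / \<Psi> j y"
    by (rule add_chars_diff[OF vecs_add_subgroup 1])
qed

definition cchar :: "(nat \<Rightarrow> (nat \<Rightarrow> 'k) \<Rightarrow> complex) \<Rightarrow> (nat \<Rightarrow> nat \<Rightarrow> 'k) \<Rightarrow> complex" where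
  "cchar \<Psi> v = (\<Prod>j<n. \<Psi> j (v j))"

lemma cchar_add:
  assumes "\<Psi> \<in> families" "v \<in> vfams" "w \<in> vfams"
  shows "cchar \<Psi> (\<lambda>j. v j + w j) = cchar \<Psi> v * cchar \<Psi> w"
  using assms by (simp add: cchar_def familiesD prod.distrib vfams_def)

lemma cchar_nonzero:
  assumes "\<Psi> \<in> families" "v \<in> vfams"
  shows "cchar \<Psi> v \<noteq> 0"
  using assms by (auto simp: cchar_def familiesD vfams_def)

lemma cchar_0: "\<Psi> \<in> families \<Longrightarrow> cchar \<Psi> (\<lambda>_. 0) = 1"
  by (simp add: cchar_def familiesD)

lemma cchar_cong: "(\<And>j. j < n \<Longrightarrow> v j = w j) \<Longrightarrow> cchar \<Psi> v = cchar \<Psi> w"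
  by (simp add: cchar_def)

definition single :: "nat \<Rightarrow> (nat \<Rightarrow> 'k) \<Rightarrow> nat \<Rightarrow> nat \<Rightarrow> 'k" where
  "single j x = (\<lambda>j'. if j' = j then x else 0)"

lemma single_vfams: "x \<in> vecs m \<Longrightarrow> single j x \<in> vfams"
  by (simp add: single_def vecs_closed vfams_def)

lemma cchar_single:
  assumes \<Psi>: "\<Psi> \<in> families" and j: "j < n" and x: "x \<in> vecs m"
  shows "cchar \<Psi> (single j x) = \<Psi> j x"
proof -
  have "cchar \<Psi> (single j x) = (\<Prod>j'<n. if j' = j then \<Psi> j x else 1)"
    unfolding cchar_def single_def using familiesD(2)[OF \<Psi>] by (intro prod.cong) auto
  thus ?thesis using j by simp
qed

text \<open>The commutator pairing: the value of the central character at the matrix x b^T, whose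
  column j is \<open>vscale (b j) x\<close>.\<close>

definition pair :: "(nat \<Rightarrow> (nat \<Rightarrow> 'k) \<Rightarrow> complex) \<Rightarrow> (nat \<Rightarrow> 'k) \<Rightarrow> (nat \<Rightarrow> 'k) \<Rightarrow> complex" where
  "pair \<Psi> x b = cchar \<Psi> (\<lambda>j. vscale (b j) x)"

text \<open>The condition that x pairs to 1 with every b, tested on those b that have at most one
  nonzero entry.\<close>

definition rad :: "(nat \<Rightarrow> (nat \<Rightarrow> 'k) \<Rightarrow> complex) \<Rightarrow> (nat \<Rightarrow> 'k) set" where
  "rad \<Psi> = {x \<in> vecs m. \<forall>r\<in>R. \<forall>j<n. \<Psi> j (vscale r x) = 1}"

section \<open>The pairing and its radical for a fixed central character\<close>

context
  fixes \<Psi> assumes \<Psi>: "\<Psi> \<in> families"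
begin

lemma pair_add_left:
  assumes "x \<in> vecs m" "y \<in> vecs m" "\<And>j. j < n \<Longrightarrow> b j \<in> R"
  shows "pair \<Psi> (x + y) b = pair \<Psi> x b * pair \<Psi> y b"
  unfolding pair_def using assms by (simp add: vscale_simps cchar_add[OF \<Psi>] vfams_vscale)

lemma pair_diff_left:
  assumes "x \<in> vecs m" "y \<in> vecs m" "\<And>j. j < n \<Longrightarrow> b j \<in> R"
  shows "pair \<Psi> (x - y) b = pair \<Psi> x b / pair \<Psi> y b"
  unfolding pair_def cchar_def using assms
  by (simp add: vscale_simps familiesD[OF \<Psi>] vecs_closed prod_dividef)

lemma pair_add_right:
  assumes "x \<in> vecs m" "\<And>j. j < n \<Longrightarrow> b j \<in> R" "\<And>j. j < n \<Longrightarrow> b' j \<in> R"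
  shows "pair \<Psi> x (\<lambda>j. b j + b' j) = pair \<Psi> x b * pair \<Psi> x b'"
  unfolding pair_def using assms by (simp add: vscale_simps cchar_add[OF \<Psi>] vfams_vscale)

lemma pair_nonzero:
  "x \<in> vecs m \<Longrightarrow> (\<And>j. j < n \<Longrightarrow> b j \<in> R) \<Longrightarrow> pair \<Psi> x b \<noteq> 0"
  unfolding pair_def by (intro cchar_nonzero[OF \<Psi>] vfams_vscale)

lemma submod_rad: "submod (rad \<Psi>)"
  unfolding submod_def add_subgroup_def rad_def
  using familiesD[OF \<Psi>] by (auto simp: vecs_closed vscale_simps R_closed)

lemma rad_subset: "rad \<Psi> \<subseteq> vecs m"
  by (auto simp: rad_def)

lemmas rad_add_subgroup = submodD(1)[OF submod_rad]

lemma pair_rad: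
  assumes "x \<in> rad \<Psi>" "\<And>j. j < n \<Longrightarrow> b j \<in> R"
  shows "pair \<Psi> x b = 1"
  using assms by (simp add: pair_def cchar_def rad_def)

lemma pair_eq_if_diff_rad:
  assumes "x \<in> vecs m" "y \<in> vecs m" "x - y \<in> rad \<Psi>" "\<And>j. j < n \<Longrightarrow> b j \<in> R"
  shows "pair \<Psi> x b = pair \<Psi> y b"
  using pair_rad[OF assms(3,4)] pair_diff_left[OF assms(1,2,4)] pair_nonzero[OF assms(2,4)] by simp

text \<open>Applied to a difference x - y it yields some b that acts by different factors on the
  cosets of x and y; irreducibility rests on this.\<close>

lemma exists_separating:
  assumes x: "x \<in> vecs m" "x \<notin> rad \<Psi>"
  obtains b where "b \<in> {..<n} \<rightarrow>\<^sub>E R" "pair \<Psi> x b \<noteq> 1"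
proof -
  obtain r j where rj: "r \<in> R" "j < n" "\<Psi> j (vscale r x) \<noteq> 1" using x by (auto simp: rad_def)
  define b where "b = (\<lambda>j'\<in>{..<n}. if j' = j then r else 0)"
  have "pair \<Psi> x b = cchar \<Psi> (single j (vscale r x))"
    unfolding pair_def by (rule cchar_cong) (auto simp: b_def single_def vscale_simps)
  also have "\<dots> = \<Psi> j (vscale r x)" by (rule cchar_single[OF \<Psi> rj(2)]) (use rj x in \<open>simp add: vecs_closed\<close>)
  finally have "pair \<Psi> x b \<noteq> 1" using rj by simp
  moreover have "b \<in> {..<n} \<rightarrow>\<^sub>E R" using rj by (auto simp: b_def R_closed)
  ultimately show ?thesis using that by blast
qed

lemma coset_representatives:
  assumes d: "d = idx (vecs m) (rad \<Psi>)" "d > 0"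
  obtains r where "\<And>x. x < d \<Longrightarrow> r x \<in> vecs m" "\<And>x y. x < d \<Longrightarrow> y < d \<Longrightarrow> r x - r y \<in> rad \<Psi> \<Longrightarrow> x = y"
    "\<And>v. v \<in> vecs m \<Longrightarrow> \<exists>x<d. v - r x \<in> rad \<Psi>"
proof -
  have "finite (cosets (vecs m) (rad \<Psi>))" "card (cosets (vecs m) (rad \<Psi>)) = d"
    using d by (auto simp: idx_def card_gt_0_iff)
  then obtain e where e: "bij_betw e {0..<d} (cosets (vecs m) (rad \<Psi>))" using ex_bij_betw_nat_finite by blast
  have "\<exists>v. v \<in> vecs m \<and> e x = add_coset (rad \<Psi>) v" if "x < d" for x
  proof -
    have "e x \<in> cosets (vecs m) (rad \<Psi>)" using e that by (auto simp: bij_betw_def)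
    thus ?thesis by (auto simp: cosets_def)
  qed
  then obtain r where r: "\<And>x. x < d \<Longrightarrow> r x \<in> vecs m \<and> e x = add_coset (rad \<Psi>) (r x)" by metis
  show ?thesis
  proof (rule that)
    show "r x \<in> vecs m" if "x < d" for x using r that by blast
    show "x = y" if xy: "x < d" "y < d" "r x - r y \<in> rad \<Psi>" for x y
    proof -
      have "e x = e y" using xy r coset_eq_iff[OF rad_add_subgroup] by simp
      thus ?thesis using e xy by (auto simp: bij_betw_def inj_on_def)
    qed
    show "\<exists>x<d. v - r x \<in> rad \<Psi>" if v: "v \<in> vecs m" for v
    proof -
      have "add_coset (rad \<Psi>) v \<in> e ` {0..<d}" using e v by (auto simp: bij_betw_def cosets_def)
      then obtain x where x: "x < d" "add_coset (rad \<Psi>) v = e x" by auto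
      hence "add_coset (rad \<Psi>) v = add_coset (rad \<Psi>) (r x)" using r by simp
      thus ?thesis using x coset_eq_iff[OF rad_add_subgroup] by blast
    qed
  qed
qed

end

section \<open>Construction of an irreducible representation with a given central character\<close>

context
  fixes \<Psi> and d :: nat and r :: "nat \<Rightarrow> nat \<Rightarrow> 'k"
  assumes \<Psi>: "\<Psi> \<in> families" and d: "d > 0"
    and r: "\<And>x. x < d \<Longrightarrow> r x \<in> vecs m" and r_inj: "\<And>x y. x < d \<Longrightarrow> y < d \<Longrightarrow> r x - r y \<in> rad \<Psi> \<Longrightarrow> x = y"
    and r_sur: "\<And>v. v \<in> vecs m \<Longrightarrow> \<exists>x<d. v - r x \<in> rad \<Psi>"
begin

text \<open>
  The representation on functions on \<open>vecs m / rad \<Psi>\<close> in which \<open>(a, b, c)\<close> acts by translation by \<open>a\<close>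
  and multiplication by \<open>x \<mapsto> \<Psi> c * \<Psi> (x b\<^sup>T)\<close>.
\<close>

definition std_rep :: "(nat \<Rightarrow> 'k) \<times> (nat \<Rightarrow> 'k) \<times> (nat \<times> nat \<Rightarrow> 'k) \<Rightarrow> complex mat" where
  "std_rep = (\<lambda>(a, b, c). mat d d (\<lambda>(x, y).
     if r x + zext a - r y \<in> rad \<Psi> then cchar \<Psi> (mcols c) * pair \<Psi> (r x) b else 0))"

lemma std_rep_carrier: "std_rep g \<in> carrier_mat d d"
  by (cases g) (simp add: std_rep_def)

lemma std_rep_entry:
  assumes "x < d" "y < d"
  shows "std_rep (a, b, c) $$ (x, y) =
    (if r x + zext a - r y \<in> rad \<Psi> then cchar \<Psi> (mcols c) * pair \<Psi> (r x) b else 0)"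
  using assms by (simp add: std_rep_def)

lemma cchar_mcols_mult:
  assumes "(a, b, c) \<in> carrier G" "(a', b', c') \<in> carrier G"
  shows "cchar \<Psi> (mcols (\<lambda>(i, j)\<in>{..<m} \<times> {..<n}. c (i, j) + c' (i, j) + a i * b' j)) =
    cchar \<Psi> (mcols c) * cchar \<Psi> (mcols c') * pair \<Psi> (zext a) b'"
proof -
  have C: "mcols c \<in> vfams" "mcols c' \<in> vfams" "(\<lambda>j. vscale (b' j) (zext a)) \<in> vfams"
    using assms by (auto simp: carrier_G mcols_vecs zext_vecs intro!: vfamsI vecs_closed)
  have "cchar \<Psi> (mcols (\<lambda>(i, j)\<in>{..<m} \<times> {..<n}. c (i, j) + c' (i, j) + a i * b' j)) =
      cchar \<Psi> (\<lambda>j. (mcols c j + mcols c' j) + vscale (b' j) (zext a))"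
    by (rule cchar_cong) (auto simp: mcols_def zext_def fun_eq_iff)
  thus ?thesis using C by (simp add: cchar_add[OF \<Psi>] pair_def vfams_add)
qed

lemma std_rep_mult:
  assumes g: "g \<in> carrier G" and h: "h \<in> carrier G"
  shows "std_rep (g \<otimes>\<^bsub>G\<^esub> h) = std_rep g * std_rep h"
proof -
  obtain a b c a' b' c' where gh: "g = (a, b, c)" "h = (a', b', c')" by (metis prod_cases3)
  have ab: "a \<in> {..<m} \<rightarrow>\<^sub>E R" "a' \<in> {..<m} \<rightarrow>\<^sub>E R" "\<And>j. j < n \<Longrightarrow> b j \<in> R" "\<And>j. j < n \<Longrightarrow> b' j \<in> R"
    using g h by (auto simp: gh carrier_G)
  note z = zext_vecs[OF ab(1)] zext_vecs[OF ab(2)]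
  note rG = rad_add_subgroup[OF \<Psi>]
  have dims: "dim_row (std_rep g) = d" "dim_col (std_rep g) = d" for g
    using std_rep_carrier[of g] by auto
  show ?thesis
  proof (rule eq_matI)
    fix x z assume "x < dim_row (std_rep g * std_rep h)" "z < dim_col (std_rep g * std_rep h)"
    hence xz: "x < d" "z < d" using std_rep_carrier[of g] std_rep_carrier[of h] by auto
    obtain y0 where y0: "y0 < d" "r x + zext a - r y0 \<in> rad \<Psi>"
      using r_sur[of "r x + zext a"] r xz z by (auto simp: vecs_closed)
    \<comment> \<open>Row x of the matrix of g is supported in the single column y0, which belongs
      to the coset of \<open>r x + zext a\<close>.\<close>
    have uniq: "r x + zext a - r y \<in> rad \<Psi> \<longleftrightarrow> y = y0" if "y < d" for y
    proof
      assume "r x + zext a - r y \<in> rad \<Psi>"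
      hence "(r x + zext a - r y0) - (r x + zext a - r y) \<in> rad \<Psi>" by (rule add_subgroupD(2)[OF rG y0(2)])
      moreover have "(r x + zext a - r y0) - (r x + zext a - r y) = r y - r y0" by simp
      ultimately show "y = y0" using r_inj[OF that y0(1)] by simp
    qed (use y0 in simp)
    have "(std_rep g * std_rep h) $$ (x, z) = (\<Sum>y<d. std_rep g $$ (x, y) * std_rep h $$ (y, z))"
      using xz std_rep_carrier[of g] std_rep_carrier[of h] by (simp add: scalar_prod_def atLeast0LessThan)
    also have "\<dots> = (\<Sum>y<d. if y = y0 then cchar \<Psi> (mcols c) * pair \<Psi> (r x) b * std_rep h $$ (y0, z) else 0)"
      using xz uniq by (intro sum.cong) (auto simp: std_rep_def gh)
    also have "\<dots> = cchar \<Psi> (mcols c) * pair \<Psi> (r x) b * std_rep h $$ (y0, z)" using y0 by simp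
    also have "std_rep h $$ (y0, z) =
        (if r y0 + zext a' - r z \<in> rad \<Psi> then cchar \<Psi> (mcols c') * pair \<Psi> (r y0) b' else 0)"
      using y0 xz by (simp add: std_rep_def gh)
    \<comment> \<open>Replacing r y0 by \<open>r x + zext a\<close> produces the factor
      \<open>pair \<Psi> (zext a) b'\<close>, which matches the term a b'^T in the group
      multiplication.\<close>
    also have "pair \<Psi> (r y0) b' = pair \<Psi> (r x) b' * pair \<Psi> (zext a) b'"
      using pair_eq_if_diff_rad[OF \<Psi> _ _ y0(2), of b'] r xz y0 z ab(4)
      by (simp add: pair_add_left[OF \<Psi>] vecs_closed)
    also have "r y0 + zext a' - r z \<in> rad \<Psi> \<longleftrightarrow> r x + (zext a + zext a') - r z \<in> rad \<Psi>"
    proof -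
      have eq: "r x + (zext a + zext a') - r z = (r x + zext a - r y0) + (r y0 + zext a' - r z)" by simp
      show ?thesis unfolding eq add_subgroup_add_iff[OF rG y0(2)] ..
    qed
    finally have eq: "(std_rep g * std_rep h) $$ (x, z) = cchar \<Psi> (mcols c) * pair \<Psi> (r x) b *
      (if r x + (zext a + zext a') - r z \<in> rad \<Psi>
       then cchar \<Psi> (mcols c') * (pair \<Psi> (r x) b' * pair \<Psi> (zext a) b') else 0)" .
    have za: "zext (\<lambda>i\<in>{..<m}. a i + a' i) = zext a + zext a'" by (auto simp: zext_def fun_eq_iff)
    have pb: "pair \<Psi> (r x) (\<lambda>j\<in>{..<n}. b j + b' j) = pair \<Psi> (r x) b * pair \<Psi> (r x) b'"
      using pair_add_right[OF \<Psi> r[OF xz(1)] ab(3,4)] by (simp add: pair_def cchar_def)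
    show "std_rep (g \<otimes>\<^bsub>G\<^esub> h) $$ (x, z) = (std_rep g * std_rep h) $$ (x, z)"
      unfolding gh mult_G std_rep_entry[OF xz] za pb cchar_mcols_mult[OF g[unfolded gh] h[unfolded gh]]
        eq[unfolded gh] by simp
  qed (simp_all add: dims)
qed

lemma std_rep_zel:
  assumes v: "v \<in> vfams"
  shows "std_rep (zel v) = cchar \<Psi> v \<cdot>\<^sub>m 1\<^sub>m d"
proof (rule eq_matI)
  fix x y assume "x < dim_row (cchar \<Psi> v \<cdot>\<^sub>m 1\<^sub>m d)" "y < dim_col (cchar \<Psi> v \<cdot>\<^sub>m 1\<^sub>m d)"
  hence xy: "x < d" "y < d" by auto
  have 1: "zext (\<lambda>i\<in>{..<m}. 0) = 0" by (auto simp: zext_def fun_eq_iff)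
  have 2: "pair \<Psi> v (\<lambda>j\<in>{..<n}. 0) = 1" for v
    unfolding pair_def using cchar_0[OF \<Psi>] by (simp add: cchar_def vscale_simps)
  have 3: "cchar \<Psi> (mcols (\<lambda>(i, j)\<in>{..<m} \<times> {..<n}. v j i)) = cchar \<Psi> v"
    using vfamsD[OF v] by (intro cchar_cong) (auto simp: mcols_def fun_eq_iff vecsD)
  have 4: "r x - r y \<in> rad \<Psi> \<longleftrightarrow> x = y"
    using r_inj[OF xy] add_subgroupD(1)[OF rad_add_subgroup[OF \<Psi>]] by auto
  show "std_rep (zel v) $$ (x, y) = (cchar \<Psi> v \<cdot>\<^sub>m 1\<^sub>m d) $$ (x, y)"
    using xy by (simp add: std_rep_def zel_def 1 2 3 4)
qed (simp_all add: std_rep_def zel_def)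

lemma std_rep_matrix_rep: "matrix_rep G d std_rep"
proof (rule G.matrix_repI[OF std_rep_carrier std_rep_mult])
  show "std_rep \<one>\<^bsub>G\<^esub> = 1\<^sub>m d"
    unfolding one_G by (subst std_rep_zel[OF vfams_0]) (auto simp: cchar_0[OF \<Psi>] intro!: eq_matI)
qed

lemma std_rep_diagonal:
  assumes b: "b \<in> {..<n} \<rightarrow>\<^sub>E R" and w: "w \<in> carrier_vec d" and x: "x < d"
  shows "(std_rep (\<lambda>i\<in>{..<m}. 0, b, \<lambda>_\<in>{..<m} \<times> {..<n}. 0) *\<^sub>v w) $ x = pair \<Psi> (r x) b * w $ x"
proof -
  have 1: "zext (\<lambda>i\<in>{..<m}. 0) = 0" by (auto simp: zext_def fun_eq_iff)
  have 3: "cchar \<Psi> (mcols (\<lambda>_\<in>{..<m} \<times> {..<n}. 0)) = 1"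
    unfolding cchar_0[OF \<Psi>, symmetric] by (intro cchar_cong) (auto simp: mcols_def fun_eq_iff)
  have 4: "r x - r y \<in> rad \<Psi> \<longleftrightarrow> y = x" if "y < d" for y
    using r_inj[OF x that] add_subgroupD(1)[OF rad_add_subgroup[OF \<Psi>]] by auto
  have "(std_rep (\<lambda>i\<in>{..<m}. 0, b, \<lambda>_\<in>{..<m} \<times> {..<n}. 0) *\<^sub>v w) $ x =
      (\<Sum>y<d. (if y = x then pair \<Psi> (r x) b else 0) * w $ y)"
    using x w by (simp add: std_rep_def scalar_prod_def atLeast0LessThan 1 3 4 cong: if_cong)
  also have "\<dots> = (\<Sum>y<d. if y = x then pair \<Psi> (r x) b * w $ x else 0)"
    by (rule sum.cong) auto
  finally show ?thesis using x by simp
qed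

lemma std_rep_translation:
  assumes x: "x < d" and z: "z < d"
  shows "std_rep (restrict (r z - r x) {..<m}, \<lambda>j\<in>{..<n}. 0, \<lambda>_\<in>{..<m} \<times> {..<n}. 0) *\<^sub>v unit_vec d z =
    unit_vec d x"
proof (rule eq_vecI)
  fix u assume "u < dim_vec (unit_vec d x)"
  hence u: "u < d" by simp
  have 1: "zext (restrict (r z - r x) {..<m}) = r z - r x" using r x z by (intro zext_restrict vecs_closed)
  have 2: "pair \<Psi> v (\<lambda>j\<in>{..<n}. 0) = 1" for v
    unfolding pair_def using cchar_0[OF \<Psi>] by (simp add: cchar_def vscale_simps)
  have 3: "cchar \<Psi> (mcols (\<lambda>_\<in>{..<m} \<times> {..<n}. 0)) = 1"
    unfolding cchar_0[OF \<Psi>, symmetric] by (intro cchar_cong) (auto simp: mcols_def fun_eq_iff)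
  have 4: "r u - r x \<in> rad \<Psi> \<longleftrightarrow> u = x"
    using r_inj[OF u x] add_subgroupD(1)[OF rad_add_subgroup[OF \<Psi>]] by auto
  have "r u + (r z - r x) - r z = r u - r x" by simp
  thus "(std_rep (restrict (r z - r x) {..<m}, \<lambda>j\<in>{..<n}. 0, \<lambda>_\<in>{..<m} \<times> {..<n}. 0) *\<^sub>v unit_vec d z) $ u =
      unit_vec d x $ u"
    using u z x by (simp add: std_rep_def 1 2 3 4)
qed (simp add: std_rep_def)

text \<open>In a nonzero invariant subspace take a nonzero vector of least support. If its support
  had two positions, some b would act on them by different factors, and subtracting a multiple of
  the vector would remove one position and keep the other. So a unit vector lies in the subspace,
  and translations carry it to all others.\<close>

lemma std_rep_irreducible: "irreducible_rep G d std_rep"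
proof -
  have "W = carrier_vec d"
    if W: "W \<subseteq> carrier_vec d" "0\<^sub>v d \<in> W" "\<forall>v\<in>W. \<forall>w\<in>W. v + w \<in> W" "\<forall>c. \<forall>v\<in>W. c \<cdot>\<^sub>v v \<in> W"
      and inv: "\<forall>g\<in>carrier G. \<forall>w\<in>W. std_rep g *\<^sub>v w \<in> W" and nz: "W \<noteq> {0\<^sub>v d}" for W
  proof -
    define supp where "supp w = {x. x < d \<and> w $ x \<noteq> (0 :: complex)}" for w :: "complex vec"
    have fin: "finite (supp w)" for w by (simp add: supp_def)
    obtain w0 where w0: "w0 \<in> W" "w0 \<noteq> 0\<^sub>v d" using nz W(2) by blast
    obtain w where w: "w \<in> W" "w \<noteq> 0\<^sub>v d"
      and min: "\<And>w'. w' \<in> W \<Longrightarrow> w' \<noteq> 0\<^sub>v d \<Longrightarrow> card (supp w) \<le> card (supp w')"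
      using arg_min_nat_lemma[of "\<lambda>w. w \<in> W \<and> w \<noteq> 0\<^sub>v d" w0 "\<lambda>w. card (supp w)"] w0 by blast
    have wc: "w \<in> carrier_vec d" using w W by blast
    obtain x where x: "x < d" "w $ x \<noteq> 0" using w(2) wc by (auto simp: vec_eq_iff)
    have only: "w $ y = 0" if y: "y < d" "y \<noteq> x" for y
    proof (rule ccontr)
      assume wy: "w $ y \<noteq> 0"
      have "r x - r y \<notin> rad \<Psi>" using r_inj[OF x(1) y(1)] y by auto
      then obtain b where b: "b \<in> {..<n} \<rightarrow>\<^sub>E R" "pair \<Psi> (r x - r y) b \<noteq> 1"
        using exists_separating[OF \<Psi>, of "r x - r y"] r x y by (auto simp: vecs_closed)
      have bR: "b j \<in> R" if "j < n" for j using b(1) that by auto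
      have ne: "pair \<Psi> (r x) b \<noteq> pair \<Psi> (r y) b"
        using b(2) pair_diff_left[OF \<Psi> r[OF x(1)] r[OF y(1)] bR] pair_nonzero[OF \<Psi> r[OF y(1)] bR] by auto
      define g where "g = (\<lambda>i\<in>{..<m}. 0 :: 'k, b, \<lambda>_\<in>{..<m} \<times> {..<n}. 0 :: 'k)"
      have "g \<in> carrier G" using b(1) by (auto simp: g_def carrier_G R_closed)
      \<comment> \<open>This combination vanishes at y and wherever w vanishes, but not at
        x.\<close>
      define w' where "w' = std_rep g *\<^sub>v w + (- pair \<Psi> (r y) b) \<cdot>\<^sub>v w"
      have w'W: "w' \<in> W" unfolding w'_def using inv \<open>g \<in> carrier G\<close> w(1) W by blast
      have w'x: "w' $ u = (pair \<Psi> (r u) b - pair \<Psi> (r y) b) * w $ u" if "u < d" for u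
        using std_rep_diagonal[OF b(1) wc that] wc that by (simp add: w'_def g_def algebra_simps)
      have "w' $ x \<noteq> 0" using w'x[OF x(1)] x(2) ne by simp
      hence "w' \<noteq> 0\<^sub>v d" using x(1) by auto
      from min[OF w'W this] have "card (supp w) \<le> card (supp w')" .
      moreover have "supp w' \<subset> supp w"
      proof
        show "supp w' \<subseteq> supp w" using w'x by (auto simp: supp_def)
        have "y \<in> supp w" "y \<notin> supp w'" using y wy w'x[OF y(1)] by (auto simp: supp_def)
        thus "supp w' \<noteq> supp w" by blast
      qed
      ultimately show False using psubset_card_mono[OF fin] by (metis linorder_not_less)
    qed
    have "unit_vec d x = inverse (w $ x) \<cdot>\<^sub>v w"
      using wc x only by (intro eq_vecI) auto
    hence ux: "unit_vec d x \<in> W" using W(4) w(1) by metis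
    have uW: "unit_vec d z \<in> W" if z: "z < d" for z
    proof -
      have "r x - r z \<in> vecs m" using r x z by (simp add: vecs_closed)
      hence "(restrict (r x - r z) {..<m}, \<lambda>j\<in>{..<n}. 0, \<lambda>_\<in>{..<m} \<times> {..<n}. 0) \<in> carrier G"
        unfolding carrier_G using restrict_vecs by (auto simp: R_closed)
      thus ?thesis using inv ux std_rep_translation[OF z x(1)] by metis
    qed
    have part: "vec d (\<lambda>i. if i < k then v $ i else 0) \<in> W" if v: "v \<in> carrier_vec d" and "k \<le> d" for v k
      using \<open>k \<le> d\<close>
    proof (induction k)
      case 0
      have "vec d (\<lambda>i. if i < 0 then v $ i else 0) = 0\<^sub>v d" by (auto simp: vec_eq_iff)
      thus ?case using W(2) by simp
    next
      case (Suc k)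
      have "vec d (\<lambda>i. if i < Suc k then v $ i else 0) =
          vec d (\<lambda>i. if i < k then v $ i else 0) + v $ k \<cdot>\<^sub>v unit_vec d k"
        using Suc.prems v by (intro eq_vecI) (auto simp: less_Suc_eq)
      thus ?case using Suc uW[of k] W(3,4) by simp
    qed
    have "v \<in> W" if v: "v \<in> carrier_vec d" for v
    proof -
      have "vec d (\<lambda>i. if i < d then v $ i else 0) = v" using v by (intro eq_vecI) auto
      thus ?thesis using part[OF v order_refl] by simp
    qed
    thus ?thesis using W(1) by blast
  qed
  thus ?thesis
    unfolding irreducible_rep_def subspace_vec_iff using d std_rep_matrix_rep by blast
qed

end

lemma exists_irreducible_rep:
  assumes \<Psi>: "\<Psi> \<in> families" and d: "d = idx (vecs m) (rad \<Psi>)" "d > 0"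
  obtains \<rho> where "irreducible_rep G d \<rho>"
    "\<And>v. v \<in> vfams \<Longrightarrow> \<rho> (zel v) = cchar \<Psi> v \<cdot>\<^sub>m 1\<^sub>m d"
proof -
  obtain r where r: "\<And>x. x < d \<Longrightarrow> r x \<in> vecs m" "\<And>x y. x < d \<Longrightarrow> y < d \<Longrightarrow> r x - r y \<in> rad \<Psi> \<Longrightarrow> x = y"
    "\<And>v. v \<in> vecs m \<Longrightarrow> \<exists>x<d. v - r x \<in> rad \<Psi>"
    using coset_representatives[OF \<Psi> d] by blast
  show ?thesis
    by (rule that[of "std_rep \<Psi> d r"]) (use std_rep_irreducible[OF \<Psi> d(2) r] std_rep_zel[OF \<Psi> d(2) r] in blast)+
qed

section \<open>The central character of an irreducible representation, and the twist classes\<close>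

lemma irreducible_rep_central:
  assumes \<rho>: "irreducible_rep G d \<rho>"
  obtains \<psi> where "\<And>v. v \<in> vfams \<Longrightarrow> \<rho> (zel v) = \<psi> v \<cdot>\<^sub>m 1\<^sub>m d"
    "\<And>v. v \<in> vfams \<Longrightarrow> \<psi> v \<noteq> 0"
    "\<And>v w. v \<in> vfams \<Longrightarrow> w \<in> vfams \<Longrightarrow>
      \<psi> (\<lambda>j. v j + w j) = \<psi> v * \<psi> w"
    "\<And>v w. \<forall>j<n. v j = w j \<Longrightarrow> \<psi> v = \<psi> w"
proof -
  note I = irreducible_repD[OF \<rho>]
  note Rp = G.matrix_repD[OF I(1)]
  \<comment> \<open>As d > 0, the entry (0, 0) recovers the factor of a scalar matrix; this makes
    \<open>\<psi>\<close> a single function of v.\<close>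
  define \<psi> where "\<psi> v = \<rho> (zel v) $$ (0, 0)" for v
  have 1: "\<rho> (zel v) = \<psi> v \<cdot>\<^sub>m 1\<^sub>m d" if v: "v \<in> vfams" for v
  proof -
    obtain c where c: "\<rho> (zel v) = c \<cdot>\<^sub>m 1\<^sub>m d"
      using G.schur_scalar[OF \<rho> zel_carrier[OF v] zel_central] by blast
    thus ?thesis using I(2) by (simp add: \<psi>_def)
  qed
  have 3: "\<psi> (\<lambda>j. v j + w j) = \<psi> v * \<psi> w"
    if v: "v \<in> vfams" and w: "w \<in> vfams" for v w
  proof -
    have "\<rho> (zel (\<lambda>j. v j + w j)) = (\<psi> v \<cdot>\<^sub>m 1\<^sub>m d) * (\<psi> w \<cdot>\<^sub>m 1\<^sub>m d)"
      using Rp(2)[OF zel_carrier[OF v] zel_carrier[OF w]] 1[OF v] 1[OF w] by (simp only: zel_mult)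
    also have "\<dots> = (\<psi> v * \<psi> w) \<cdot>\<^sub>m 1\<^sub>m d" by (intro eq_matI) auto
    finally show ?thesis using I(2) by (simp add: \<psi>_def)
  qed
  have 2: "\<psi> v \<noteq> 0" if v: "v \<in> vfams" for v
  proof -
    have "\<psi> (\<lambda>j. v j + - v j) = \<psi> v * \<psi> (\<lambda>j. - v j)" using v by (intro 3) (auto simp: vecs_closed vfams_def)
    moreover have "\<psi> (\<lambda>j. v j + - v j) = 1" using I(2) Rp(3) unfolding \<psi>_def by (simp add: one_G)
    ultimately show "\<psi> v \<noteq> 0" by auto
  qed
  have 4: "\<psi> v = \<psi> w" if "\<forall>j<n. v j = w j" for v w
    using zel_cong[of v w] that by (simp add: \<psi>_def)
  show ?thesis by (rule that[of \<psi>, OF 1 2 3 4])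
qed

text \<open>Recovers the central character from a character alone: on a central element, an
  irreducible character of degree d takes d times the scalar. Since only \<open>\<theta>\<close>
  enters, the construction can be passed on to twist classes.\<close>

definition family_of ::
  "nat \<Rightarrow> ((nat \<Rightarrow> 'k) \<times> (nat \<Rightarrow> 'k) \<times> (nat \<times> nat \<Rightarrow> 'k) \<Rightarrow> complex) \<Rightarrow> nat \<Rightarrow> (nat \<Rightarrow> 'k) \<Rightarrow> complex" where
  "family_of d \<theta> = (\<lambda>j\<in>{..<n}. \<lambda>x\<in>vecs m. \<theta> (zel (single j x)) / of_nat d)"

lemma rep_character_scalar:
  assumes "g \<in> carrier H" "\<rho> g = c \<cdot>\<^sub>m 1\<^sub>m d"
  shows "rep_character H d \<rho> g = of_nat d * c"
  using assms by (simp add: rep_character_def)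

lemma family_of_character:
  assumes "d > 0" "j < n" "x \<in> vecs m" "\<rho> (zel (single j x)) = c \<cdot>\<^sub>m 1\<^sub>m d"
  shows "family_of d (rep_character G d \<rho>) j x = c"
  using assms rep_character_scalar[of "zel (single j x)" G \<rho> c d]
  by (simp add: family_of_def zel_carrier single_vfams)

lemma family_of_irreducible:
  assumes \<rho>: "irreducible_rep G d \<rho>"
  defines "\<Psi> \<equiv> family_of d (rep_character G d \<rho>)"
  shows "\<Psi> \<in> families"
    and "\<And>v. v \<in> vfams \<Longrightarrow> \<rho> (zel v) = cchar \<Psi> v \<cdot>\<^sub>m 1\<^sub>m d"
proof -
  note I = irreducible_repD[OF \<rho>]
  obtain \<psi> where \<psi>: "\<And>v. v \<in> vfams \<Longrightarrow> \<rho> (zel v) = \<psi> v \<cdot>\<^sub>m 1\<^sub>m d"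
    "\<And>v. v \<in> vfams \<Longrightarrow> \<psi> v \<noteq> 0"
    "\<And>v w. v \<in> vfams \<Longrightarrow> w \<in> vfams \<Longrightarrow>
      \<psi> (\<lambda>j. v j + w j) = \<psi> v * \<psi> w"
    "\<And>v w. \<forall>j<n. v j = w j \<Longrightarrow> \<psi> v = \<psi> w"
    using irreducible_rep_central[OF \<rho>] by blast
  have val: "\<Psi> j x = \<psi> (single j x)" if "j < n" "x \<in> vecs m" for j x
    unfolding \<Psi>_def using that I(2) \<psi>(1) by (intro family_of_character) (auto simp: single_vfams)
  show \<Psi>: "\<Psi> \<in> families"
    unfolding families_def
  proof (rule PiE_I)
    fix j assume "j \<in> {..<n}"
    hence j: "j < n" by simp
    have "\<Psi> j (x + y) = \<Psi> j x * \<Psi> j y" if xy: "x \<in> vecs m" "y \<in> vecs m" for x y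
    proof -
      have "\<psi> (single j (x + y)) = \<psi> (\<lambda>j'. single j x j' + single j y j')"
        using xy by (intro \<psi>(4)) (auto simp: single_def vfams_def)
      also have "\<dots> = \<psi> (single j x) * \<psi> (single j y)" using xy by (intro \<psi>(3)) (auto simp: single_vfams)
      finally show ?thesis using val j xy by (simp add: vecs_closed)
    qed
    moreover have "\<Psi> j x \<noteq> 0" if "x \<in> vecs m" for x
      using val[OF j that] \<psi>(2)[of "single j x"] that by (simp add: single_vfams)
    moreover have "\<Psi> j \<in> extensional (vecs m)" using j by (simp add: \<Psi>_def family_of_def)
    ultimately show "\<Psi> j \<in> add_chars (vecs m)" by (simp add: add_chars_def)
  qed (simp add: \<Psi>_def family_of_def)
  show "\<rho> (zel v) = cchar \<Psi> v \<cdot>\<^sub>m 1\<^sub>m d" if v: "v \<in> vfams" for v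
  proof -
    \<comment> \<open>Builds v column by column, because \<open>\<psi>\<close> is known to be
      multiplicative only for sums of two families.\<close>
    have "\<psi> (\<lambda>j. if j < k then v j else 0) = (\<Prod>j<k. \<Psi> j (v j))" if "k \<le> n" for k
      using that
    proof (induction k)
      case 0
      have "\<psi> (\<lambda>j. 0 + 0) = \<psi> (\<lambda>j. 0) * \<psi> (\<lambda>j. 0)" by (rule \<psi>(3)[OF vfams_0 vfams_0])
      hence "\<psi> (\<lambda>j. 0) = 1" using \<psi>(2)[OF vfams_0] by simp
      thus ?case by (simp only: not_less_zero if_False lessThan_0 prod.empty)
    next
      case (Suc k)
      hence k: "k < n" by simp
      have "\<psi> (\<lambda>j. if j < Suc k then v j else 0) =
          \<psi> (\<lambda>j. (if j < k then v j else 0) + single k (v k) j)"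
        using v by (intro \<psi>(4)) (auto simp: single_def less_Suc_eq)
      also have "\<dots> = \<psi> (\<lambda>j. if j < k then v j else 0) * \<psi> (single k (v k))"
      proof (rule \<psi>(3)[OF _ single_vfams[OF vfamsD[OF v k]]])
        show "(\<lambda>j. if j < k then v j else 0) \<in> vfams" using v by (auto simp: vecs_closed vfams_def)
      qed
      finally show ?case using Suc val[OF k vfamsD[OF v k]] by simp
    qed
    from this[of n] have "\<psi> (\<lambda>j. if j < n then v j else 0) = cchar \<Psi> v" by (simp add: cchar_def)
    moreover have "\<psi> (\<lambda>j. if j < n then v j else 0) = \<psi> v"
      using v by (intro \<psi>(4)) auto
    ultimately show ?thesis using \<psi>(1)[OF v] by simp
  qed
qed

lemma pair_as_cchar_commutator:
  assumes x: "x \<in> vecs m" and b: "b \<in> {..<n} \<rightarrow>\<^sub>E R"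
  defines "g \<equiv> (restrict x {..<m}, \<lambda>j\<in>{..<n}. 0, \<lambda>_\<in>{..<m} \<times> {..<n}. 0)"
    and "h \<equiv> (\<lambda>i\<in>{..<m}. 0, b, \<lambda>_\<in>{..<m} \<times> {..<n}. 0)"
  shows "g \<in> carrier G" "h \<in> carrier G"
    "g \<otimes>\<^bsub>G\<^esub> h = zel (\<lambda>j. vscale (b j) x) \<otimes>\<^bsub>G\<^esub> (h \<otimes>\<^bsub>G\<^esub> g)"
proof -
  show "g \<in> carrier G" "h \<in> carrier G"
    using x b restrict_vecs by (auto simp: g_def h_def carrier_G R_closed)
  have "zext (\<lambda>i\<in>{..<m}. 0) = 0" by (auto simp: zext_def fun_eq_iff)
  thus "g \<otimes>\<^bsub>G\<^esub> h = zel (\<lambda>j. vscale (b j) x) \<otimes>\<^bsub>G\<^esub> (h \<otimes>\<^bsub>G\<^esub> g)"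
    unfolding g_def h_def by (subst commutator_G) (simp add: zext_restrict[OF x] vscale_simps)
qed

text \<open>With g given by x and h by the j-th unit vector, the commutator of g and h is the
  central element with x in column j. So \<open>\<rho> g * \<rho> h\<close> is
  \<open>\<Psi> j x\<close> times \<open>\<rho> h * \<rho> g\<close>, and taking determinants gives
  the d-th power.\<close>

lemma family_of_power:
  assumes \<rho>: "irreducible_rep G d \<rho>" and j: "j < n" and x: "x \<in> vecs m"
  shows "family_of d (rep_character G d \<rho>) j x ^ d = 1"
proof -
  note I = irreducible_repD[OF \<rho>]
  note Rp = G.matrix_repD[OF I(1)]
  define \<Psi> where "\<Psi> = family_of d (rep_character G d \<rho>)"
  note F = family_of_irreducible[OF \<rho>, folded \<Psi>_def]
  define b where "b = (\<lambda>j'\<in>{..<n}. if j' = j then 1 else 0 :: 'k)"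
  have b: "b \<in> {..<n} \<rightarrow>\<^sub>E R" by (auto simp: b_def R_closed)
  define g where "g = (restrict x {..<m}, \<lambda>j\<in>{..<n}. 0 :: 'k, \<lambda>_\<in>{..<m} \<times> {..<n}. 0 :: 'k)"
  define h where "h = (\<lambda>i\<in>{..<m}. 0 :: 'k, b, \<lambda>_\<in>{..<m} \<times> {..<n}. 0 :: 'k)"
  note gh = pair_as_cchar_commutator[OF x b, folded g_def h_def]
  have bR: "(\<lambda>j. vscale (b j) x) \<in> vfams" using b x by (auto intro!: vfams_vscale)
  define z where "z = cchar \<Psi> (\<lambda>j. vscale (b j) x)"
  have z: "z = \<Psi> j x"
  proof -
    have "z = cchar \<Psi> (single j x)"
      unfolding z_def by (rule cchar_cong) (auto simp: b_def single_def vscale_simps)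
    thus ?thesis using cchar_single[OF F(1) j x] by simp
  qed
  have "\<rho> g * \<rho> h = (z \<cdot>\<^sub>m 1\<^sub>m d) * (\<rho> h * \<rho> g)"
    using Rp(2)[OF gh(1,2)] Rp(2)[OF gh(2,1)] Rp(2)[OF zel_carrier[OF bR] G.m_closed[OF gh(2,1)]] F(2)[OF bR]
    by (simp only: gh(3) z_def)
  also have "\<dots> = z \<cdot>\<^sub>m (\<rho> h * \<rho> g)"
    using Rp(1)[OF gh(1)] Rp(1)[OF gh(2)] by (simp add: mult_smult_assoc_mat[of _ d d _ d])
  finally have "det (\<rho> g * \<rho> h) = det (z \<cdot>\<^sub>m (\<rho> h * \<rho> g))" by simp
  hence "det (\<rho> g) * det (\<rho> h) = z ^ d * (det (\<rho> h) * det (\<rho> g))"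
    using Rp(1)[OF gh(1)] Rp(1)[OF gh(2)] by (simp add: det_mult[of _ d])
  moreover have "det (\<rho> k) \<noteq> 0" if k: "k \<in> carrier G" for k
  proof -
    have "det (\<rho> (inv\<^bsub>G\<^esub> k)) * det (\<rho> k) = 1"
      using G.matrix_rep_inv(1)[OF I(1) k] Rp(1)[OF k] Rp(1)[OF G.inv_closed[OF k]]
      by (simp flip: det_mult)
    thus ?thesis by auto
  qed
  ultimately have "z ^ d = 1" using gh by (simp add: mult.commute)
  thus ?thesis by (simp add: z \<Psi>_def)
qed

text \<open>Each coordinate has finitely many residues modulo d, so d R^m has finite index, and it
  lies in N.\<close>

lemma idx_vecs_multiples:
  assumes "d > 0" and sub: "submod N" "N \<subseteq> vecs m" and dN: "\<And>x. x \<in> vecs m \<Longrightarrow> of_nat d * x \<in> N"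
  shows "idx (vecs m) N > 0"
proof -
  define P where "P = (*) (of_nat d :: 'k) ` R"
  have dR: "(of_nat d :: 'k) \<in> R" "(of_nat d :: 'k) \<noteq> 0" using assms by (auto simp: of_nat_closed)
  have P: "add_subgroup P" unfolding P_def using rideal_principal[OF dR(1)] ridealD by blast
  have "finite (cosets R P)" using finite_mod[OF dR] by (simp add: P_def idx_def card_gt_0_iff)
  then obtain T where T: "T \<subseteq> R" "finite T" "cosets R P = add_coset P ` T"
    unfolding cosets_def using finite_subset_image[of "add_coset P ` R" "add_coset P" R] by auto
  define V where "V = zext ` ({..<m} \<rightarrow>\<^sub>E T)"
  have "finite V" unfolding V_def using T by (intro finite_imageI finite_PiE) auto
  moreover have "cosets (vecs m) N \<subseteq> add_coset N ` V"
  proof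
    fix C assume "C \<in> cosets (vecs m) N"
    then obtain x where x: "x \<in> vecs m" "C = add_coset N x" by (auto simp: cosets_def)
    have "\<exists>t\<in>T. \<exists>s\<in>R. x i - t = of_nat d * s" if "i < m" for i
    proof -
      have "add_coset P (x i) \<in> add_coset P ` T" using T(3) vecsD(1)[OF x(1) that] unfolding cosets_def by blast
      then obtain t where t: "t \<in> T" "add_coset P (x i) = add_coset P t" by blast
      have "x i - t \<in> P" using t coset_eq_iff[OF P] by blast
      thus ?thesis using t by (auto simp: P_def)
    qed
    then obtain t s where ts: "\<And>i. i < m \<Longrightarrow> t i \<in> T" "\<And>i. i < m \<Longrightarrow> s i \<in> R"
      "\<And>i. i < m \<Longrightarrow> x i - t i = of_nat d * s i" by metis
    define t' where "t' = restrict t {..<m}"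
    have t': "t' \<in> {..<m} \<rightarrow>\<^sub>E T" using ts by (auto simp: t'_def)
    have "zext s \<in> vecs m" using ts by (auto simp: zext_def vecs_def)
    hence "of_nat d * zext s \<in> N" by (rule dN)
    moreover have "of_nat d * zext s = x - zext t'"
      using ts(3) x by (auto simp: fun_eq_iff zext_def t'_def vecs_def)
    ultimately have "C = add_coset N (zext t')"
      using x coset_eq_iff[OF submodD(1)[OF sub(1)]] by simp
    thus "C \<in> add_coset N ` V" using t' by (auto simp: V_def)
  qed
  ultimately have "finite (cosets (vecs m) N)" by (meson finite_imageI finite_subset)
  moreover have "vecs m \<noteq> {}" using vecs_closed(1) by blast
  ultimately show ?thesis by (simp add: idx_pos_iff)
qed

lemma same_central_character_twist:
  assumes \<rho>1: "irreducible_rep G d1 \<rho>1" and \<rho>2: "irreducible_rep G d2 \<rho>2"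
    and 1: "\<And>v. v \<in> vfams \<Longrightarrow> \<rho>1 (zel v) = cchar \<Psi> v \<cdot>\<^sub>m 1\<^sub>m d1"
    and 2: "\<And>v. v \<in> vfams \<Longrightarrow> \<rho>2 (zel v) = cchar \<Psi> v \<cdot>\<^sub>m 1\<^sub>m d2"
  shows "d1 = d2" "(rep_character G d1 \<rho>1, rep_character G d2 \<rho>2) \<in> twist_rel G d1"
proof -
  have comm: "\<exists>z\<in>carrier G. \<exists>c. g \<otimes>\<^bsub>G\<^esub> h = z \<otimes>\<^bsub>G\<^esub> (h \<otimes>\<^bsub>G\<^esub> g) \<and> \<rho>1 z = c \<cdot>\<^sub>m 1\<^sub>m d1 \<and> \<rho>2 z = c \<cdot>\<^sub>m 1\<^sub>m d2"
    if g: "g \<in> carrier G" and h: "h \<in> carrier G" for g h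
  proof -
    obtain a b c a' b' c' where gh: "g = (a, b, c)" "h = (a', b', c')" by (metis prod_cases3)
    define v where "v j = vscale (b' j) (zext a) - vscale (b j) (zext a')" for j
    have v: "v \<in> vfams"
      unfolding v_def using g h by (auto simp: gh carrier_G intro!: vfamsI vecs_closed zext_vecs)
    have "g \<otimes>\<^bsub>G\<^esub> h = zel v \<otimes>\<^bsub>G\<^esub> (h \<otimes>\<^bsub>G\<^esub> g)" unfolding gh v_def by (rule commutator_G)
    thus ?thesis using zel_carrier[OF v] 1[OF v] 2[OF v] by blast
  qed
  show "d1 = d2" "(rep_character G d1 \<rho>1, rep_character G d2 \<rho>2) \<in> twist_rel G d1"
    by (rule G.twist_equivalent_if_same_central_character[OF \<rho>1 \<rho>2 comm]; assumption)+
qed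

text \<open>By \<open>family_of_power\<close>, d R^m lies in the radical, which therefore has finite
  index. The explicit representation with the same central character has this index as its
  dimension, and equal central characters force equal dimensions.\<close>

lemma idx_rad_family_of:
  assumes \<rho>: "irreducible_rep G d \<rho>"
  shows "idx (vecs m) (rad (family_of d (rep_character G d \<rho>))) = d"
proof -
  define \<Psi> where "\<Psi> = family_of d (rep_character G d \<rho>)"
  note F = family_of_irreducible[OF \<rho>, folded \<Psi>_def]
  note I = irreducible_repD[OF \<rho>]
  have "of_nat d * x \<in> rad \<Psi>" if x: "x \<in> vecs m" for x
  proof -
    have "\<Psi> j (vscale s (of_nat d * x)) = 1" if "s \<in> R" "j < n" for s j
    proof -
      have sx: "vscale s x \<in> vecs m" using that x by (intro vecs_closed)
      have "vscale s (of_nat d * x) = of_nat d * vscale s x" by (simp add: fun_eq_iff)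
      hence "\<Psi> j (vscale s (of_nat d * x)) = \<Psi> j (vscale s x) ^ d"
        using add_chars_of_nat_mult[OF vecs_add_subgroup familiesD(1)[OF F(1) that(2)] sx] by simp
      thus ?thesis using family_of_power[OF \<rho> that(2) sx] by (simp add: \<Psi>_def)
    qed
    thus ?thesis using add_subgroup_of_nat_mult[OF vecs_add_subgroup x] by (simp add: rad_def)
  qed
  hence "idx (vecs m) (rad \<Psi>) > 0"
    using I(2) submod_rad[OF F(1)] rad_subset by (intro idx_vecs_multiples[of d]) (auto simp: rad_def)
  then obtain \<rho>' where \<rho>': "irreducible_rep G (idx (vecs m) (rad \<Psi>)) \<rho>'"
    "\<And>v. v \<in> vfams \<Longrightarrow> \<rho>' (zel v) = cchar \<Psi> v \<cdot>\<^sub>m 1\<^sub>m (idx (vecs m) (rad \<Psi>))"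
    using exists_irreducible_rep[OF F(1)] by blast
  have "d = idx (vecs m) (rad \<Psi>)"
    by (rule same_central_character_twist(1)[OF \<rho> \<rho>'(1) F(2) \<rho>'(2)])
  thus ?thesis by (simp add: \<Psi>_def)
qed

text \<open>By \<open>family_of_power\<close> with d = 1, the twisting character is 1 on the central
  elements at which \<open>family_of\<close> evaluates.\<close>

lemma family_of_twist:
  assumes tw: "(\<theta>1, \<theta>2) \<in> twist_rel G d"
  shows "family_of d \<theta>1 = family_of d \<theta>2"
proof -
  obtain \<chi> where \<chi>: "\<chi> \<in> Irr G 1" "\<theta>1 = (\<lambda>g\<in>carrier G. \<chi> g * \<theta>2 g)"
    using tw by (auto simp: twist_rel_def)
  obtain \<rho> where \<rho>: "irreducible_rep G 1 \<rho>" "\<chi> = rep_character G 1 \<rho>" using \<chi>(1) by (auto simp: Irr_def)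
  have "\<chi> (zel (single j x)) = 1" if "j < n" "x \<in> vecs m" for j x
    using family_of_power[OF \<rho>(1) that] that by (simp add: family_of_def \<rho>(2))
  thus ?thesis unfolding family_of_def \<chi>(2)
    by (intro restrict_ext) (simp add: zel_carrier single_vfams)
qed

text \<open>The twist classes are the fibres of \<open>family_of d\<close>: it is constant on
  classes, and equal values mean equal central characters, hence a twist. Its image is determined by
  \<open>exists_irreducible_rep\<close> and \<open>idx_rad_family_of\<close>.\<close>

lemma twist_classes:
  assumes d: "d > 0"
  shows "bij_betw (\<lambda>\<Psi>. {\<theta>\<in>Irr G d. family_of d \<theta> = \<Psi>}) {\<Psi> \<in> families. idx (vecs m) (rad \<Psi>) = d}
    (Irr G d // twist_rel G d)"
proof -
  have rel: "(\<theta>1, \<theta>2) \<in> twist_rel G d \<longleftrightarrow> \<theta>1 \<in> Irr G d \<and> \<theta>2 \<in> Irr G d \<and> family_of d \<theta>1 = family_of d \<theta>2" for \<theta>1 \<theta>2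
  proof
    assume "(\<theta>1, \<theta>2) \<in> twist_rel G d"
    thus "\<theta>1 \<in> Irr G d \<and> \<theta>2 \<in> Irr G d \<and> family_of d \<theta>1 = family_of d \<theta>2"
      using family_of_twist by (auto simp: twist_rel_def)
  next
    assume *: "\<theta>1 \<in> Irr G d \<and> \<theta>2 \<in> Irr G d \<and> family_of d \<theta>1 = family_of d \<theta>2"
    then obtain \<rho>1 \<rho>2 where \<rho>: "irreducible_rep G d \<rho>1" "\<theta>1 = rep_character G d \<rho>1"
      "irreducible_rep G d \<rho>2" "\<theta>2 = rep_character G d \<rho>2" by (auto simp: Irr_def)
    have eq: "family_of d (rep_character G d \<rho>2) = family_of d (rep_character G d \<rho>1)" using * \<rho> by simp
    show "(\<theta>1, \<theta>2) \<in> twist_rel G d"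
      unfolding \<rho>(2,4)
      by (rule same_central_character_twist(2)[OF \<rho>(1,3) family_of_irreducible(2)[OF \<rho>(1)]
            family_of_irreducible(2)[OF \<rho>(3), unfolded eq]])
  qed
  have image: "family_of d ` Irr G d = {\<Psi> \<in> families. idx (vecs m) (rad \<Psi>) = d}"
  proof
    show "family_of d ` Irr G d \<subseteq> {\<Psi> \<in> families. idx (vecs m) (rad \<Psi>) = d}"
      using family_of_irreducible(1) idx_rad_family_of by (auto simp: Irr_def)
    show "{\<Psi> \<in> families. idx (vecs m) (rad \<Psi>) = d} \<subseteq> family_of d ` Irr G d"
    proof
      fix \<Psi> assume "\<Psi> \<in> {\<Psi> \<in> families. idx (vecs m) (rad \<Psi>) = d}"
      hence \<Psi>: "\<Psi> \<in> families" "d = idx (vecs m) (rad \<Psi>)" by auto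
      obtain \<rho> where \<rho>: "irreducible_rep G d \<rho>"
        "\<And>v. v \<in> vfams \<Longrightarrow> \<rho> (zel v) = cchar \<Psi> v \<cdot>\<^sub>m 1\<^sub>m d"
        using exists_irreducible_rep[OF \<Psi> d] by blast
      have "family_of d (rep_character G d \<rho>) j = \<Psi> j" for j
      proof (cases "j < n")
        case True
        show ?thesis
        proof (rule extensionalityI[of _ "vecs m"])
          show "\<Psi> j \<in> extensional (vecs m)" using add_charsD(1)[OF familiesD(1)[OF \<Psi>(1) True]] .
          show "family_of d (rep_character G d \<rho>) j \<in> extensional (vecs m)" using True by (simp add: family_of_def)
          show "family_of d (rep_character G d \<rho>) j x = \<Psi> j x" if "x \<in> vecs m" for x
            using \<rho>(2)[of "single j x"] that cchar_single[OF \<Psi>(1) True that]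
            by (intro family_of_character[OF d True that]) (simp add: single_vfams)
        qed
      next
        case False
        thus ?thesis using PiE_arb[OF \<Psi>(1)[unfolded families_def], of j] by (simp add: family_of_def)
      qed
      hence "\<Psi> = family_of d (rep_character G d \<rho>)" by (simp add: fun_eq_iff)
      thus "\<Psi> \<in> family_of d ` Irr G d" using \<rho>(1) by (auto simp: Irr_def)
    qed
  qed
  have "twist_rel G d `` {\<theta>} = {\<theta>'\<in>Irr G d. family_of d \<theta>' = family_of d \<theta>}" if "\<theta> \<in> Irr G d" for \<theta>
    unfolding Image_singleton rel using that by (auto simp del: Collect_conj_eq)
  hence "Irr G d // twist_rel G d = (\<lambda>\<Psi>. {\<theta>\<in>Irr G d. family_of d \<theta> = \<Psi>}) ` family_of d ` Irr G d"
    unfolding quotient_def by (simp add: UNION_singleton_eq_range image_image)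
  moreover have "inj_on (\<lambda>\<Psi>. {\<theta>\<in>Irr G d. family_of d \<theta> = \<Psi>}) (family_of d ` Irr G d)"
    by (rule inj_onI) blast
  ultimately show ?thesis unfolding image[symmetric] by (simp add: bij_betw_def)
qed

end

section \<open>The zeta function\<close>

context number_ring
begin

lemma ideal_count_1: "ideal_count 1 = 1"
proof -
  have "{I. rideal I \<and> idx R I = 1} = {R}"
    using idx_eq_1_iff[OF ridealD(2) add_subgroup_R] ridealD(1) rideal_R by blast
  thus ?thesis by (simp add: ideal_count_def)
qed

end

context gmn
begin

text \<open>Since N is a submodule, it lies in the radical exactly when every
  \<open>\<Psi> j\<close> is trivial on N. This leaves n independent choices among the extensions to
  R^m of the trivial character of N.\<close>

lemma families_with_rad_over:
  assumes N: "submod N" "N \<subseteq> vecs m" "idx (vecs m) N > 0"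
  shows "finite {\<Psi> \<in> families. N \<subseteq> rad \<Psi>}" "card {\<Psi> \<in> families. N \<subseteq> rad \<Psi>} = idx (vecs m) N ^ n"
proof -
  define E where "E = char_extensions (vecs m) N (\<lambda>x\<in>N. 1)"
  note NG = submodD(1)[OF N(1)]
  have "(\<lambda>x\<in>N. 1) \<in> add_chars N" using add_subgroupD(4)[OF NG] by (simp add: add_chars_def)
  hence card: "card E = idx (vecs m) N"
    unfolding E_def by (rule card_char_extensions[OF vecs_add_subgroup NG N(2,3)])
  hence fin: "finite E" using N(3) by (metis card.infinite less_not_refl)
  have "N \<subseteq> rad \<Psi> \<longleftrightarrow> (\<forall>j<n. \<forall>x\<in>N. \<Psi> j x = 1)" for \<Psi> :: "nat \<Rightarrow> (nat \<Rightarrow> 'k) \<Rightarrow> complex"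
  proof
    assume *: "N \<subseteq> rad \<Psi>"
    show "\<forall>j<n. \<forall>x\<in>N. \<Psi> j x = 1"
    proof (intro allI impI ballI)
      fix j x assume "j < n" "x \<in> N"
      hence "\<Psi> j (vscale 1 x) = 1" using * one_closed unfolding rad_def by blast
      thus "\<Psi> j x = 1" by (simp add: vscale_simps)
    qed
  next
    assume *: "\<forall>j<n. \<forall>x\<in>N. \<Psi> j x = 1"
    show "N \<subseteq> rad \<Psi>" using * N(2) submodD(2)[OF N(1)] unfolding rad_def by blast
  qed
  hence "{\<Psi> \<in> families. N \<subseteq> rad \<Psi>} = {..<n} \<rightarrow>\<^sub>E E"
    unfolding families_def E_def char_extensions_def by (auto simp: PiE_iff extensional_def)
  thus "finite {\<Psi> \<in> families. N \<subseteq> rad \<Psi>}" "card {\<Psi> \<in> families. N \<subseteq> rad \<Psi>} = idx (vecs m) N ^ n"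
    using fin card by (auto simp: card_PiE intro: finite_PiE)
qed

definition families_of_index :: "nat \<Rightarrow> (nat \<Rightarrow> (nat \<Rightarrow> 'k) \<Rightarrow> complex) set" where
  "families_of_index d = {\<Psi> \<in> families. idx (vecs m) (rad \<Psi>) = d}"

definition lattice_zeta :: fds where
  "lattice_zeta = (\<Prod>i<m. fds_shift i (fds (\<lambda>k. of_nat (ideal_count k))))"

lemma vecs_index_pos: "idx (vecs m) (vecs m) > 0"
  using idx_self[OF vecs_add_subgroup] by simp

text \<open>Each such family lies over its own radical, which is one of finitely many submodules of
  index d.\<close>

lemma finite_families_of_index:
  assumes "d > 0"
  shows "finite (families_of_index d)"
proof (rule finite_subset)
  show "families_of_index d \<subseteq> (\<Union>N\<in>submods_of_index (vecs m) d. {\<Psi> \<in> families. N \<subseteq> rad \<Psi>})"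
    using submod_rad rad_subset by (auto simp: families_of_index_def submods_of_index_def)
  show "finite (\<Union>N\<in>submods_of_index (vecs m) d. {\<Psi> \<in> families. N \<subseteq> rad \<Psi>})"
  proof (rule finite_UN_I)
    show "finite (submods_of_index (vecs m) d)"
      using submods_of_index_count[OF submod_vecs order_refl vecs_index_pos assms] by blast
    show "finite {\<Psi> \<in> families. N \<subseteq> rad \<Psi>}" if "N \<in> submods_of_index (vecs m) d" for N
      using that assms by (intro families_with_rad_over) (auto simp: submods_of_index_def)
  qed
qed

text \<open>Count the pairs \<open>(N, \<Psi>)\<close> with \<open>N \<subseteq> rad \<Psi>\<close> and \<open>N\<close> of index \<open>k\<close> in two ways.\<close>

lemma count_families:
  assumes k: "k > 0"
  shows "of_nat k ^ n * fds_nth lattice_zeta k =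
    (\<Sum>d | d dvd k. of_nat (card (families_of_index d)) * fds_nth lattice_zeta (k div d))"
proof -
  have cnt: "finite (submods_of_index L j)" "of_nat (card (submods_of_index L j)) = fds_nth lattice_zeta j"
    if "submod L" "L \<subseteq> vecs m" "idx (vecs m) L > 0" "j > 0" for L j
    using submods_of_index_count[OF that] by (simp_all add: lattice_zeta_def)
  have dk: "d > 0" "k div d > 0" if "d dvd k" for d
    using that k by (auto intro: Nat.gr0I simp: dvd_div_eq_0_iff)
  define P where "P = (SIGMA N:submods_of_index (vecs m) k. {\<Psi> \<in> families. N \<subseteq> rad \<Psi>})"
  define Q where "Q = (SIGMA d:{d. d dvd k}. SIGMA \<Psi>:families_of_index d. submods_of_index (rad \<Psi>) (k div d))"
  have rad: "submod (rad \<Psi>)" "rad \<Psi> \<subseteq> vecs m" if "\<Psi> \<in> families" for \<Psi>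
    using submod_rad[OF that] rad_subset[OF that] by auto
  have "bij_betw (\<lambda>(d, \<Psi>, N). (N, \<Psi>)) Q P"
  proof (rule bij_betw_imageI)
    show "inj_on (\<lambda>(d, \<Psi>, N). (N, \<Psi>)) Q"
      by (auto simp: inj_on_def Q_def families_of_index_def)
    show "(\<lambda>(d, \<Psi>, N). (N, \<Psi>)) ` Q = P"
    proof
      show "(\<lambda>(d, \<Psi>, N). (N, \<Psi>)) ` Q \<subseteq> P"
      proof
        fix p assume "p \<in> (\<lambda>(d, \<Psi>, N). (N, \<Psi>)) ` Q"
        then obtain d \<Psi> N where *: "p = (N, \<Psi>)" "d dvd k" "\<Psi> \<in> families" "idx (vecs m) (rad \<Psi>) = d"
          "submod N" "N \<subseteq> rad \<Psi>" "idx (rad \<Psi>) N = k div d"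
          by (auto simp: Q_def families_of_index_def submods_of_index_def)
        have "idx (vecs m) N = idx (vecs m) (rad \<Psi>) * idx (rad \<Psi>) N"
          using * rad[OF *(3)] by (intro idx_mult) (auto simp: submodD submod_vecs)
        thus "p \<in> P" using * rad[OF *(3)] by (auto simp: P_def submods_of_index_def)
      qed
      show "P \<subseteq> (\<lambda>(d, \<Psi>, N). (N, \<Psi>)) ` Q"
      proof
        fix p assume "p \<in> P"
        then obtain \<Psi> N where *: "p = (N, \<Psi>)" "\<Psi> \<in> families" "N \<subseteq> rad \<Psi>" "submod N" "idx (vecs m) N = k"
          by (auto simp: P_def submods_of_index_def)
        have eq: "idx (vecs m) N = idx (vecs m) (rad \<Psi>) * idx (rad \<Psi>) N"
          using * rad[OF *(2)] by (intro idx_mult) (auto simp: submodD submod_vecs)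
        have "(idx (vecs m) (rad \<Psi>), \<Psi>, N) \<in> Q"
          using * eq k by (auto simp: Q_def families_of_index_def submods_of_index_def)
        thus "p \<in> (\<lambda>(d, \<Psi>, N). (N, \<Psi>)) ` Q"
          using * by (intro image_eqI[of _ _ "(idx (vecs m) (rad \<Psi>), \<Psi>, N)"]) auto
      qed
    qed
  qed
  hence PQ: "card Q = card P" by (rule bij_betw_same_card)
  have "card P = (\<Sum>N\<in>submods_of_index (vecs m) k. card {\<Psi> \<in> families. N \<subseteq> rad \<Psi>})"
    unfolding P_def using cnt(1)[OF submod_vecs order_refl vecs_index_pos k] k
    by (intro card_SigmaI) (auto simp: submods_of_index_def families_with_rad_over)
  also have "\<dots> = (\<Sum>N\<in>submods_of_index (vecs m) k. k ^ n)"
    using k by (intro sum.cong) (auto simp: submods_of_index_def families_with_rad_over)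
  finally have P: "of_nat (card P) = of_nat k ^ n * fds_nth lattice_zeta k"
    using cnt(2)[OF submod_vecs order_refl vecs_index_pos k] by (simp add: mult.commute)
  have radd: "submod (rad \<Psi>)" "rad \<Psi> \<subseteq> vecs m" "idx (vecs m) (rad \<Psi>) > 0"
    if "d dvd k" "\<Psi> \<in> families_of_index d" for d \<Psi>
    using that dk(1)[OF that(1)] rad by (auto simp: families_of_index_def)
  have cnt_rad: "finite (submods_of_index (rad \<Psi>) (k div d))"
    "of_nat (card (submods_of_index (rad \<Psi>) (k div d))) = fds_nth lattice_zeta (k div d)"
    if "d dvd k" "\<Psi> \<in> families_of_index d" for d \<Psi>
    using cnt[OF radd[OF that] dk(2)[OF that(1)]] by auto
  have "card Q = (\<Sum>d | d dvd k. card (SIGMA \<Psi>:families_of_index d. submods_of_index (rad \<Psi>) (k div d)))"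
    unfolding Q_def using k
    by (intro card_SigmaI) (auto intro!: finite_SigmaI finite_families_of_index cnt_rad dk)
  also have "\<dots> = (\<Sum>d | d dvd k. \<Sum>\<Psi>\<in>families_of_index d. card (submods_of_index (rad \<Psi>) (k div d)))"
    by (intro sum.cong refl card_SigmaI) (auto intro!: finite_families_of_index cnt_rad dk)
  finally have "of_nat (card Q) =
      (\<Sum>d | d dvd k. \<Sum>\<Psi>\<in>families_of_index d. (of_nat (card (submods_of_index (rad \<Psi>) (k div d))) :: complex))"
    by simp
  also have "\<dots> = (\<Sum>d | d dvd k. \<Sum>\<Psi>\<in>families_of_index d. fds_nth lattice_zeta (k div d))"
    by (intro sum.cong refl cnt_rad(2)) auto
  finally show ?thesis using P PQ by simp
qed

text \<open>\<open>count_families\<close> compares the coefficients of two Dirichlet series. Each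
  factor of \<open>lattice_zeta\<close> has first coefficient 1, since R is the only ideal of index
  1, so it can be divided out; the shift by n distributes over the factors.\<close>

lemma twist_zeta_G:
  "(\<forall>d\<ge>1. finite (Irr G d // twist_rel G d)) \<and>
   twist_zeta G = (\<Prod>i<m. fds_shift (n + i) (fds (\<lambda>k. of_nat (ideal_count k))) /
     fds_shift i (fds (\<lambda>k. of_nat (ideal_count k))))"
proof
  let ?Z = "fds (\<lambda>k. of_nat (ideal_count k))"
  have fin: "finite (Irr G d // twist_rel G d)" "card (Irr G d // twist_rel G d) = card (families_of_index d)"
    if "d > 0" for d
    using twist_classes[OF that, folded families_of_index_def] finite_families_of_index[OF that]
    by (auto dest: bij_betw_finite bij_betw_same_card)
  thus "\<forall>d\<ge>1. finite (Irr G d // twist_rel G d)" by simp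
  have "fds_shift n lattice_zeta = twist_zeta G * lattice_zeta"
  proof (rule fds_eqI)
    fix k :: nat assume k: "k > 0"
    have "fds_nth (twist_zeta G * lattice_zeta) k =
        (\<Sum>d | d dvd k. fds_nth (twist_zeta G) d * fds_nth lattice_zeta (k div d))"
      using k by (simp add: times_fds_def fds_nth_fds)
    also have "\<dots> = (\<Sum>d | d dvd k. of_nat (card (families_of_index d)) * fds_nth lattice_zeta (k div d))"
      using k by (intro sum.cong) (auto simp: twist_zeta_def fds_nth_fds fin dvd_pos_nat)
    finally show "fds_nth (fds_shift n lattice_zeta) k = fds_nth (twist_zeta G * lattice_zeta) k"
      using k count_families[OF k] by (simp add: fds_shift_def fds_nth_fds)
  qed
  moreover have "lattice_zeta * (\<Prod>i<m. inverse (fds_shift i ?Z)) = 1"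
  proof -
    have "inverse (fds_shift i ?Z) * fds_shift i ?Z = 1" for i
      by (rule fds_inverse) (simp add: fds_shift_def fds_nth_fds ideal_count_1[simplified])
    thus ?thesis unfolding lattice_zeta_def prod.distrib[symmetric] by (simp add: mult.commute)
  qed
  ultimately have "twist_zeta G = fds_shift n lattice_zeta * (\<Prod>i<m. inverse (fds_shift i ?Z))"
    by (simp add: mult.assoc)
  also have "fds_shift n lattice_zeta = (\<Prod>i<m. fds_shift (n + i) ?Z)"
    by (simp add: lattice_zeta_def fds_shift_prod fds_shift_shift)
  finally show "twist_zeta G = (\<Prod>i<m. fds_shift (n + i) ?Z / fds_shift i ?Z)"
    by (simp add: divide_fds_def prod.distrib)
qed

section \<open>Comparison with ideals and quotient rings over a ring structure\<close>

lemma ideal_ring_str_iff: "ideal I ring_str \<longleftrightarrow> rideal I"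
proof
  assume I: "ideal I ring_str"
  interpret I: ideal I ring_str by fact
  have sub: "I \<subseteq> R" using I.a_subset by (simp add: ring_str_def)
  have mult: "r * x \<in> I" if "r \<in> R" "x \<in> I" for r x
    using I.I_l_closed[OF that(2)] that(1) by (simp add: ring_str_def)
  have add: "x + y \<in> I" if "x \<in> I" "y \<in> I" for x y
    using additive_subgroup.a_closed[OF ideal.axioms(1)[OF I] that] by (simp add: ring_str_def)
  have "0 \<in> I" using additive_subgroup.zero_closed[OF ideal.axioms(1)[OF I]] by (simp add: ring_str_def)
  moreover have "x - y \<in> I" if "x \<in> I" "y \<in> I" for x y
    using add[OF that(1) mult[OF R_closed(6)[OF one_closed] that(2)]] by simp
  ultimately show "rideal I" using sub mult by (simp add: rideal_def add_subgroup_def)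
next
  assume I: "rideal I"
  note ID = ridealD[OF I]
  note IG = add_subgroupD[OF ID(2)]
  interpret cring ring_str by (rule cring_ring_str)
  show "ideal I ring_str"
  proof (rule idealI)
    show "subgroup I (add_monoid ring_str)"
    proof
      show "inv\<^bsub>add_monoid ring_str\<^esub> x \<in> I" if x: "x \<in> I" for x
      proof -
        have "\<ominus>\<^bsub>ring_str\<^esub> x = - x"
          by (rule minus_equality) (use x ID(1) R_closed(6) in \<open>auto simp: ring_str_def\<close>)
        thus ?thesis using IG x by (simp add: a_inv_def)
      qed
    qed (use ID IG in \<open>auto simp: ring_str_def\<close>)
  qed (use ID cring.axioms(1)[OF cring_ring_str] in \<open>auto simp: ring_str_def\<close>)
qed

lemma card_Quot_ring_str: "card (carrier (ring_str Quot I)) = idx R I"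
proof -
  have "I +>\<^bsub>ring_str\<^esub> x = add_coset I x" for x
  proof -
    have "(\<Union>h\<in>I. {h + x}) = {y. y - x \<in> I}"
      by (auto intro!: bexI[of _ "_ - x"])
    thus ?thesis by (simp add: a_r_coset_def r_coset_def ring_str_def add_coset_def)
  qed
  hence "carrier (ring_str Quot I) = cosets R I"
    by (auto simp: FactRing_def A_RCOSETS_def RCOSETS_def a_r_coset_def cosets_def ring_str_def)
  thus ?thesis by (simp add: idx_def)
qed

end

text \<open>All x^n c lie in O, and O / c O is finite, so x^j c and x^i c agree modulo c O for some
  i < j. After cancelling c, the monic integral polynomial X^j - X^i takes an algebraic integer as
  its value at x; then x is one too.\<close>

lemma completely_integrally_closed_algebraic_ints:
  fixes x c :: "'k :: field_char_0"
  assumes K: "number_field TYPE('k)" and c: "c \<noteq> 0" and pow: "\<And>n. algebraic_int (x ^ n * c)"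
  shows "algebraic_int x"
proof -
  let ?O = "algebraic_ints :: 'k set"
  define P where "P = (*) c ` ?O"
  have P: "add_subgroup P" unfolding P_def by (rule add_subgroup_mult_image[OF add_subgroup_algebraic_ints])
  have "algebraic_int c" using pow[of 0] by simp
  hence fin: "finite (cosets ?O P)"
    using finite_algebraic_ints_mod[OF K _ c] by (simp add: P_def idx_def card_gt_0_iff)
  have "\<not> inj (\<lambda>n. add_coset P (x ^ n * c))"
  proof
    assume "inj (\<lambda>n. add_coset P (x ^ n * c))"
    moreover have "range (\<lambda>n. add_coset P (x ^ n * c)) \<subseteq> cosets ?O P" using pow by (auto simp: cosets_def)
    hence "finite (range (\<lambda>n. add_coset P (x ^ n * c)))" using fin finite_subset by blast
    ultimately show False using finite_imageD infinite_UNIV_nat by blast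
  qed
  then obtain i j where ij: "i < j" "add_coset P (x ^ j * c) = add_coset P (x ^ i * c)"
    unfolding inj_on_def by (metis linorder_neqE_nat)
  hence "x ^ j * c - x ^ i * c \<in> P" using coset_eq_iff[OF P] by blast
  then obtain s where s: "algebraic_int s" "x ^ j * c - x ^ i * c = c * s" by (auto simp: P_def)
  have "c * (x ^ j - x ^ i) = c * s" using s(2) by (simp add: algebra_simps)
  hence xs: "x ^ j - x ^ i = s" using c by simp
  define p where "p = monom 1 j - monom (1 :: 'k) i"
  have co: "coeff p l = (if l = j then 1 else if l = i then - 1 else 0)" for l
    using ij(1) by (auto simp: p_def)
  have deg: "degree p = j"
  proof (rule antisym)
    show "degree p \<le> j" by (rule degree_le) (use ij(1) in \<open>auto simp: co\<close>)
    show "j \<le> degree p" by (rule le_degree) (simp add: co)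
  qed
  show ?thesis
  proof (rule algebraic_int_root[OF s(1)])
    show "poly p x = s" using xs by (simp add: p_def poly_monom)
    show "\<forall>l. coeff p l \<in> \<int>" by (simp add: co)
    show "lead_coeff p = 1" by (simp add: deg co)
    show "degree p > 0" using ij(1) by (simp add: deg)
  qed
qed

theorem theorem1:
  fixes m n :: nat
  assumes "number_field TYPE('k :: field_char_0)"
    and "1 \<le> m" and "m \<le> n"
  shows "(\<forall>d\<ge>1. finite (Irr (Gmn m n (ring_of_integers :: 'k ring)) d //
                       twist_rel (Gmn m n (ring_of_integers :: 'k ring)) d)) \<and>
    twist_zeta (Gmn m n (ring_of_integers :: 'k ring)) =
      (\<Prod>i<m. fds_shift (n + i) (dedekind_zeta TYPE('k)) / fds_shift i (dedekind_zeta TYPE('k)))"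
proof -
  interpret gmn "algebraic_ints :: 'k set" m n
  proof unfold_locales
    show "x \<in> algebraic_ints" if "c \<noteq> 0" "\<And>n. x ^ n * c \<in> algebraic_ints" for x c :: 'k
      using completely_integrally_closed_algebraic_ints[OF assms(1) that(1)] that(2) by simp
  qed (use finite_algebraic_ints_mod[OF assms(1)] in
    \<open>auto intro: algebraic_int_diff algebraic_int_mult\<close>)
  have ring: "ring_of_integers = ring_str"
    unfolding ring_of_integers_def ring_str_def by (simp add: algebraic_ints_def)
  have "dedekind_zeta TYPE('k) = fds (\<lambda>k. of_nat (ideal_count k))"
  proof (rule fds_eqI)
    fix k :: nat assume k: "k > 0"
    \<comment> \<open>An ideal of positive index k contains the nonzero integer k, so it satisfies
      the nonzero condition in \<open>dedekind_zeta\<close>.\<close>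
    have "I \<noteq> {0}" if "rideal I" "idx algebraic_ints I = k" for I
      using idx_pos_nonzero[OF that(1)] that(2) k by auto
    hence "{I. ideal I ring_str \<and> I \<noteq> {0} \<and> card (carrier (ring_str Quot I)) = k} =
        {I. rideal I \<and> idx algebraic_ints I = k}"
      by (auto simp: ideal_ring_str_iff card_Quot_ring_str)
    thus "fds_nth (dedekind_zeta TYPE('k)) k = fds_nth (fds (\<lambda>k. of_nat (ideal_count k))) k"
      by (simp add: dedekind_zeta_def fds_nth_fds ring ideal_count_def)
  qed
  thus ?thesis using twist_zeta_G by (simp add: ring)
qed

end
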